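(* Let $(M,P,\Phi)$ be a Hamiltonian quasi-Poisson $G$-variety, where $G$ admits a decomposition $G=G'\times\prod_{j=1}^\ell G_j$ such that for each $1\leq j\leq\ell$, $\mathbb{C}^\times$ embeds in the center of $G_j$ as diagonal matrices (i.e. via $\lambda\mapsto\lambda\,\mathrm{Id}_{G_j}$). For each $j$, let $\mathrm{Inf}^{(j)}$ be the vector field on $M$ given by the infinitesimal action of $1\in\mathbb{C}$ associated with the embedding of $\mathbb{C}^\times$ into $G_j$. Write $\Phi=(\Phi',\Phi_1,\dots,\Phi_\ell)$ with $\Phi':M\to G'$ and $\Phi_j:M\to G_j$. Fix $\underline{z}=(z_{ij})_{1\leq i<j\leq\ell}\in\mathbb{C}^{\ell(\ell-1)/2}$. Then: (1) The triple $(M,P+\psi_{\underline z},\Phi)$ is a Hamiltonian quasi-Poisson $G$-variety for $$\psi_{\underline z}:=\sum_{1\leq i<j\leq\ell}z_{ij}\,\mathrm{Inf}^{(i)}\wedge\mathrm{Inf}^{(j)}.$$ (2) Assume that $P$ is non-degenerate and $\omega$ is the corresponding quasi-Hamiltonian 2-form. Let $$\varpi_{\underline z}:=\sum_{1\leq i<j\leq\ell}z_{ij}\,\mathrm{tr}(\Phi_i^{-1}d\Phi_i)\wedge\mathrm{tr}(\Phi_j^{-1}d\Phi_j).$$ Then $P+\psi_{\underline z}$ is non-degenerate, and $(M,\omega+\varpi_{\underline z},\Phi)$ is the corresponding quasi-Hamiltonian variety.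
   Context: Everything is over $\mathbb{C}$; wedges mean $u\wedge v=u\otimes v-v\otimes u$. $G\subset\mathrm{GL}_N(\mathbb{C})$ is a complex reductive algebraic subgroup, with Lie algebra $\mathfrak{g}\subset\mathfrak{gl}_N(\mathbb{C})$ on which the trace form $(\xi,\xi')_{\mathfrak g}=\mathrm{tr}(\xi\xi')$ is non-degenerate; $(E_a),(E^a)$ are dual bases. A product decomposition $G=G'\times\prod_jG_j$ is understood block-diagonally: each $G_j$ is a matrix group sitting as a diagonal block in $\mathrm{GL}_N(\mathbb{C})$, and $\Phi_j$ is the corresponding diagonal block of $\Phi$. Set $\phi:=\frac1{12}\sum_{a,b,c}(E^a,[E^b,E^c])_{\mathfrak g}\,E_a\wedge E_b\wedge E_c$. For $\xi\in\mathfrak g$, $\xi^L(F)(g)=\frac{d}{dt}|_{0}F(ge^{t\xi})$, $\xi^R(F)(g)=\frac{d}{dt}|_0F(e^{t\xi}g)$, and $\mathcal{D}(F):=\frac12\sum_a(E_a^L+E_a^R)(F)\,E^a$. Let $\theta^L=g^{-1}dg$, $\theta^R=dg\,g^{-1}$, $\eta:=\frac16\mathrm{tr}(dg\,g^{-1}\wedge dg\,g^{-1}\wedge dg\,g^{-1})$. $M$ is an affine complex variety with a left $G$-action; $\xi_M(f)(x)=\frac{d}{dt}|_0 f(\exp(-t\xi)\cdot x)$, extended to $\bigwedge^\bullet\mathfrak g$ (so $\mathrm{Inf}^{(j)}=(1_{\mathfrak g_j})_M$, with $1_{\mathfrak g_j}$ the identity matrix of the $j$-th block). For a bivector $P$,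 $P^\sharp(\alpha_1)(\alpha_2)=\langle P,\alpha_1\otimes\alpha_2\rangle$; for a 2-form $\omega$, $\omega^\flat(X_1)(X_2)=\langle X_1\otimes X_2,\omega\rangle$. A $G$-invariant bivector $P$ on $M$ is *quasi-Poisson* if $[P,P]=\phi_M$ (Schouten bracket). It is *non-degenerate* if for all $x\in M$ the map $T_x^*M\times\mathfrak g\to T_xM$, $(\alpha,\xi)\mapsto P_x^\sharp(\alpha)+\xi_{M,x}$ is surjective. A *moment map* is a $G$-equivariant morphism $\Phi:M\to G$ (adjoint action on $G$) with $P^\sharp(d(\Phi^*F))=(\Phi^*\mathcal{D}(F))_M$ for all functions $F$ on $G$; then $(M,P,\Phi)$ is a *Hamiltonian quasi-Poisson variety*. A triple $(M,\omega,\Phi)$ with $\omega$ a $G$-invariant 2-form and $\Phi:M\to G$ a $G$-equivariant morphism is a *quasi-Hamiltonian variety* if $d\omega=\Phi^*\eta$; $\omega^\flat(\xi_M)=\frac12\Phi^*(\xi,\theta^L+\theta^R)_{\mathfrak g}$ for all $\xi\in\mathfrak g$; and for all $x\in M$ the map $T_xM\to T_x^*M\times\mathfrak g$, $X\mapsto(\omega_x^\flat(X),\langle X,(\Phi^*\theta^L)_x\rangle)$ is injective. Non-degenerate Hamiltonian quasi-Poisson structures and quasi-Hamiltonian structures on $M$ with the same moment map are in bijection ( *correspond* ) via $P^\sharp\circ\omega^\flat=\mathrm{Id}_{TM}-\frac14\sum_a(E_a)_M\otimes\Phi^*(E^a,\theta^L-\theta^R)_{\mathfrak g}$. *)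

theory Defs
  imports "HOL-Analysis.Analysis" "HOL-Library.Poly_Mapping"
begin

section \<open>Algebras of functions and affine varieties\<close>

text \<open>The \<open>\<complex>\<close>-algebra of functions generated by a set of functions.\<close>

inductive_set gen_alg :: "('a \<Rightarrow> complex) set \<Rightarrow> ('a \<Rightarrow> complex) set"
  for B :: "('a \<Rightarrow> complex) set" where
  const: "(\<lambda>_. c) \<in> gen_alg B"
| gen: "b \<in> B \<Longrightarrow> b \<in> gen_alg B"
| add: "f \<in> gen_alg B \<Longrightarrow> g \<in> gen_alg B \<Longrightarrow> (\<lambda>x. f x + g x) \<in> gen_alg B"
| mult: "f \<in> gen_alg B \<Longrightarrow> g \<in> gen_alg B \<Longrightarrow> (\<lambda>x. f x * g x) \<in> gen_alg B"

definition alg_character :: "('m \<Rightarrow> complex) set \<Rightarrow> (('m \<Rightarrow> complex) \<Rightarrow> complex) \<Rightarrow> bool" where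
  "alg_character A ch \<longleftrightarrow>
     (\<forall>c. ch (\<lambda>_. c) = c) \<and>
     (\<forall>f\<in>A. \<forall>g\<in>A. ch (\<lambda>x. f x + g x) = ch f + ch g \<and> ch (\<lambda>x. f x * g x) = ch f * ch g)"

text \<open>An affine variety is given by its set of closed points, which is the whole type \<open>'m\<close>,
  and its coordinate ring \<open>A\<close>: a finitely generated (automatically reduced) algebra of functions
  on the points, such that points are the same as algebra homomorphisms \<open>A \<rightarrow> \<complex>\<close>
  (equivalently, maximal ideals of \<open>A\<close>). Neither smoothness nor irreducibility is required.\<close>

definition affine_variety :: "('m \<Rightarrow> complex) set \<Rightarrow> bool" where
  "affine_variety A \<longleftrightarrow>
     (\<exists>B. finite B \<and> A = gen_alg B) \<and>
     (\<forall>ch. alg_character A ch \<longrightarrow> (\<exists>!x. \<forall>f\<in>A. ch f = f x))"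


section \<open>Matrices and linear algebraic groups\<close>

type_synonym 'n cmat = "complex^'n^'n"

definition cscale :: "complex \<Rightarrow> 'n::finite cmat \<Rightarrow> 'n cmat" where
  "cscale c X = map_matrix (\<lambda>y. c * y) X"

text \<open>The power and exponential operations of the library refer to the componentwise product.\<close>

definition matpow :: "'n::finite cmat \<Rightarrow> nat \<Rightarrow> 'n cmat" where
  "matpow X k = (((**) X) ^^ k) (mat 1)"

definition mexp :: "'n::finite cmat \<Rightarrow> 'n cmat" where
  "mexp X = suminf (\<lambda>k. (1 / fact k) *\<^sub>R matpow X k)"

definition bracket :: "'n::finite cmat \<Rightarrow> 'n cmat \<Rightarrow> 'n cmat" where
  "bracket X Y = X ** Y - Y ** X"

definition tr_form :: "'n::finite cmat \<Rightarrow> 'n cmat \<Rightarrow> complex" where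
  "tr_form X Y = trace (X ** Y)"

definition polyfun :: "('n::finite cmat \<Rightarrow> complex) set" where
  "polyfun = gen_alg {\<lambda>g. g $ i $ j | i j. True}"

text \<open>Regular functions on \<open>GL\<^sub>N\<close>; those on a closed subgroup are their restrictions. The
  values at singular matrices are irrelevant.\<close>

definition regfun :: "('n::finite cmat \<Rightarrow> complex) set" where
  "regfun = gen_alg ({\<lambda>g. g $ i $ j | i j. True} \<union> {\<lambda>g. inverse (det g)})"

definition GL_closed :: "('n::finite cmat) set \<Rightarrow> bool" where
  "GL_closed X \<longleftrightarrow> (\<exists>S \<subseteq> polyfun. X = {g. invertible g \<and> (\<forall>p\<in>S. p g = 0)})"

definition matrix_group :: "('n::finite cmat) set \<Rightarrow> bool" where
  "matrix_group G \<longleftrightarrow>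
     (\<forall>g\<in>G. invertible g) \<and> mat 1 \<in> G \<and>
     (\<forall>g\<in>G. \<forall>h\<in>G. g ** h \<in> G) \<and> (\<forall>g\<in>G. matrix_inv g \<in> G)"

definition GL_connected :: "('n::finite cmat) set \<Rightarrow> bool" where
  "GL_connected U \<longleftrightarrow>
     \<not> (\<exists>X Y. GL_closed X \<and> GL_closed Y \<and> X \<noteq> {} \<and> Y \<noteq> {} \<and> X \<inter> Y = {} \<and> X \<union> Y = U)"

text \<open>Reductive: the unipotent radical is trivial.\<close>

definition reductive_group :: "('n::finite cmat) set \<Rightarrow> bool" where
  "reductive_group G \<longleftrightarrow>
     GL_closed G \<and> matrix_group G \<and>
     (\<forall>U \<subseteq> G. GL_closed U \<and> matrix_group U \<and> GL_connected U \<and>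
        (\<forall>g\<in>G. \<forall>u\<in>U. g ** u ** matrix_inv g \<in> U) \<and>
        (\<forall>u\<in>U. \<exists>k. matpow (u - mat 1) k = 0)
        \<longrightarrow> U = {mat 1})"

definition lie_alg :: "('n::finite cmat) set \<Rightarrow> 'n cmat set" where
  "lie_alg G = {\<xi>. \<forall>t::complex. mexp (cscale t \<xi>) \<in> G}"

definition tr_form_nondegenerate :: "('n::finite cmat) set \<Rightarrow> bool" where
  "tr_form_nondegenerate V \<longleftrightarrow> (\<forall>\<xi>\<in>V. (\<forall>\<xi>'\<in>V. tr_form \<xi> \<xi>' = 0) \<longrightarrow> \<xi> = 0)"

definition complex_basis :: "('n::finite cmat) set \<Rightarrow> nat \<Rightarrow> (nat \<Rightarrow> 'n cmat) \<Rightarrow> bool" where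
  "complex_basis V d E \<longleftrightarrow>
     (\<forall>a<d. E a \<in> V) \<and>
     (\<forall>\<xi>\<in>V. \<exists>c. \<xi> = (\<Sum>a<d. cscale (c a) (E a))) \<and>
     (\<forall>c. (\<Sum>a<d. cscale (c a) (E a)) = 0 \<longrightarrow> (\<forall>a<d. c a = 0))"

definition dual_bases ::
  "('n::finite cmat) set \<Rightarrow> nat \<Rightarrow> (nat \<Rightarrow> 'n cmat) \<Rightarrow> (nat \<Rightarrow> 'n cmat) \<Rightarrow> bool" where
  "dual_bases V d E E' \<longleftrightarrow>
     complex_basis V d E \<and> complex_basis V d E' \<and>
     (\<forall>a<d. \<forall>b<d. tr_form (E a) (E' b) = (if a = b then 1 else 0))"

definition left_der :: "'n::finite cmat \<Rightarrow> ('n cmat \<Rightarrow> complex) \<Rightarrow> 'n cmat \<Rightarrow> complex" where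
  "left_der \<xi> F g = deriv (\<lambda>t. F (g ** mexp (cscale t \<xi>))) 0"

definition right_der :: "'n::finite cmat \<Rightarrow> ('n cmat \<Rightarrow> complex) \<Rightarrow> 'n cmat \<Rightarrow> complex" where
  "right_der \<xi> F g = deriv (\<lambda>t. F (mexp (cscale t \<xi>) ** g)) 0"

definition D_op ::
  "nat \<Rightarrow> (nat \<Rightarrow> 'n::finite cmat) \<Rightarrow> (nat \<Rightarrow> 'n cmat) \<Rightarrow> ('n cmat \<Rightarrow> complex) \<Rightarrow> 'n cmat \<Rightarrow> 'n cmat" where
  "D_op d E E' F g =
     (\<Sum>a<d. cscale (1/2 * (left_der (E a) F g + right_der (E a) F g)) (E' a))"


section \<open>Actions\<close>

text \<open>Regularity of \<open>G \<times> M \<rightarrow> M\<close> is expressed through \<open>\<complex>[G \<times> M] = \<complex>[G] \<otimes> A\<close>.\<close>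

definition algebraic_action ::
  "('m \<Rightarrow> complex) set \<Rightarrow> ('n::finite cmat) set \<Rightarrow> ('n cmat \<Rightarrow> 'm \<Rightarrow> 'm) \<Rightarrow> bool" where
  "algebraic_action A G act \<longleftrightarrow>
     (\<forall>x. act (mat 1) x = x) \<and>
     (\<forall>g\<in>G. \<forall>h\<in>G. \<forall>x. act (g ** h) x = act g (act h x)) \<and>
     (\<forall>f\<in>A. \<exists>k::nat. \<exists>u v. (\<forall>i<k. u i \<in> regfun \<and> v i \<in> A) \<and>
        (\<forall>g\<in>G. \<forall>x. f (act g x) = (\<Sum>i<k. u i g * v i x)))"

definition inf_act ::
  "('n::finite cmat \<Rightarrow> 'm \<Rightarrow> 'm) \<Rightarrow> 'n cmat \<Rightarrow> ('m \<Rightarrow> complex) \<Rightarrow> 'm \<Rightarrow> complex" where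
  "inf_act act \<xi> f x = deriv (\<lambda>t. f (act (mexp (cscale (- t) \<xi>)) x)) 0"

definition equivariant_morphism ::
  "('m \<Rightarrow> complex) set \<Rightarrow> ('n::finite cmat) set \<Rightarrow> ('n cmat \<Rightarrow> 'm \<Rightarrow> 'm) \<Rightarrow> ('m \<Rightarrow> 'n cmat) \<Rightarrow> bool" where
  "equivariant_morphism A G act \<Phi> \<longleftrightarrow>
     (\<forall>x. \<Phi> x \<in> G) \<and> (\<forall>F\<in>regfun. (\<lambda>x. F (\<Phi> x)) \<in> A) \<and>
     (\<forall>g\<in>G. \<forall>x. \<Phi> (act g x) = g ** \<Phi> x ** matrix_inv g)"


section \<open>Polyvector fields\<close>

text \<open>Vector fields are derivations of \<open>A\<close>, bivector fields are skew-symmetric biderivations,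
  where \<open>P f g\<close> stands for \<open>\<langle>P, df \<otimes> dg\<rangle>\<close>.  Values at arguments outside \<open>A\<close> are irrelevant.\<close>

definition bivector ::
  "('m \<Rightarrow> complex) set \<Rightarrow> (('m \<Rightarrow> complex) \<Rightarrow> ('m \<Rightarrow> complex) \<Rightarrow> 'm \<Rightarrow> complex) \<Rightarrow> bool" where
  "bivector A P \<longleftrightarrow>
     (\<forall>f\<in>A. \<forall>g\<in>A. P f g \<in> A) \<and>
     (\<forall>f\<in>A. \<forall>g\<in>A. \<forall>x. P f g x = - P g f x) \<and>
     (\<forall>c. \<forall>f\<in>A. \<forall>x. P f (\<lambda>_. c) x = 0) \<and>
     (\<forall>f\<in>A. \<forall>g\<in>A. \<forall>h\<in>A. \<forall>x. P f (\<lambda>y. g y + h y) x = P f g x + P f h x) \<and>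
     (\<forall>f\<in>A. \<forall>g\<in>A. \<forall>h\<in>A. \<forall>x. P f (\<lambda>y. g y * h y) x = P f g x * h x + g x * P f h x)"

definition bivector_invariant ::
  "('m \<Rightarrow> complex) set \<Rightarrow> ('n::finite cmat) set \<Rightarrow> ('n cmat \<Rightarrow> 'm \<Rightarrow> 'm) \<Rightarrow>
   (('m \<Rightarrow> complex) \<Rightarrow> ('m \<Rightarrow> complex) \<Rightarrow> 'm \<Rightarrow> complex) \<Rightarrow> bool" where
  "bivector_invariant A G act P \<longleftrightarrow>
     (\<forall>g\<in>G. \<forall>f\<in>A. \<forall>h\<in>A. \<forall>x.
        P (\<lambda>y. f (act g y)) (\<lambda>y. h (act g y)) x = P f h (act g x))"

definition bivector_add ::
  "(('m \<Rightarrow> complex) \<Rightarrow> ('m \<Rightarrow> complex) \<Rightarrow> 'm \<Rightarrow> complex) \<Rightarrow>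
   (('m \<Rightarrow> complex) \<Rightarrow> ('m \<Rightarrow> complex) \<Rightarrow> 'm \<Rightarrow> complex) \<Rightarrow>
   ('m \<Rightarrow> complex) \<Rightarrow> ('m \<Rightarrow> complex) \<Rightarrow> 'm \<Rightarrow> complex" where
  "bivector_add P Q f g x = P f g x + Q f g x"

text \<open>Wedge products of vector fields, normalised by
  \<open>X\<^sub>1 \<and> \<dots> \<and> X\<^sub>k = \<Sum>\<^sub>\<sigma> sgn(\<sigma>) X\<^bsub>\<sigma>(1)\<^esub> \<otimes> \<dots> \<otimes> X\<^bsub>\<sigma>(k)\<^esub>\<close>.\<close>

definition wedge2 ::
  "(('m \<Rightarrow> complex) \<Rightarrow> 'm \<Rightarrow> complex) \<Rightarrow> (('m \<Rightarrow> complex) \<Rightarrow> 'm \<Rightarrow> complex) \<Rightarrow>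
   ('m \<Rightarrow> complex) \<Rightarrow> ('m \<Rightarrow> complex) \<Rightarrow> 'm \<Rightarrow> complex" where
  "wedge2 X Y f g x = X f x * Y g x - Y f x * X g x"

definition wedge3 ::
  "(('m \<Rightarrow> complex) \<Rightarrow> 'm \<Rightarrow> complex) \<Rightarrow> (('m \<Rightarrow> complex) \<Rightarrow> 'm \<Rightarrow> complex) \<Rightarrow>
   (('m \<Rightarrow> complex) \<Rightarrow> 'm \<Rightarrow> complex) \<Rightarrow>
   ('m \<Rightarrow> complex) \<Rightarrow> ('m \<Rightarrow> complex) \<Rightarrow> ('m \<Rightarrow> complex) \<Rightarrow> 'm \<Rightarrow> complex" where
  "wedge3 X Y Z f g h x =
       X f x * Y g x * Z h x + Y f x * Z g x * X h x + Z f x * X g x * Y h x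
     - Y f x * X g x * Z h x - X f x * Z g x * Y h x - Z f x * Y g x * X h x"

text \<open>The Schouten bracket of two bivector fields, as a triderivation; in particular
  \<open>[P,P](f,g,h) = 2 ({f,{g,h}} + {g,{h,f}} + {h,{f,g}})\<close>. Sign and normalisation are those of
  \<open>[X\<^sub>1 \<and> X\<^sub>2, Y\<^sub>1 \<and> Y\<^sub>2] = \<Sum>\<^sub>i\<^sub>j (-1)\<^bsup>i+j\<^esup> [X\<^sub>i,Y\<^sub>j] \<and> X\<^bsub>3-i\<^esub> \<and> Y\<^bsub>3-j\<^esub>\<close>,
  see the lemma \<open>schouten_wedge2\<close>.\<close>

definition schouten ::
  "(('m \<Rightarrow> complex) \<Rightarrow> ('m \<Rightarrow> complex) \<Rightarrow> 'm \<Rightarrow> complex) \<Rightarrow>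
   (('m \<Rightarrow> complex) \<Rightarrow> ('m \<Rightarrow> complex) \<Rightarrow> 'm \<Rightarrow> complex) \<Rightarrow>
   ('m \<Rightarrow> complex) \<Rightarrow> ('m \<Rightarrow> complex) \<Rightarrow> ('m \<Rightarrow> complex) \<Rightarrow> 'm \<Rightarrow> complex" where
  "schouten P Q f g h x =
       P f (Q g h) x + P g (Q h f) x + P h (Q f g) x
     + Q f (P g h) x + Q g (P h f) x + Q h (P f g) x"

definition derivation ::
  "('m \<Rightarrow> complex) set \<Rightarrow> (('m \<Rightarrow> complex) \<Rightarrow> 'm \<Rightarrow> complex) \<Rightarrow> bool" where
  "derivation A X \<longleftrightarrow>
     (\<forall>f\<in>A. X f \<in> A) \<and> (\<forall>c. \<forall>x. X (\<lambda>_. c) x = 0) \<and>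
     (\<forall>f\<in>A. \<forall>g\<in>A. \<forall>x. X (\<lambda>y. f y + g y) x = X f x + X g x) \<and>
     (\<forall>f\<in>A. \<forall>g\<in>A. \<forall>x. X (\<lambda>y. f y * g y) x = X f x * g x + f x * X g x)"

lemma derivation_wedge2:
  assumes A: "A = gen_alg B" and X: "derivation A X"
    and U: "derivation A U" and V: "derivation A V" and f: "f \<in> A" and g: "g \<in> A"
  shows "X (wedge2 U V f g) x =
    X (U f) x * V g x + U f x * X (V g) x - X (V f) x * U g x - V f x * X (U g) x"
proof -
  have m: "(\<lambda>y. p y * q y) \<in> A" if "p \<in> A" "q \<in> A" for p q
    using that A gen_alg.mult by blast
  have c: "(\<lambda>y. -1) \<in> A" using A gen_alg.const by blast
  have UV: "U f \<in> A" "V f \<in> A" "U g \<in> A" "V g \<in> A"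
    using U V f g unfolding derivation_def by auto
  have X0: "X (\<lambda>_. k) x = 0" for k using X unfolding derivation_def by auto
  have Xa: "X (\<lambda>y. p y + q y) x = X p x + X q x" if "p \<in> A" "q \<in> A" for p q
    using X that unfolding derivation_def by auto
  have Xm: "X (\<lambda>y. p y * q y) x = X p x * q x + p x * X q x" if "p \<in> A" "q \<in> A" for p q
    using X that unfolding derivation_def by auto
  have e: "wedge2 U V f g = (\<lambda>y. U f y * V g y + - 1 * (V f y * U g y))"
    by (auto simp: wedge2_def)
  have "X (wedge2 U V f g) x = X (\<lambda>y. U f y * V g y) x + X (\<lambda>y. - 1 * (V f y * U g y)) x"
    unfolding e by (rule Xa) (intro m c UV)+
  also have "X (\<lambda>y. - 1 * (V f y * U g y)) x = - X (\<lambda>y. V f y * U g y) x"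
    using Xm[OF c m[OF UV(2) UV(3)]] X0 by simp
  finally show ?thesis
    using Xm[OF UV(1) UV(4)] Xm[OF UV(2) UV(3)] by simp
qed

lemma schouten_wedge2:
  assumes A: "A = gen_alg B"
    and D: "derivation A X" "derivation A Y" "derivation A U" "derivation A V"
    and F: "f \<in> A" "g \<in> A" "h \<in> A"
  defines "lie \<equiv> \<lambda>X Y f x. X (Y f) x - Y (X f) x"
  shows "schouten (wedge2 X Y) (wedge2 U V) f g h x =
      wedge3 (lie X U) Y V f g h x - wedge3 (lie X V) Y U f g h x
    - wedge3 (lie Y U) X V f g h x + wedge3 (lie Y V) X U f g h x"
proof -
  have w: "wedge2 P Q p q x = P p x * Q q x - Q p x * P q x" for P Q p q
    by (simp add: wedge2_def)
  note d = derivation_wedge2[OF A]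
  have 1: "X (wedge2 U V p q) x = X (U p) x * V q x + U p x * X (V q) x - X (V p) x * U q x - V p x * X (U q) x"
    if "p \<in> A" "q \<in> A" for p q using d D that by blast
  have 2: "Y (wedge2 U V p q) x = Y (U p) x * V q x + U p x * Y (V q) x - Y (V p) x * U q x - V p x * Y (U q) x"
    if "p \<in> A" "q \<in> A" for p q using d D that by blast
  have 3: "U (wedge2 X Y p q) x = U (X p) x * Y q x + X p x * U (Y q) x - U (Y p) x * X q x - Y p x * U (X q) x"
    if "p \<in> A" "q \<in> A" for p q using d D that by blast
  have 4: "V (wedge2 X Y p q) x = V (X p) x * Y q x + X p x * V (Y q) x - V (Y p) x * X q x - Y p x * V (X q) x"
    if "p \<in> A" "q \<in> A" for p q using d D that by blast
  show ?thesis
    unfolding schouten_def wedge3_def lie_def w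
      1[OF F(1,2)] 1[OF F(2,3)] 1[OF F(3,1)] 2[OF F(1,2)] 2[OF F(2,3)] 2[OF F(3,1)]
      3[OF F(1,2)] 3[OF F(2,3)] 3[OF F(3,1)] 4[OF F(1,2)] 4[OF F(2,3)] 4[OF F(3,1)]
    by algebra
qed

definition phi_M ::
  "('n::finite cmat \<Rightarrow> 'm \<Rightarrow> 'm) \<Rightarrow> nat \<Rightarrow> (nat \<Rightarrow> 'n cmat) \<Rightarrow> (nat \<Rightarrow> 'n cmat) \<Rightarrow>
   ('m \<Rightarrow> complex) \<Rightarrow> ('m \<Rightarrow> complex) \<Rightarrow> ('m \<Rightarrow> complex) \<Rightarrow> 'm \<Rightarrow> complex" where
  "phi_M act d E E' f g h x =
     1/12 * (\<Sum>a<d. \<Sum>b<d. \<Sum>c<d. tr_form (E' a) (bracket (E' b) (E' c)) *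
        wedge3 (inf_act act (E a)) (inf_act act (E b)) (inf_act act (E c)) f g h x)"

definition quasi_Poisson where
  "quasi_Poisson A G act d E E' P \<longleftrightarrow>
     bivector A P \<and> bivector_invariant A G act P \<and>
     (\<forall>f\<in>A. \<forall>g\<in>A. \<forall>h\<in>A. \<forall>x. schouten P P f g h x = phi_M act d E E' f g h x)"

text \<open>Moment map condition: \<open>P\<^sup>\<sharp>(d(\<Phi>\<^sup>*F)) = (\<Phi>\<^sup>*D(F))\<^sub>M\<close>, both sides applied to \<open>h\<close> at \<open>x\<close>.\<close>

definition hamiltonian_quasi_Poisson where
  "hamiltonian_quasi_Poisson A G act d E E' P \<Phi> \<longleftrightarrow>
     quasi_Poisson A G act d E E' P \<and> equivariant_morphism A G act \<Phi> \<and>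
     (\<forall>F\<in>regfun. \<forall>h\<in>A. \<forall>x.
        P (\<lambda>y. F (\<Phi> y)) h x = inf_act act (D_op d E E' F (\<Phi> x)) h x)"


section \<open>Tangent and cotangent spaces\<close>

text \<open>Point derivations of \<open>A\<close> at \<open>x\<close>; they are set to \<open>0\<close> outside \<open>A\<close> so that equality
  of tangent vectors is equality of functions.\<close>

definition tangent :: "('m \<Rightarrow> complex) set \<Rightarrow> 'm \<Rightarrow> (('m \<Rightarrow> complex) \<Rightarrow> complex) set" where
  "tangent A x = {v.
     (\<forall>f. f \<notin> A \<longrightarrow> v f = 0) \<and> (\<forall>c. v (\<lambda>_. c) = 0) \<and>
     (\<forall>f\<in>A. \<forall>g\<in>A. v (\<lambda>y. f y + g y) = v f + v g) \<and>
     (\<forall>f\<in>A. \<forall>g\<in>A. v (\<lambda>y. f y * g y) = v f * g x + f x * v g)}"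

definition cotangent ::
  "('m \<Rightarrow> complex) set \<Rightarrow> 'm \<Rightarrow> ((('m \<Rightarrow> complex) \<Rightarrow> complex) \<Rightarrow> complex) set" where
  "cotangent A x = {\<alpha>.
     (\<forall>v. v \<notin> tangent A x \<longrightarrow> \<alpha> v = 0) \<and>
     (\<forall>v\<in>tangent A x. \<forall>w\<in>tangent A x. \<alpha> (\<lambda>f. v f + w f) = \<alpha> v + \<alpha> w) \<and>
     (\<forall>c. \<forall>v\<in>tangent A x. \<alpha> (\<lambda>f. c * v f) = c * \<alpha> v)}"

text \<open>\<open>P\<^sub>x\<^sup>\<sharp>(\<alpha>) \<in> T\<^sub>xM\<close>, which maps \<open>h\<close> to \<open>\<langle>P\<^sub>x, \<alpha> \<otimes> d\<^sub>xh\<rangle>\<close>, that is, to the value of \<open>\<alpha>\<close> on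
  the tangent vector \<open>f \<mapsto> \<langle>P\<^sub>x, d\<^sub>xf \<otimes> d\<^sub>xh\<rangle>\<close>.\<close>

definition sharp_at ::
  "('m \<Rightarrow> complex) set \<Rightarrow> (('m \<Rightarrow> complex) \<Rightarrow> ('m \<Rightarrow> complex) \<Rightarrow> 'm \<Rightarrow> complex) \<Rightarrow> 'm \<Rightarrow>
   ((('m \<Rightarrow> complex) \<Rightarrow> complex) \<Rightarrow> complex) \<Rightarrow> ('m \<Rightarrow> complex) \<Rightarrow> complex" where
  "sharp_at A P x \<alpha> =
     (\<lambda>h. if h \<in> A then \<alpha> (\<lambda>f. if f \<in> A then P f h x else 0) else 0)"

definition inf_act_at ::
  "('m \<Rightarrow> complex) set \<Rightarrow> ('n::finite cmat \<Rightarrow> 'm \<Rightarrow> 'm) \<Rightarrow> 'n cmat \<Rightarrow> 'm \<Rightarrow>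
   ('m \<Rightarrow> complex) \<Rightarrow> complex" where
  "inf_act_at A act \<xi> x = (\<lambda>f. if f \<in> A then inf_act act \<xi> f x else 0)"

definition nondegenerate where
  "nondegenerate A G act P \<longleftrightarrow>
     (\<forall>x. tangent A x \<subseteq>
        (\<lambda>(\<alpha>, \<xi>). (\<lambda>f. sharp_at A P x \<alpha> f + inf_act_at A act \<xi> x f))
          ` (cotangent A x \<times> lie_alg G))"


section \<open>Differential forms\<close>

text \<open>The \<open>A\<close>-module \<open>\<Omega>\<^sup>k\<close> of Kaehler \<open>k\<close>-forms is presented as the free abelian group on the
  symbols \<open>(a\<^sub>0, [a\<^sub>1, \<dots>, a\<^sub>k])\<close>, standing for \<open>a\<^sub>0 da\<^sub>1 \<and> \<dots> \<and> da\<^sub>k\<close>, modulo the subgroup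
  \<open>null_form A k\<close>.\<close>

type_synonym 'm form = "(('m \<Rightarrow> complex) \<times> ('m \<Rightarrow> complex) list) \<Rightarrow>\<^sub>0 int"

definition kform :: "('m \<Rightarrow> complex) set \<Rightarrow> nat \<Rightarrow> 'm form set" where
  "kform A k = {\<omega>. \<forall>(a, as) \<in> Poly_Mapping.keys \<omega>. a \<in> A \<and> set as \<subseteq> A \<and> length as = k}"

inductive_set null_form :: "('m \<Rightarrow> complex) set \<Rightarrow> nat \<Rightarrow> 'm form set"
  for A :: "('m \<Rightarrow> complex) set" and k :: nat where
  zero: "0 \<in> null_form A k"
| diff: "\<omega> \<in> null_form A k \<Longrightarrow> \<omega>' \<in> null_form A k \<Longrightarrow> \<omega> - \<omega>' \<in> null_form A k"
| coeff_add:
    "\<lbrakk>a \<in> A; b \<in> A; set as \<subseteq> A; length as = k\<rbrakk> \<Longrightarrow>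
     frag_of (\<lambda>x. a x + b x, as) - frag_of (a, as) - frag_of (b, as) \<in> null_form A k"
| d_const:
    "\<lbrakk>a \<in> A; set us \<subseteq> A; set vs \<subseteq> A; length us + 1 + length vs = k\<rbrakk> \<Longrightarrow>
     frag_of (a, us @ [\<lambda>_. c] @ vs) \<in> null_form A k"
| d_add:
    "\<lbrakk>a \<in> A; f \<in> A; g \<in> A; set us \<subseteq> A; set vs \<subseteq> A; length us + 1 + length vs = k\<rbrakk> \<Longrightarrow>
     frag_of (a, us @ [\<lambda>x. f x + g x] @ vs)
       - frag_of (a, us @ [f] @ vs) - frag_of (a, us @ [g] @ vs) \<in> null_form A k"
| d_mult:
    "\<lbrakk>a \<in> A; f \<in> A; g \<in> A; set us \<subseteq> A; set vs \<subseteq> A; length us + 1 + length vs = k\<rbrakk> \<Longrightarrow>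
     frag_of (a, us @ [\<lambda>x. f x * g x] @ vs)
       - frag_of (\<lambda>x. a x * f x, us @ [g] @ vs)
       - frag_of (\<lambda>x. a x * g x, us @ [f] @ vs) \<in> null_form A k"
| alt:
    "\<lbrakk>a \<in> A; f \<in> A; set us \<subseteq> A; set vs \<subseteq> A; set ws \<subseteq> A;
      length us + 1 + length vs + 1 + length ws = k\<rbrakk> \<Longrightarrow>
     frag_of (a, us @ [f] @ vs @ [f] @ ws) \<in> null_form A k"

definition form_eq :: "('m \<Rightarrow> complex) set \<Rightarrow> nat \<Rightarrow> 'm form \<Rightarrow> 'm form \<Rightarrow> bool" where
  "form_eq A k \<omega> \<omega>' \<longleftrightarrow> \<omega> - \<omega>' \<in> null_form A k"

definition form_scale :: "('m \<Rightarrow> complex) \<Rightarrow> 'm form \<Rightarrow> 'm form" where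
  "form_scale f = frag_extend (\<lambda>(a, as). frag_of (\<lambda>x. f x * a x, as))"

definition form_wedge :: "'m form \<Rightarrow> 'm form \<Rightarrow> 'm form" where
  "form_wedge \<alpha> \<beta> =
     frag_extend (\<lambda>(a, as). frag_extend (\<lambda>(b, bs). frag_of (\<lambda>x. a x * b x, as @ bs)) \<beta>) \<alpha>"

definition ext_d :: "'m form \<Rightarrow> 'm form" where
  "ext_d = frag_extend (\<lambda>(a, as). frag_of (\<lambda>_. 1, a # as))"

definition form_pullback :: "('m \<Rightarrow> 'k) \<Rightarrow> 'k form \<Rightarrow> 'm form" where
  "form_pullback \<Phi> = frag_extend (\<lambda>(a, as). frag_of (a \<circ> \<Phi>, map (\<lambda>f. f \<circ> \<Phi>) as))"

text \<open>Evaluation of a 1-form on a tangent vector and of a 2-form on a pair of tangent vectors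
  at \<open>x\<close>, where \<open>(db \<and> dc)(v,w) = v(b) w(c) - v(c) w(b)\<close>.\<close>

definition eval1 :: "'m form \<Rightarrow> 'm \<Rightarrow> (('m \<Rightarrow> complex) \<Rightarrow> complex) \<Rightarrow> complex" where
  "eval1 \<alpha> x v = (\<Sum>t\<in>Poly_Mapping.keys \<alpha>. of_int (Poly_Mapping.lookup \<alpha> t) *
     (case t of (a, as) \<Rightarrow> a x * v (as ! 0)))"

definition eval2 ::
  "'m form \<Rightarrow> 'm \<Rightarrow> (('m \<Rightarrow> complex) \<Rightarrow> complex) \<Rightarrow> (('m \<Rightarrow> complex) \<Rightarrow> complex) \<Rightarrow> complex" where
  "eval2 \<omega> x v w = (\<Sum>t\<in>Poly_Mapping.keys \<omega>. of_int (Poly_Mapping.lookup \<omega> t) *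
     (case t of (a, as) \<Rightarrow> a x * (v (as ! 0) * w (as ! 1) - v (as ! 1) * w (as ! 0))))"

text \<open>\<open>\<omega>\<^sup>\<flat>\<close> for a 2-form: on vector fields, with values in 1-forms, and at a point.\<close>

definition flat :: "'m form \<Rightarrow> (('m \<Rightarrow> complex) \<Rightarrow> 'm \<Rightarrow> complex) \<Rightarrow> 'm form" where
  "flat \<omega> X = frag_extend (\<lambda>(a, as).
     frag_of (\<lambda>x. a x * X (as ! 0) x, [as ! 1]) - frag_of (\<lambda>x. a x * X (as ! 1) x, [as ! 0])) \<omega>"

definition flat_at ::
  "('m \<Rightarrow> complex) set \<Rightarrow> 'm form \<Rightarrow> 'm \<Rightarrow> (('m \<Rightarrow> complex) \<Rightarrow> complex) \<Rightarrow>
   (('m \<Rightarrow> complex) \<Rightarrow> complex) \<Rightarrow> complex" where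
  "flat_at A \<omega> x v = (\<lambda>w. if w \<in> tangent A x then eval2 \<omega> x v w else 0)"


section \<open>Maurer--Cartan forms and quasi-Hamiltonian varieties\<close>

text \<open>Entries of \<open>\<theta>\<^sup>L = g\<^sup>-\<^sup>1dg\<close> and \<open>\<theta>\<^sup>R = dg g\<^sup>-\<^sup>1\<close>.\<close>

definition thetaL :: "'n::finite \<Rightarrow> 'n \<Rightarrow> 'n cmat form" where
  "thetaL p q = (\<Sum>r\<in>UNIV. frag_of (\<lambda>g. matrix_inv g $ p $ r, [\<lambda>g. g $ r $ q]))"

definition thetaR :: "'n::finite \<Rightarrow> 'n \<Rightarrow> 'n cmat form" where
  "thetaR p q = (\<Sum>r\<in>UNIV. frag_of (\<lambda>g. matrix_inv g $ r $ q, [\<lambda>g. g $ p $ r]))"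

definition eta :: "'n::finite cmat form" where
  "eta = form_scale (\<lambda>_. 1/6)
     (\<Sum>p\<in>UNIV. \<Sum>q\<in>UNIV. \<Sum>r\<in>UNIV. form_wedge (form_wedge (thetaR p q) (thetaR q r)) (thetaR r p))"

text \<open>\<open>(\<xi>, \<Theta>)\<close> for a matrix \<open>\<Theta>\<close> of 1-forms.\<close>

definition tr_pair :: "'n::finite cmat \<Rightarrow> ('n \<Rightarrow> 'n \<Rightarrow> 'm form) \<Rightarrow> 'm form" where
  "tr_pair \<xi> \<Theta> = (\<Sum>p\<in>UNIV. \<Sum>q\<in>UNIV. form_scale (\<lambda>_. \<xi> $ p $ q) (\<Theta> q p))"

definition thetaL_at ::
  "('m \<Rightarrow> 'n::finite cmat) \<Rightarrow> 'm \<Rightarrow> (('m \<Rightarrow> complex) \<Rightarrow> complex) \<Rightarrow> 'n cmat" where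
  "thetaL_at \<Phi> x v = (\<chi> p q. eval1 (form_pullback \<Phi> (thetaL p q)) x v)"

definition quasi_Hamiltonian where
  "quasi_Hamiltonian A G act \<omega> \<Phi> \<longleftrightarrow>
     \<omega> \<in> kform A 2 \<and>
     (\<forall>g\<in>G. form_eq A 2 (form_pullback (act g) \<omega>) \<omega>) \<and>
     equivariant_morphism A G act \<Phi> \<and>
     form_eq A 3 (ext_d \<omega>) (form_pullback \<Phi> eta) \<and>
     (\<forall>\<xi>\<in>lie_alg G. form_eq A 1 (flat \<omega> (inf_act act \<xi>))
        (form_scale (\<lambda>_. 1/2) (form_pullback \<Phi> (tr_pair \<xi> (\<lambda>p q. thetaL p q + thetaR p q))))) \<and>
     (\<forall>x. inj_on (\<lambda>v. (flat_at A \<omega> x v, thetaL_at \<Phi> x v)) (tangent A x))"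

text \<open>\<open>P\<^sup>\<sharp> \<circ> \<omega>\<^sup>\<flat> = Id - 1/4 \<Sum>\<^sub>a (E\<^sub>a)\<^sub>M \<otimes> \<Phi>\<^sup>*(E\<^sup>a, \<theta>\<^sup>L - \<theta>\<^sup>R)\<close> on every tangent space.\<close>

definition corresponding where
  "corresponding A act d E E' P \<omega> \<Phi> \<longleftrightarrow>
     (\<forall>x. \<forall>v\<in>tangent A x. sharp_at A P x (flat_at A \<omega> x v) =
        (\<lambda>f. v f - 1/4 * (\<Sum>a<d.
           eval1 (form_pullback \<Phi> (tr_pair (E' a) (\<lambda>p q. thetaL p q - thetaR p q))) x v *
           inf_act_at A act (E a) x f)))"


section \<open>Block decompositions\<close>

text \<open>The map \<open>blk\<close> assigns to each index of an \<open>N \<times> N\<close> matrix the number of its diagonal block: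
  \<open>0\<close> for the factor \<open>G'\<close> (this block may be empty), \<open>j\<close> for the factor \<open>G\<^sub>j\<close> (\<open>1 \<le> j \<le> l\<close>).
  A matrix of the size of block \<open>j\<close> is represented by the \<open>N \<times> N\<close> matrix having it as block \<open>j\<close>
  and coinciding with the identity matrix elsewhere.\<close>

definition block_part :: "('n::finite \<Rightarrow> nat) \<Rightarrow> nat \<Rightarrow> 'n cmat \<Rightarrow> 'n cmat" where
  "block_part blk j g =
     (\<chi> p q. if blk p = j \<and> blk q = j then g $ p $ q else if p = q then 1 else 0)"

definition block_scalar :: "('n::finite \<Rightarrow> nat) \<Rightarrow> nat \<Rightarrow> complex \<Rightarrow> 'n cmat" where
  "block_scalar blk j c = (\<chi> p q. if p = q then if blk p = j then c else 1 else 0)"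

text \<open>The element \<open>1\<close> of the Lie algebra of \<open>G\<^sub>j\<close>, as an element of the Lie algebra of \<open>G\<close>.\<close>

definition block_id :: "('n::finite \<Rightarrow> nat) \<Rightarrow> nat \<Rightarrow> 'n cmat" where
  "block_id blk j = (\<chi> p q. if p = q \<and> blk p = j then 1 else 0)"

definition block_decomposition ::
  "('n::finite \<Rightarrow> nat) \<Rightarrow> nat \<Rightarrow> (nat \<Rightarrow> 'n cmat set) \<Rightarrow> 'n cmat set \<Rightarrow> bool" where
  "block_decomposition blk l Gs G \<longleftrightarrow>
     (\<forall>p. blk p \<le> l) \<and> (\<forall>j\<in>{1..l}. \<exists>p. blk p = j) \<and>
     (\<forall>j\<le>l. matrix_group (Gs j) \<and> (\<forall>u\<in>Gs j. block_part blk j u = u)) \<and>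
     G = {g. (\<forall>p q. blk p \<noteq> blk q \<longrightarrow> g $ p $ q = 0) \<and> (\<forall>j\<le>l. block_part blk j g \<in> Gs j)}"

definition central_scalars :: "('n::finite \<Rightarrow> nat) \<Rightarrow> nat \<Rightarrow> (nat \<Rightarrow> 'n cmat set) \<Rightarrow> bool" where
  "central_scalars blk l Gs \<longleftrightarrow>
     (\<forall>j\<in>{1..l}. \<forall>c. c \<noteq> 0 \<longrightarrow> block_scalar blk j c \<in> Gs j \<and>
        (\<forall>u\<in>Gs j. block_scalar blk j c ** u = u ** block_scalar blk j c))"

definition Inf_field ::
  "('n::finite cmat \<Rightarrow> 'm \<Rightarrow> 'm) \<Rightarrow> ('n \<Rightarrow> nat) \<Rightarrow> nat \<Rightarrow> ('m \<Rightarrow> complex) \<Rightarrow> 'm \<Rightarrow> complex" where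
  "Inf_field act blk j = inf_act act (block_id blk j)"

definition psi ::
  "('n::finite cmat \<Rightarrow> 'm \<Rightarrow> 'm) \<Rightarrow> ('n \<Rightarrow> nat) \<Rightarrow> nat \<Rightarrow> (nat \<Rightarrow> nat \<Rightarrow> complex) \<Rightarrow>
   ('m \<Rightarrow> complex) \<Rightarrow> ('m \<Rightarrow> complex) \<Rightarrow> 'm \<Rightarrow> complex" where
  "psi act blk l z f g x =
     (\<Sum>i\<in>{1..l}. \<Sum>j\<in>{i<..l}. z i j * wedge2 (Inf_field act blk i) (Inf_field act blk j) f g x)"

text \<open>\<open>tr(\<Phi>\<^sub>j\<^sup>-\<^sup>1 d\<Phi>\<^sub>j)\<close>. The entries of \<open>block_part blk j \<circ> \<Phi>\<close> outside block \<open>j\<close> are constant and do not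
  contribute.\<close>

definition tr_block :: "('n::finite \<Rightarrow> nat) \<Rightarrow> nat \<Rightarrow> ('m \<Rightarrow> 'n cmat) \<Rightarrow> 'm form" where
  "tr_block blk j \<Phi> = form_pullback (block_part blk j \<circ> \<Phi>) (\<Sum>p\<in>UNIV. thetaL p p)"

definition varpi ::
  "('n::finite \<Rightarrow> nat) \<Rightarrow> nat \<Rightarrow> (nat \<Rightarrow> nat \<Rightarrow> complex) \<Rightarrow> ('m \<Rightarrow> 'n cmat) \<Rightarrow> 'm form" where
  "varpi blk l z \<Phi> =
     (\<Sum>i\<in>{1..l}. \<Sum>j\<in>{i<..l}.
        form_scale (\<lambda>_. z i j) (form_wedge (tr_block blk i \<Phi>) (tr_block blk j \<Phi>)))"

end

theory Submission
  imports Defs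
begin

text \<open>Write \<open>\<tau>\<^sub>j = tr(\<Phi>\<^sub>j\<^sup>-\<^sup>1 d\<Phi>\<^sub>j)\<close>. The fields \<open>Inf\<^bsup>(j)\<^esup>\<close> come from central elements of \<open>G\<close>, so they
  preserve every \<open>G\<close>-invariant bivector, \<open>\<psi>\<close> included; hence \<open>[P,\<psi>] = [\<psi>,\<psi>] = 0\<close>. They
  annihilate all functions of \<open>\<Phi>\<close>, so the moment map condition is unaffected.

  The forms \<open>\<tau>\<^sub>j\<close> are closed, \<open>G\<close>-invariant and vanish on the orbit directions, so adding
  \<open>\<varpi> = \<Sum> z\<^sub>i\<^sub>j \<tau>\<^sub>i \<and> \<tau>\<^sub>j\<close> to \<open>\<omega>\<close> preserves the quasi-Hamiltonian axioms; injectivity survives because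
  \<open>\<tau>\<^sub>j\<close> is a function of \<open>\<Phi>\<^sup>*\<theta>\<^sup>L\<close>. The moment map conditions for \<open>P\<close> and \<open>\<omega>\<close> read
  \<open>P\<^sup>\<sharp>(\<tau>\<^sub>j) = Inf\<^bsup>(j)\<^esup>\<close> and \<open>\<omega>\<^sup>\<flat>(Inf\<^bsup>(j)\<^esup>) = \<tau>\<^sub>j\<close>. In
  \<open>(P + \<psi>)\<^sup>\<sharp> \<circ> (\<omega> + \<varpi>)\<^sup>\<flat>\<close> the terms \<open>P\<^sup>\<sharp> \<circ> \<varpi>\<^sup>\<flat>\<close> and \<open>\<psi>\<^sup>\<sharp> \<circ> \<omega>\<^sup>\<flat>\<close> therefore cancel, and
  \<open>\<psi>\<^sup>\<sharp> \<circ> \<varpi>\<^sup>\<flat>\<close> vanishes because \<open>\<tau>\<^sub>j(Inf\<^bsup>(i)\<^esup>) = 0\<close>.\<close>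

section \<open>Closure of generated function algebras under linear combinations, sums and
  products\<close>

lemma gen_alg_cmult: "f \<in> gen_alg B \<Longrightarrow> (\<lambda>x. c * f x) \<in> gen_alg B"
  by (rule gen_alg.mult[OF gen_alg.const])

lemma gen_alg_sum:
  assumes "\<And>i. i \<in> I \<Longrightarrow> f i \<in> gen_alg B"
  shows "(\<lambda>x. \<Sum>i\<in>I. f i x) \<in> gen_alg B"
proof (cases "finite I")
  case True
  then show ?thesis using assms
    by (induction I) (auto intro: gen_alg.const gen_alg.add)
qed (simp add: gen_alg.const)

lemma gen_alg_prod:
  assumes "\<And>i. i \<in> I \<Longrightarrow> f i \<in> gen_alg B"
  shows "(\<lambda>x. \<Prod>i\<in>I. f i x) \<in> gen_alg B"
proof (cases "finite I")
  case True
  then show ?thesis using assms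
    by (induction I) (auto intro: gen_alg.const gen_alg.mult)
qed (simp add: gen_alg.const)

lemma gen_alg_diff: "f \<in> gen_alg B \<Longrightarrow> g \<in> gen_alg B \<Longrightarrow> (\<lambda>x. f x - g x) \<in> gen_alg B"
  using gen_alg.add[OF _ gen_alg_cmult[of g B "-1"], of f] by simp

section \<open>Matrices and regular functions\<close>

lemma matrix_inv_eqI:
  fixes X :: "'a::semiring_1^'n^'n"
  assumes "X ** Y = mat 1" "Y ** X = mat 1"
  shows "matrix_inv X = Y"
proof -
  have "X ** matrix_inv X = mat 1 \<and> matrix_inv X ** X = mat 1"
    unfolding matrix_inv_def by (rule someI[of _ Y]) (use assms in simp)
  then have "matrix_inv X = (Y ** X) ** matrix_inv X" "Y ** (X ** matrix_inv X) = Y"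
    using assms by simp_all
  then show ?thesis by (simp add: matrix_mul_assoc)
qed

lemma matrix_inv_mul:
  fixes X :: "'a::semiring_1^'n^'n"
  assumes "invertible X"
  shows "X ** matrix_inv X = mat 1" "matrix_inv X ** X = mat 1"
proof -
  have "\<exists>Y. X ** Y = mat 1 \<and> Y ** X = mat 1" using assms by (simp add: invertible_def)
  from someI_ex[OF this] show "X ** matrix_inv X = mat 1" "matrix_inv X ** X = mat 1"
    by (simp_all add: matrix_inv_def)
qed

lemma gen_alg_det:
  assumes "\<And>i j. (\<lambda>x. M x $ i $ j) \<in> gen_alg B"
  shows "(\<lambda>x. det (M x :: complex^'n^'n)) \<in> gen_alg B"
  unfolding det_def by (intro gen_alg_sum gen_alg_cmult gen_alg_prod assms)

lemma regfun_entry: "(\<lambda>g. g $ i $ j) \<in> regfun"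
  unfolding regfun_def by (rule gen_alg.gen) blast

text \<open>Cramer's rule: column \<open>j\<close> of the inverse solves \<open>g y = e_j\<close>,
  so its entry \<open>i\<close> is the determinant of \<open>g\<close> with column \<open>i\<close>
  replaced by \<open>e_j\<close>, divided by \<open>det g\<close>. At singular matrices
  \<open>matrix_inv\<close> is an arbitrary choice, hence the restriction.\<close>

lemma regfun_matrix_inv_entry:
  fixes i j :: "'n::finite"
  shows "\<exists>F\<in>regfun. \<forall>g. invertible g \<longrightarrow> F g = matrix_inv g $ i $ j"
proof -
  define F :: "'n cmat \<Rightarrow> complex" where
    "F g = det (\<chi> p q. if q = i then (mat 1 :: 'n cmat) $ p $ j else g $ p $ q) * inverse (det g)" for g
  have "F \<in> regfun"
    unfolding F_def regfun_def
  proof (intro gen_alg.mult gen_alg_det)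
    show "(\<lambda>g. inverse (det g)) \<in> gen_alg ({\<lambda>g. g $ i $ j |i j. True} \<union> {\<lambda>g. inverse (det g)})"
      by (rule gen_alg.gen) blast
    fix p q
    show "(\<lambda>g. (\<chi> p q. if q = i then (mat 1 :: 'n cmat) $ p $ j else g $ p $ q) $ p $ q)
        \<in> gen_alg ({\<lambda>g. g $ i $ j |i j. True} \<union> {\<lambda>g. inverse (det g)})"
      using gen_alg.const regfun_entry[of p q, unfolded regfun_def] by (cases "q = i") auto
  qed
  moreover have "F g = matrix_inv g $ i $ j" if "invertible g" for g
  proof -
    have "det g \<noteq> 0" using that by (simp add: invertible_det_nz)
    moreover have "g *v (\<chi> p. matrix_inv g $ p $ j) = (\<chi> p. (mat 1 :: 'n cmat) $ p $ j)"
      unfolding matrix_inv_mul(1)[OF that, symmetric]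
      by (simp add: vec_eq_iff matrix_vector_mult_def matrix_matrix_mult_def)
    ultimately have "(\<chi> p. matrix_inv g $ p $ j) =
        (\<chi> k. det (\<chi> p q. if q = k then (\<chi> p. (mat 1 :: 'n cmat) $ p $ j) $ p else g $ p $ q) / det g)"
      using cramer by blast
    then have "(\<chi> p. matrix_inv g $ p $ j) $ i = 
        (\<chi> k. det (\<chi> p q. if q = k then (\<chi> p. (mat 1 :: 'n cmat) $ p $ j) $ p else g $ p $ q) / det g) $ i"
      by metis
    moreover have "(\<chi> p q. if q = i then (\<chi> p. (mat 1 :: 'n cmat) $ p $ j) $ p else g $ p $ q) =
        (\<chi> p q. if q = i then (mat 1 :: 'n cmat) $ p $ j else g $ p $ q)"
      by (simp add: vec_eq_iff)
    ultimately show ?thesis by (simp add: F_def divide_inverse)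
  qed
  ultimately show ?thesis by blast
qed

lemma field_differentiable_prod:
  fixes f :: "'i \<Rightarrow> 'a::real_normed_field \<Rightarrow> 'a"
  assumes "\<And>i. i \<in> I \<Longrightarrow> f i field_differentiable (at x within S)"
  shows "(\<lambda>t. \<Prod>i\<in>I. f i t) field_differentiable (at x within S)"
proof (cases "finite I")
  case True
  then show ?thesis using assms
  proof (induction I)
    case (insert i I)
    then show ?case
      by (auto intro: field_differentiable_mult)
  qed simp
qed simp

text \<open>Induction over the generators; invertibility at \<open>t0\<close> keeps the generator
  \<open>inverse (det g)\<close> away from its pole.\<close>

lemma regfun_field_differentiable:
  fixes c :: "complex \<Rightarrow> 'n::finite cmat"
  assumes "F \<in> regfun" and c: "\<And>i j. (\<lambda>t. c t $ i $ j) field_differentiable (at t0)"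
    and "invertible (c t0)"
  shows "(\<lambda>t. F (c t)) field_differentiable (at t0)"
  using assms(1) unfolding regfun_def
proof induction
  case (gen b)
  have "(\<lambda>t. det (c t)) field_differentiable (at t0)"
    unfolding det_def
    by (intro field_differentiable_sum field_differentiable_mult field_differentiable_const
        field_differentiable_prod c)
  then show ?case using gen c assms(3)
    by (auto intro: field_differentiable_inverse simp: invertible_det_nz)
qed (auto intro: field_differentiable_add field_differentiable_mult)

section \<open>The matrix exponential\<close>

lemma cscale_entry [simp]: "cscale c X $ i $ j = c * X $ i $ j"
  by (simp add: cscale_def)

lemma matpow_0 [simp]: "matpow X 0 = mat 1"
  by (simp add: matpow_def)

lemma matpow_Suc: "matpow X (Suc k) = X ** matpow X k"
  by (simp add: matpow_def)

lemma matpow_cscale: "matpow (cscale c X) k = cscale (c ^ k) (matpow X k)"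
  by (induction k) (auto simp: matpow_Suc vec_eq_iff matrix_matrix_mult_def sum_distrib_left mult_ac)

text \<open>The sum of the norms of all entries dominates every row sum of \<open>X\<close>, so each
  further factor costs at most one such sum.\<close>

lemma norm_matpow_le:
  "norm (matpow X k $ i $ j) \<le> (\<Sum>p\<in>UNIV. \<Sum>q\<in>UNIV. norm (X $ p $ q)) ^ k" (is "_ \<le> ?K ^ k")
proof (induction k arbitrary: i)
  case (Suc k)
  have "norm (matpow X (Suc k) $ i $ j) \<le> (\<Sum>r\<in>UNIV. norm (X $ i $ r * matpow X k $ r $ j))"
    by (simp add: matpow_Suc matrix_matrix_mult_def norm_sum)
  also have "\<dots> \<le> (\<Sum>r\<in>UNIV. norm (X $ i $ r) * ?K ^ k)"
    by (intro sum_mono) (auto simp: norm_mult intro: mult_left_mono Suc)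
  also have "\<dots> = (\<Sum>r\<in>UNIV. norm (X $ i $ r)) * ?K ^ k"
    by (simp add: sum_distrib_right)
  also have "\<dots> \<le> ?K * ?K ^ k"
    by (intro mult_right_mono zero_le_power sum_nonneg norm_ge_zero)
      (auto intro!: member_le_sum[of i UNIV "\<lambda>p. \<Sum>q\<in>UNIV. norm (X $ p $ q)"] sum_nonneg)
  finally show ?case by simp
qed (simp add: mat_def)

text \<open>The extra factor \<open>t ^ k\<close> turns an entry of the exponential into an
  everywhere convergent power series in \<open>t\<close>, to be differentiated termwise in
  \<open>DERIV_mexp\<close>; the majorant is a scalar exponential series.\<close>

lemma summable_matpow_entry:
  "summable (\<lambda>k. matpow X k $ i $ j / fact k * t ^ k)"
proof (rule summable_comparison_test')
  define K where "K = (\<Sum>p\<in>UNIV. \<Sum>q\<in>UNIV. norm (X $ p $ q))"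
  show "summable (\<lambda>k. inverse (fact k) * (K * norm t) ^ k)"
    by (rule summable_exp)
  fix k :: nat
  have "norm (matpow X k $ i $ j / fact k * t ^ k) = norm (matpow X k $ i $ j) / fact k * norm t ^ k"
    by (simp add: norm_mult norm_divide norm_power)
  also have "\<dots> \<le> K ^ k / fact k * norm t ^ k"
    unfolding K_def by (intro mult_right_mono divide_right_mono norm_matpow_le) auto
  finally show "norm (matpow X k $ i $ j / fact k * t ^ k) \<le> inverse (fact k) * (K * norm t) ^ k"
    by (simp add: power_mult_distrib field_simps)
qed

lemma mexp_entry: "mexp X $ i $ j = suminf (\<lambda>k. matpow X k $ i $ j / fact k)"
proof -
  define Y where "Y = (\<chi> i j. suminf (\<lambda>k. matpow X k $ i $ j / fact k))"
  have "(\<lambda>k. (1 / fact k) *\<^sub>R matpow X k) sums Y"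
    unfolding sums_def
  proof (intro vec_tendstoI)
    fix i j
    have "(\<lambda>k. matpow X k $ i $ j / fact k) sums (Y $ i $ j)"
      unfolding Y_def using summable_matpow_entry[of X i j 1] by (simp add: summable_sums)
    then show "(\<lambda>n. (\<Sum>k<n. (1 / fact k) *\<^sub>R matpow X k) $ i $ j) \<longlonglongrightarrow> Y $ i $ j"
      by (simp add: sums_def sum_component scaleR_conv_of_real[where 'a = complex] mult.commute divide_inverse)
  qed
  then have "mexp X = Y" unfolding mexp_def by (rule sums_unique[symmetric])
  then show ?thesis by (simp add: Y_def)
qed

lemma mexp_0 [simp]: "mexp (cscale 0 X) = mat 1"
proof -
  have "suminf (\<lambda>k. matpow (cscale 0 X) k $ i $ j / fact k) = mat 1 $ i $ j" for i j
    using powser_sums_zero[of "\<lambda>k. matpow X k $ i $ j / fact k"]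
    by (simp add: matpow_cscale sums_iff mult.commute)
  then show ?thesis by (simp add: vec_eq_iff mexp_entry)
qed

lemma DERIV_mexp:
  "((\<lambda>t. mexp (cscale t X) $ i $ j) has_field_derivative X $ i $ j) (at 0)"
proof -
  define c where "c k = matpow X k $ i $ j / fact k" for k
  have "((\<lambda>t. suminf (\<lambda>k. c k * t ^ k)) has_field_derivative suminf (\<lambda>k. diffs c k * 0 ^ k)) (at 0)"
    unfolding c_def by (rule termdiffs_strong_converges_everywhere) (rule summable_matpow_entry)
  moreover have "suminf (\<lambda>k. diffs c k * 0 ^ k) = X $ i $ j"
    unfolding powser_zero by (simp add: diffs_def c_def matpow_Suc)
  moreover have "mexp (cscale t X) $ i $ j = suminf (\<lambda>k. c k * t ^ k)" for t
    by (simp add: mexp_entry matpow_cscale c_def mult_ac)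
  ultimately show ?thesis by simp
qed

lemma DERIV_mexp_minus:
  "((\<lambda>t. mexp (cscale (- t) X) $ i $ j) has_field_derivative - X $ i $ j) (at 0)"
proof -
  have "(uminus has_field_derivative (- 1 :: complex)) (at 0)"
    by (auto intro!: derivative_eq_intros)
  then show ?thesis
    using DERIV_chain2[of "\<lambda>t. mexp (cscale t X) $ i $ j" "X $ i $ j" uminus 0 "-1" UNIV] DERIV_mexp[of X i j]
    by simp
qed

section \<open>Powers and exponentials of the identity of a block\<close>

lemma block_id_mult: "(block_id blk j ** X) $ p $ q = (if blk p = j then X $ p $ q else 0)"
proof -
  have "block_id blk j $ p $ r * X $ r $ q = (if r = p then if blk p = j then X $ p $ q else 0 else 0)" for r
    by (auto simp: block_id_def)
  then show ?thesis by (simp add: matrix_matrix_mult_def)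
qed

lemma mult_block_id: "(X ** block_id blk j) $ p $ q = (if blk q = j then X $ p $ q else 0)"
proof -
  have "X $ p $ r * block_id blk j $ r $ q = (if r = q then if blk q = j then X $ p $ q else 0 else 0)" for r
    by (auto simp: block_id_def)
  then show ?thesis by (simp add: matrix_matrix_mult_def)
qed

lemma matpow_block_id:
  "matpow (block_id blk j) k = (if k = 0 then mat 1 else block_id blk j)"
proof (induction k)
  case (Suc k)
  have "block_id blk j ** block_id blk j = block_id blk j"
    by (auto simp: vec_eq_iff block_id_mult) (auto simp: block_id_def)
  with Suc show ?case by (auto simp: matpow_Suc)
qed simp

text \<open>As \<open>block_id\<close> is idempotent, the series is the scalar exponential on the
  diagonal of block \<open>j\<close> and stops after the constant term elsewhere. The flow of
  \<open>Inf_field\<close> is thus the action of the embedded multiplicative group.\<close>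

lemma mexp_block_id: "mexp (cscale c (block_id blk j)) = block_scalar blk j (exp c)"
proof -
  have "suminf (\<lambda>k. matpow (cscale c (block_id blk j)) k $ p $ q / fact k) = block_scalar blk j (exp c) $ p $ q" for p q
  proof (cases "p = q \<and> blk p = j")
    case True
    then have "matpow (cscale c (block_id blk j)) k $ p $ q / fact k = c ^ k /\<^sub>R fact k" for k
      unfolding matpow_cscale matpow_block_id
      by (cases "k = 0") (auto simp: block_id_def mat_def scaleR_conv_of_real divide_inverse mult.commute)
    then show ?thesis using True by (auto simp: block_scalar_def exp_def)
  next
    case False
    then have "matpow (cscale c (block_id blk j)) k $ p $ q / fact k = (if k = 0 then mat 1 $ p $ q :: complex else 0)" for k
      unfolding matpow_cscale matpow_block_id by (auto simp: block_id_def)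
    then have "suminf (\<lambda>k. matpow (cscale c (block_id blk j)) k $ p $ q / fact k) = (mat 1 $ p $ q :: complex)"
      using sums_unique[OF sums_single[of 0 "\<lambda>_. mat 1 $ p $ q :: complex"]] by simp
    then show ?thesis using False by (auto simp: block_scalar_def mat_def)
  qed
  then show ?thesis by (simp add: vec_eq_iff mexp_entry)
qed

section \<open>Block diagonal matrices\<close>

definition block_diagonal :: "('n::finite \<Rightarrow> nat) \<Rightarrow> 'n cmat \<Rightarrow> bool" where
  "block_diagonal blk g \<longleftrightarrow> (\<forall>p q. blk p \<noteq> blk q \<longrightarrow> g $ p $ q = 0)"

text \<open>For \<open>p\<close> and \<open>q\<close> in block \<open>j\<close>, indices outside the
  block contribute nothing to the product because the off-block entries vanish; outside the block
  both sides are the identity.\<close>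

lemma block_part_mult:
  assumes "block_diagonal blk g" "block_diagonal blk h"
  shows "block_part blk j (g ** h) = block_part blk j g ** block_part blk j h"
proof -
  have "block_part blk j (g ** h) $ p $ q = (block_part blk j g ** block_part blk j h) $ p $ q" for p q
  proof (cases "blk p = j")
    case p: True
    show ?thesis
    proof (cases "blk q = j")
      case q: True
      have "g $ p $ r * h $ r $ q = block_part blk j g $ p $ r * block_part blk j h $ r $ q" for r
        using assms p q by (auto simp: block_diagonal_def block_part_def)
      then show ?thesis using p q by (simp add: block_part_def matrix_matrix_mult_def)
    next
      case q: False
      have "block_part blk j g $ p $ r * block_part blk j h $ r $ q = 0" for r
        using p q by (auto simp: block_part_def)
      then have "(block_part blk j g ** block_part blk j h) $ p $ q = 0"
        unfolding matrix_matrix_mult_def vec_lambda_beta by (intro sum.neutral ballI)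
      then show ?thesis using p q by (auto simp: block_part_def)
    qed
  next
    case p: False
    have "block_part blk j g $ p $ r * block_part blk j h $ r $ q =
        (if r = p then block_part blk j h $ p $ q else 0)" for r
      using p by (auto simp: block_part_def)
    then show ?thesis using p by (simp add: matrix_matrix_mult_def) (simp add: block_part_def)
  qed
  then show ?thesis by (simp add: vec_eq_iff)
qed

lemma block_part_mat_1: "block_part blk j (mat 1) = mat 1"
  by (simp add: vec_eq_iff block_part_def mat_def)

lemma block_scalar_commute:
  assumes "block_diagonal blk g"
  shows "block_scalar blk j c ** g = g ** block_scalar blk j c"
proof -
  have "(block_scalar blk j c ** g) $ p $ q = (g ** block_scalar blk j c) $ p $ q" for p q
  proof -
    have "block_scalar blk j c $ p $ r * g $ r $ q =
        (if r = p then (if blk p = j then c else 1) * g $ p $ q else 0)" for r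
      by (simp add: block_scalar_def)
    moreover have "g $ p $ r * block_scalar blk j c $ r $ q =
        (if r = q then (if blk q = j then c else 1) * g $ p $ q else 0)" for r
      by (simp add: block_scalar_def)
    ultimately show ?thesis
      using assms by (auto simp: matrix_matrix_mult_def block_diagonal_def)
  qed
  then show ?thesis by (simp add: vec_eq_iff)
qed

lemma block_id_commute:
  assumes "block_diagonal blk g"
  shows "block_id blk j ** g = g ** block_id blk j"
  using assms by (auto simp: vec_eq_iff block_id_mult mult_block_id block_diagonal_def)

lemma block_scalar_mem:
  assumes "block_decomposition blk l Gs G" "central_scalars blk l Gs" "j \<in> {1..l}" "c \<noteq> 0"
  shows "block_scalar blk j c \<in> G"
proof -
  have "block_part blk i (block_scalar blk j c) \<in> Gs i" if "i \<le> l" for i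
  proof (cases "i = j")
    case True
    have "block_part blk j (block_scalar blk j c) = block_scalar blk j c"
      by (auto simp: vec_eq_iff block_part_def block_scalar_def)
    with True show ?thesis using assms by (auto simp: central_scalars_def)
  next
    case False
    then have "block_part blk i (block_scalar blk j c) = mat 1"
      by (auto simp: vec_eq_iff block_part_def block_scalar_def mat_def)
    with that show ?thesis using assms(1) by (auto simp: block_decomposition_def matrix_group_def)
  qed
  moreover have "block_scalar blk j c $ p $ q = 0" if "blk p \<noteq> blk q" for p q
    using that by (auto simp: block_scalar_def)
  ultimately show ?thesis using assms(1) by (auto simp: block_decomposition_def)
qed

lemma block_diagonal_mem:
  assumes "block_decomposition blk l Gs G" "g \<in> G"
  shows "block_diagonal blk g"
  using assms by (auto simp: block_decomposition_def block_diagonal_def)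

section \<open>Point derivations\<close>

text \<open>Tangent vectors without the normalisation to \<open>0\<close> outside \<open>A\<close>,
  so that values of vector fields and of \<open>P f h\<close> at a point qualify directly.\<close>

definition point_derivation :: "('m \<Rightarrow> complex) set \<Rightarrow> 'm \<Rightarrow> (('m \<Rightarrow> complex) \<Rightarrow> complex) \<Rightarrow> bool" where
  "point_derivation A x v \<longleftrightarrow> (\<forall>c. v (\<lambda>_. c) = 0) \<and>
     (\<forall>f\<in>A. \<forall>g\<in>A. v (\<lambda>y. f y + g y) = v f + v g) \<and>
     (\<forall>f\<in>A. \<forall>g\<in>A. v (\<lambda>y. f y * g y) = v f * g x + f x * v g)"

lemma tangent_iff: "v \<in> tangent A x \<longleftrightarrow> point_derivation A x v \<and> (\<forall>f. f \<notin> A \<longrightarrow> v f = 0)"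
  unfolding tangent_def point_derivation_def by blast

locale function_algebra =
  fixes A :: "('m \<Rightarrow> complex) set"
  assumes generated: "\<exists>B. A = gen_alg B"
begin

lemma
  shows const_mem: "(\<lambda>_. c) \<in> A"
    and add_mem: "f \<in> A \<Longrightarrow> g \<in> A \<Longrightarrow> (\<lambda>x. f x + g x) \<in> A"
    and diff_mem: "f \<in> A \<Longrightarrow> g \<in> A \<Longrightarrow> (\<lambda>x. f x - g x) \<in> A"
    and mult_mem: "f \<in> A \<Longrightarrow> g \<in> A \<Longrightarrow> (\<lambda>x. f x * g x) \<in> A"
    and sum_mem: "(\<And>i. i \<in> I \<Longrightarrow> F i \<in> A) \<Longrightarrow> (\<lambda>x. \<Sum>i\<in>I. F i x) \<in> A"
  using generated by (auto intro: gen_alg.intros gen_alg_diff gen_alg_sum)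

lemmas closed_intros = const_mem add_mem diff_mem mult_mem sum_mem

context
  fixes x v assumes v: "point_derivation A x v"
begin

lemma pd_const: "v (\<lambda>_. c) = 0"
  and pd_add: "f \<in> A \<Longrightarrow> g \<in> A \<Longrightarrow> v (\<lambda>y. f y + g y) = v f + v g"
  and pd_mult: "f \<in> A \<Longrightarrow> g \<in> A \<Longrightarrow> v (\<lambda>y. f y * g y) = v f * g x + f x * v g"
  using v by (auto simp: point_derivation_def)

lemma pd_cmult: "f \<in> A \<Longrightarrow> v (\<lambda>y. c * f y) = c * v f"
  using pd_mult[OF const_mem, of f c] by (simp add: pd_const)

lemma pd_sum:
  assumes "\<And>i. i \<in> I \<Longrightarrow> F i \<in> A"
  shows "v (\<lambda>y. \<Sum>i\<in>I. F i y) = (\<Sum>i\<in>I. v (F i))"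
proof (cases "finite I")
  case True
  then show ?thesis using assms
    by (induction I) (auto simp: pd_const pd_add sum_mem)
qed (simp add: pd_const)

lemma pd_lincomb:
  assumes "\<And>i. i \<in> I \<Longrightarrow> F i \<in> A"
  shows "v (\<lambda>y. \<Sum>i\<in>I. c i * F i y) = (\<Sum>i\<in>I. c i * v (F i))"
  using assms by (simp add: pd_sum pd_cmult closed_intros cong: sum.cong)

end

lemma bivector_mem: "bivector A P \<Longrightarrow> f \<in> A \<Longrightarrow> g \<in> A \<Longrightarrow> P f g \<in> A"
  unfolding bivector_def by blast

lemma bivector_skew: "bivector A P \<Longrightarrow> f \<in> A \<Longrightarrow> g \<in> A \<Longrightarrow> P f g x = - P g f x"
  unfolding bivector_def by blast

lemma point_derivation_bivector:
  assumes "bivector A P"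
  shows "f \<in> A \<Longrightarrow> point_derivation A x (\<lambda>g. P f g x)"
  using assms unfolding bivector_def point_derivation_def by (elim conjE) (intro conjI ballI allI; blast)

lemma point_derivation_bivector':
  assumes P: "bivector A P" and "h \<in> A"
  shows "point_derivation A x (\<lambda>f. P f h x)"
proof -
  have skew: "P f h x = - P h f x" if "f \<in> A" for f
    using P that assms(2) unfolding bivector_def by blast
  note pd = point_derivation_bivector[OF P assms(2), of x]
  show ?thesis
    unfolding point_derivation_def
    using pd_const[OF pd] pd_add[OF pd] pd_mult[OF pd]
    by (simp add: skew closed_intros)
qed

lemma point_derivation_derivation: "derivation A X \<Longrightarrow> point_derivation A x (\<lambda>f. X f x)"
  by (auto simp: derivation_def point_derivation_def)

lemma tangentI:
  assumes "point_derivation A x v"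
  shows "(\<lambda>f. if f \<in> A then v f else 0) \<in> tangent A x"
  using assms unfolding tangent_iff point_derivation_def by (simp add: closed_intros)

end

section \<open>Infinitesimal actions\<close>

locale algebraic_G_set = function_algebra A for A :: "('m \<Rightarrow> complex) set" +
  fixes G :: "('n::finite cmat) set" and act :: "'n cmat \<Rightarrow> 'm \<Rightarrow> 'm"
  assumes group: "matrix_group G"
    and action: "algebraic_action A G act"
begin

lemma act_1: "act (mat 1) x = x"
  using action by (simp add: algebraic_action_def)

lemma act_mult: "g \<in> G \<Longrightarrow> h \<in> G \<Longrightarrow> act (g ** h) x = act g (act h x)"
  using action by (simp add: algebraic_action_def)

lemma act_expansion:
  assumes "f \<in> A"
  shows "\<exists>k::nat. \<exists>u v. (\<forall>i<k. u i \<in> regfun \<and> v i \<in> A) \<and>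
     (\<forall>g\<in>G. \<forall>x. f (act g x) = (\<Sum>i<k. u i g * v i x))"
  using action assms by (simp add: algebraic_action_def)

lemma comp_act_mem: "f \<in> A \<Longrightarrow> g \<in> G \<Longrightarrow> (\<lambda>x. f (act g x)) \<in> A"
proof -
  assume f: "f \<in> A" and g: "g \<in> G"
  obtain k :: nat and u v where uv: "\<forall>i<k. u i \<in> regfun \<and> v i \<in> A"
      "\<forall>g\<in>G. \<forall>x. f (act g x) = (\<Sum>i<k. u i g * v i x)"
    using act_expansion[OF f] by (elim exE conjE) (rule that)
  have "(\<lambda>x. \<Sum>i<k. u i g * v i x) \<in> A"
    using uv(1) by (auto intro!: closed_intros)
  with uv(2) g show ?thesis by simp
qed

lemma mexp_mem: "\<xi> \<in> lie_alg G \<Longrightarrow> mexp (cscale t \<xi>) \<in> G"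
  by (simp add: lie_alg_def)

text \<open>Along a one-parameter subgroup, a translated function stays in the span of finitely many
  fixed \<open>v i\<close>. Time enters only through the scalar coefficients \<open>w i\<close>,
  regular functions evaluated on a differentiable curve, so derivatives in \<open>t\<close> pass
  through any linear operation on \<open>A\<close>.\<close>

lemma inf_act_expansion:
  assumes f: "f \<in> A" and \<xi>: "\<xi> \<in> lie_alg G"
  obtains k :: nat and w v c where "\<And>i. i < k \<Longrightarrow> v i \<in> A"
    and "\<And>i. i < k \<Longrightarrow> (w i has_field_derivative c i) (at 0)"
    and "\<And>t x. f (act (mexp (cscale (- t) \<xi>)) x) = (\<Sum>i<k. w i t * v i x)"
    and "\<And>x. inf_act act \<xi> f x = (\<Sum>i<k. c i * v i x)"
proof -
  obtain k :: nat and u v where uv: "\<forall>i<k. u i \<in> regfun \<and> v i \<in> A"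
      "\<forall>g\<in>G. \<forall>x. f (act g x) = (\<Sum>i<k. u i g * v i x)"
    using act_expansion[OF f] by (elim exE conjE) (rule that)
  define w where "w i t = u i (mexp (cscale (- t) \<xi>))" for i t
  have "(w i has_field_derivative deriv (w i) 0) (at 0)" if "i < k" for i
  proof -
    have "w i field_differentiable (at 0)"
      unfolding w_def
    proof (rule regfun_field_differentiable)
      show "invertible (mexp (cscale (- 0) \<xi>))"
        using group mexp_mem[OF \<xi>, of 0] by (simp add: matrix_group_def)
    qed (use uv that in \<open>auto simp: field_differentiable_def intro: DERIV_mexp_minus\<close>)
    then show ?thesis by (simp add: field_differentiable_derivI)
  qed
  note w = this
  have e: "f (act (mexp (cscale (- t) \<xi>)) x) = (\<Sum>i<k. w i t * v i x)" for t x
    using uv(2) mexp_mem[OF \<xi>] by (simp add: w_def)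
  have "inf_act act \<xi> f x = (\<Sum>i<k. deriv (w i) 0 * v i x)" for x
    unfolding inf_act_def e
    by (rule DERIV_imp_deriv) (auto intro!: derivative_eq_intros w)
  show ?thesis
    by (rule that[of k v w "\<lambda>i. deriv (w i) 0"]) (use uv(1) in blast, fact w, fact e, fact)
qed

lemma DERIV_inf_act:
  assumes "f \<in> A" "\<xi> \<in> lie_alg G"
  shows "((\<lambda>t. f (act (mexp (cscale (- t) \<xi>)) x)) has_field_derivative inf_act act \<xi> f x) (at 0)"
proof -
  obtain k :: nat and w v c where v: "\<And>i. i < k \<Longrightarrow> v i \<in> A"
    and w: "\<And>i. i < k \<Longrightarrow> (w i has_field_derivative c i) (at 0)"
    and e: "\<And>t x. f (act (mexp (cscale (- t) \<xi>)) x) = (\<Sum>i<k. w i t * v i x)"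
      "\<And>x. inf_act act \<xi> f x = (\<Sum>i<k. c i * v i x)"
    by (rule inf_act_expansion[OF assms]) (rule that)
  show ?thesis unfolding e by (auto intro!: derivative_eq_intros w)
qed

lemma inf_act_mem: "f \<in> A \<Longrightarrow> \<xi> \<in> lie_alg G \<Longrightarrow> inf_act act \<xi> f \<in> A"
proof -
  assume a: "f \<in> A" "\<xi> \<in> lie_alg G"
  obtain k :: nat and w v c where v: "\<And>i. i < k \<Longrightarrow> v i \<in> A"
    and w: "\<And>i. i < k \<Longrightarrow> (w i has_field_derivative c i) (at 0)"
    and e': "\<And>t x. f (act (mexp (cscale (- t) \<xi>)) x) = (\<Sum>i<k. w i t * v i x)"
    and e: "\<And>x. inf_act act \<xi> f x = (\<Sum>i<k. c i * v i x)"
    by (rule inf_act_expansion[OF a]) (rule that)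
  have "(\<lambda>x. \<Sum>i<k. c i * v i x) \<in> A" by (intro closed_intros v) auto
  moreover have "inf_act act \<xi> f = (\<lambda>x. \<Sum>i<k. c i * v i x)" by (rule ext) (rule e)
  ultimately show ?thesis by simp
qed

lemma inf_act_const [simp]: "inf_act act \<xi> (\<lambda>_. c) x = 0"
  unfolding inf_act_def by (rule DERIV_imp_deriv) simp

lemma derivation_inf_act:
  assumes "\<xi> \<in> lie_alg G"
  shows "derivation A (inf_act act \<xi>)"
  unfolding derivation_def
proof (intro conjI ballI allI)
  fix f g x assume fg: "f \<in> A" "g \<in> A"
  note D = DERIV_inf_act[OF _ assms]
  show "inf_act act \<xi> (\<lambda>y. f y + g y) x = inf_act act \<xi> f x + inf_act act \<xi> g x"
    by (rule DERIV_unique[OF D]) (auto intro!: derivative_eq_intros D fg closed_intros)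
  show "inf_act act \<xi> (\<lambda>y. f y * g y) x = inf_act act \<xi> f x * g x + f x * inf_act act \<xi> g x"
    by (rule DERIV_unique[OF D])
      (auto intro!: derivative_eq_intros D fg closed_intros simp: act_1 mult.commute)
qed (use assms inf_act_mem in auto)

text \<open>Infinitesimal form of \<open>G\<close>-invariance: differentiate \<open>P(f \<circ> g, h \<circ> g) = P(f, h) \<circ> g\<close> along
  \<open>g = exp(-t \<xi>)\<close>, using that \<open>f \<circ> g\<close> stays in a finite-dimensional space.\<close>

lemma inf_act_bivector:
  assumes P: "bivector A P" and inv: "bivector_invariant A G act P"
    and \<xi>: "\<xi> \<in> lie_alg G" and f: "f \<in> A" and h: "h \<in> A"
  shows "inf_act act \<xi> (P f h) x = P (inf_act act \<xi> f) h x + P f (inf_act act \<xi> h) x"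
proof -
  obtain k :: nat and w v c where v: "\<And>i. i < k \<Longrightarrow> v i \<in> A"
    and w: "\<And>i. i < k \<Longrightarrow> (w i has_field_derivative c i) (at 0)"
    and e: "\<And>t x. f (act (mexp (cscale (- t) \<xi>)) x) = (\<Sum>i<k. w i t * v i x)"
      "\<And>x. inf_act act \<xi> f x = (\<Sum>i<k. c i * v i x)"
    by (rule inf_act_expansion[OF f \<xi>]) (rule that)
  obtain k' :: nat and w' v' c' where v': "\<And>i. i < k' \<Longrightarrow> v' i \<in> A"
    and w': "\<And>i. i < k' \<Longrightarrow> (w' i has_field_derivative c' i) (at 0)"
    and e': "\<And>t x. h (act (mexp (cscale (- t) \<xi>)) x) = (\<Sum>i<k'. w' i t * v' i x)"
      "\<And>x. inf_act act \<xi> h x = (\<Sum>i<k'. c' i * v' i x)"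
    by (rule inf_act_expansion[OF h \<xi>]) (rule that)
  note pd1 = point_derivation_bivector[OF P] and pd2 = point_derivation_bivector'[OF P]
  \<comment> \<open>Stated for arbitrary coefficients, since it is applied to those at time
    \<open>t\<close>, to those at time 0 and to their derivatives.\<close>
  have bilin: "P (\<lambda>x. \<Sum>i<k. a i * v i x) (\<lambda>x. \<Sum>j<k'. b j * v' j x) x =
      (\<Sum>i<k. \<Sum>j<k'. a i * b j * P (v i) (v' j) x)" for a b x
  proof -
    have m: "(\<lambda>x. \<Sum>j<k'. b j * v' j x) \<in> A" by (intro closed_intros v') auto
    have "P (\<lambda>x. \<Sum>i<k. a i * v i x) (\<lambda>x. \<Sum>j<k'. b j * v' j x) x =
        (\<Sum>i<k. a i * P (v i) (\<lambda>x. \<Sum>j<k'. b j * v' j x) x)"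
      by (rule pd_lincomb[OF pd2[OF m]]) (simp add: v)
    also have "\<dots> = (\<Sum>i<k. a i * (\<Sum>j<k'. b j * P (v i) (v' j) x))"
      by (intro sum.cong arg_cong2[where f = "(*)"] pd_lincomb[OF pd1] refl) (simp_all add: v v')
    finally show ?thesis by (simp add: sum_distrib_left mult_ac)
  qed
  have 0: "f = (\<lambda>x. \<Sum>i<k. w i 0 * v i x)" "h = (\<lambda>x. \<Sum>i<k'. w' i 0 * v' i x)"
    using e(1)[of 0] e'(1)[of 0] by (auto simp: act_1)
  have "P f h (act (mexp (cscale (- t) \<xi>)) x) =
      (\<Sum>i<k. \<Sum>j<k'. w i t * w' j t * P (v i) (v' j) x)" for t
    using inv[unfolded bivector_invariant_def, rule_format, OF mexp_mem[OF \<xi>, of "- t"] f h, of x]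
    unfolding e e' bilin by simp
  then have "((\<lambda>t. \<Sum>i<k. \<Sum>j<k'. w i t * w' j t * P (v i) (v' j) x) has_field_derivative
      inf_act act \<xi> (P f h) x) (at 0)"
    using DERIV_inf_act[OF _ \<xi>, of "P f h" x] bivector_mem[OF P f h] by simp
  moreover have "((\<lambda>t. \<Sum>i<k. \<Sum>j<k'. w i t * w' j t * P (v i) (v' j) x) has_field_derivative
      (\<Sum>i<k. \<Sum>j<k'. (c i * w' j 0 + w i 0 * c' j) * P (v i) (v' j) x)) (at 0)"
    by (auto intro!: derivative_eq_intros w w' sum.cong simp: algebra_simps)
  ultimately have "inf_act act \<xi> (P f h) x = (\<Sum>i<k. \<Sum>j<k'. (c i * w' j 0 + w i 0 * c' j) * P (v i) (v' j) x)"
    by (rule DERIV_unique)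
  also have "\<dots> = P (inf_act act \<xi> f) (\<lambda>x. \<Sum>i<k'. w' i 0 * v' i x) x
      + P (\<lambda>x. \<Sum>i<k. w i 0 * v i x) (inf_act act \<xi> h) x"
    unfolding e e' bilin by (simp add: sum.distrib algebra_simps)
  finally show ?thesis using 0 by simp
qed

text \<open>The action of \<open>g\<close> commutes with the flow of \<xi>, so the two functions of
  \<open>t\<close> being differentiated coincide.\<close>

lemma inf_act_invariant:
  assumes \<xi>: "\<xi> \<in> lie_alg G" and g: "g \<in> G"
    and comm: "\<And>t. mexp (cscale t \<xi>) ** g = g ** mexp (cscale t \<xi>)"
  shows "inf_act act \<xi> (\<lambda>y. f (act g y)) x = inf_act act \<xi> f (act g x)"
  unfolding inf_act_def
  by (simp flip: act_mult[OF g mexp_mem[OF \<xi>]] act_mult[OF mexp_mem[OF \<xi>] g] add: comm)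

end

section \<open>Schouten brackets with invariant bivectors\<close>

lemma point_derivation_lincomb:
  assumes "\<And>t. t \<in> T \<Longrightarrow> point_derivation A x (v t)"
  shows "point_derivation A x (\<lambda>f. \<Sum>t\<in>T. c t * v t f)"
proof -
  have v: "v t (\<lambda>_. k) = 0" "f \<in> A \<Longrightarrow> g \<in> A \<Longrightarrow> v t (\<lambda>y. f y + g y) = v t f + v t g"
    "f \<in> A \<Longrightarrow> g \<in> A \<Longrightarrow> v t (\<lambda>y. f y * g y) = v t f * g x + f x * v t g"
    if "t \<in> T" for t k f g
    using assms[OF that] by (auto simp: point_derivation_def)
  show ?thesis
    unfolding point_derivation_def
    by (auto simp: v sum.distrib sum_distrib_left sum_distrib_right algebra_simps cong: sum.cong)
qed

context function_algebra
begin

lemma bivectorI: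
  assumes "\<And>f g. f \<in> A \<Longrightarrow> g \<in> A \<Longrightarrow> P f g \<in> A"
    and "\<And>f g x. f \<in> A \<Longrightarrow> g \<in> A \<Longrightarrow> P f g x = - P g f x"
    and "\<And>f x. f \<in> A \<Longrightarrow> point_derivation A x (\<lambda>g. P f g x)"
  shows "bivector A P"
proof -
  have "(\<forall>c. P f (\<lambda>_. c) x = 0)"
    "(\<forall>g\<in>A. \<forall>h\<in>A. P f (\<lambda>y. g y + h y) x = P f g x + P f h x)"
    "(\<forall>g\<in>A. \<forall>h\<in>A. P f (\<lambda>y. g y * h y) x = P f g x * h x + g x * P f h x)"
    if "f \<in> A" for f x
    using assms(3)[OF that, of x] unfolding point_derivation_def by blast+
  with assms(1,2) show ?thesis
    unfolding bivector_def by (intro conjI ballI allI) blast+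
qed

lemma bivector_wedge2:
  assumes "derivation A X" "derivation A Y"
  shows "bivector A (wedge2 X Y)"
proof (rule bivectorI)
  have mem: "X f \<in> A" "Y f \<in> A" if "f \<in> A" for f
    using assms that by (auto simp: derivation_def)
  fix f assume f: "f \<in> A"
  show "wedge2 X Y f g \<in> A" if "g \<in> A" for g
    unfolding wedge2_def by (intro closed_intros mem f that)
  show "wedge2 X Y f g x = - wedge2 X Y g f x" for g x
    by (simp add: wedge2_def)
  show "point_derivation A x (\<lambda>g. wedge2 X Y f g x)" for x
    using assms by (simp add: point_derivation_def derivation_def wedge2_def algebra_simps)
qed

lemma bivector_lincomb:
  assumes Q: "\<And>t. t \<in> T \<Longrightarrow> bivector A (Q t)"
  shows "bivector A (\<lambda>f g x. \<Sum>t\<in>T. c t * Q t f g x)"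
proof (rule bivectorI)
  fix f assume f: "f \<in> A"
  show "(\<lambda>x. \<Sum>t\<in>T. c t * Q t f g x) \<in> A" if "g \<in> A" for g
    by (intro closed_intros bivector_mem[OF Q] f that)
  show "(\<Sum>t\<in>T. c t * Q t f g x) = - (\<Sum>t\<in>T. c t * Q t g f x)" if "g \<in> A" for g x
    unfolding sum_negf[symmetric]
  proof (rule sum.cong)
    fix t assume "t \<in> T"
    show "c t * Q t f g x = - (c t * Q t g f x)"
      using bivector_skew[OF Q[OF \<open>t \<in> T\<close>] f that, of x] by simp
  qed simp
  show "point_derivation A x (\<lambda>g. \<Sum>t\<in>T. c t * Q t f g x)" for x
    by (intro point_derivation_lincomb point_derivation_bivector[OF Q] f)
qed

lemma bivector_bivector_add:
  assumes P: "bivector A P" and Q: "bivector A Q"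
  shows "bivector A (bivector_add P Q)"
proof -
  \<comment> \<open>The sum is read as a linear combination indexed by the two booleans.\<close>
  have "bivector A (\<lambda>f g x. \<Sum>b\<in>UNIV. 1 * (if b then P else Q) f g x)"
    by (rule bivector_lincomb) (simp add: P Q)
  then show ?thesis by (simp add: UNIV_bool bivector_add_def[abs_def] add.commute)
qed

text \<open>The bracket is a combination of Lie derivatives of \<open>P\<close> along
  \<open>X\<close> and \<open>Y\<close>, which vanish by \<open>LX\<close> and \<open>LY\<close>.
  Concretely, these expand \<open>X (P g h)\<close> and \<open>Y (P g h)\<close>, skew-symmetry
  moves \<open>X\<close> and \<open>Y\<close> into the second argument of \<open>P\<close>, and the
  cyclic sums cancel.\<close>

lemma schouten_wedge2_invariant:
  assumes P: "bivector A P" and X: "derivation A X" and Y: "derivation A Y"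
    and LX: "\<And>f g x. f \<in> A \<Longrightarrow> g \<in> A \<Longrightarrow> X (P f g) x = P (X f) g x + P f (X g) x"
    and LY: "\<And>f g x. f \<in> A \<Longrightarrow> g \<in> A \<Longrightarrow> Y (P f g) x = P (Y f) g x + P f (Y g) x"
    and A: "f \<in> A" "g \<in> A" "h \<in> A"
  shows "schouten P (wedge2 X Y) f g h x = 0"
proof -
  obtain B where B: "A = gen_alg B" using generated by blast
  have mem: "X f \<in> A" "Y f \<in> A" if "f \<in> A" for f
    using X Y that by (auto simp: derivation_def)
  have dP: "derivation A (P f)" if "f \<in> A" for f
    using P that unfolding bivector_def derivation_def by (elim conjE) (intro conjI ballI allI; blast)
  have P1: "P f (wedge2 X Y g h) x =
      P f (X g) x * Y h x + X g x * P f (Y h) x - P f (Y g) x * X h x - Y g x * P f (X h) x"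
    if "f \<in> A" "g \<in> A" "h \<in> A" for f g h
    by (rule derivation_wedge2[OF B dP X Y]) (fact that)+
  have P2: "wedge2 X Y f (P g h) x =
      X f x * (P g (Y h) x - P h (Y g) x) - (P g (X h) x - P h (X g) x) * Y f x"
    if "f \<in> A" "g \<in> A" "h \<in> A" for f g h
    using that bivector_skew[OF P mem(1)[OF that(2)] that(3), of x]
      bivector_skew[OF P mem(2)[OF that(2)] that(3), of x]
    by (simp add: wedge2_def LX LY)
  show ?thesis
    unfolding schouten_def by (simp add: P1 P2 A algebra_simps)
qed

lemma schouten_lincomb:
  assumes P: "bivector A P" and Q: "\<And>t. t \<in> T \<Longrightarrow> bivector A (Q t)"
    and A: "f \<in> A" "g \<in> A" "h \<in> A"
  shows "schouten P (\<lambda>f g x. \<Sum>t\<in>T. c t * Q t f g x) f g h x = (\<Sum>t\<in>T. c t * schouten P (Q t) f g h x)"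
proof -
  have "P f (\<lambda>x. \<Sum>t\<in>T. c t * Q t g h x) x = (\<Sum>t\<in>T. c t * P f (Q t g h) x)"
    if "f \<in> A" "g \<in> A" "h \<in> A" for f g h
    by (rule pd_lincomb[OF point_derivation_bivector[OF P]]) (auto intro: bivector_mem[OF Q] that)
  with A show ?thesis
    by (simp add: schouten_def sum.distrib distrib_left)
qed

text \<open>The factor 2 arises because \<open>schouten\<close> is symmetric in its two
  bivectors.\<close>

lemma schouten_bivector_add:
  assumes P: "bivector A P" and Q: "bivector A Q" and A: "f \<in> A" "g \<in> A" "h \<in> A"
  shows "schouten (bivector_add P Q) (bivector_add P Q) f g h x =
    schouten P P f g h x + 2 * schouten P Q f g h x + schouten Q Q f g h x"
proof -
  have add: "R f (bivector_add P Q g h) x = R f (P g h) x + R f (Q g h) x"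
    if "bivector A R" "f \<in> A" "g \<in> A" "h \<in> A" for R f g h
    unfolding bivector_add_def[abs_def]
    by (rule pd_add[OF point_derivation_bivector[OF that(1,2)]]) (intro bivector_mem[OF P] bivector_mem[OF Q] that)+
  have "bivector_add P Q f (bivector_add P Q g h) x =
      P f (P g h) x + P f (Q g h) x + Q f (P g h) x + Q f (Q g h) x"
    if "f \<in> A" "g \<in> A" "h \<in> A" for f g h
    unfolding bivector_add_def[of P Q f] using add[OF P that] add[OF Q that] by simp
  with A show ?thesis by (simp add: schouten_def)
qed

end

section \<open>The central vector fields\<close>

locale central_G_set = algebraic_G_set A G act
  for A :: "('m \<Rightarrow> complex) set" and G :: "('n::finite cmat) set" and act +
  fixes blk :: "'n \<Rightarrow> nat" and l :: nat and Gs :: "nat \<Rightarrow> 'n cmat set"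
  assumes blocks: "block_decomposition blk l Gs G"
    and scalars: "central_scalars blk l Gs"
begin

definition indices :: "nat set" where
  "indices = {1..l}"

abbreviation "infl j \<equiv> Inf_field act blk j"

lemma block_id_mem: "j \<in> indices \<Longrightarrow> block_id blk j \<in> lie_alg G"
  using block_scalar_mem[OF blocks scalars, of j] by (simp add: lie_alg_def mexp_block_id indices_def)

lemma derivation_Inf: "j \<in> indices \<Longrightarrow> derivation A (infl j)"
  unfolding Inf_field_def by (intro derivation_inf_act block_id_mem)

lemma Inf_invariant:
  assumes "j \<in> indices" "g \<in> G"
  shows "infl j (\<lambda>y. f (act g y)) x = infl j f (act g x)"
  unfolding Inf_field_def
  by (rule inf_act_invariant[OF block_id_mem[OF assms(1)] assms(2)])
    (simp add: mexp_block_id block_scalar_commute[OF block_diagonal_mem[OF blocks assms(2)]])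

lemma Inf_bivector:
  assumes "bivector A P" "bivector_invariant A G act P" "j \<in> indices" "f \<in> A" "h \<in> A"
  shows "infl j (P f h) x = P (infl j f) h x + P f (infl j h) x"
  unfolding Inf_field_def by (intro inf_act_bivector assms block_id_mem)

text \<open>A single index set replaces the double sums of \<open>psi\<close> and
  \<open>varpi\<close>, so that the results on linear combinations apply in one go.\<close>

definition pairs :: "(nat \<times> nat) set" where
  "pairs = (SIGMA i:indices. {i<..l})"

lemma pairs_mem: "t \<in> pairs \<Longrightarrow> fst t \<in> indices" "t \<in> pairs \<Longrightarrow> snd t \<in> indices"
  by (auto simp: pairs_def indices_def)

lemma sum_pairs: "(\<Sum>i\<in>{1..l}. \<Sum>j\<in>{i<..l}. F i j) = (\<Sum>t\<in>pairs. F (fst t) (snd t))"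
  by (simp add: pairs_def indices_def sum.Sigma case_prod_beta)

lemma psi_eq:
  "psi act blk l z = (\<lambda>f g x. \<Sum>t\<in>pairs. z (fst t) (snd t) * wedge2 (infl (fst t)) (infl (snd t)) f g x)"
  by (intro ext) (simp only: psi_def sum_pairs)

lemma bivector_psi: "bivector A (psi act blk l z)"
  unfolding psi_eq by (intro bivector_lincomb bivector_wedge2 derivation_Inf pairs_mem)

lemma bivector_invariant_psi: "bivector_invariant A G act (psi act blk l z)"
  unfolding bivector_invariant_def psi_eq
  by (auto simp: wedge2_def Inf_invariant pairs_mem intro!: sum.cong simp del: split_paired_All)

text \<open>Each wedge in \<open>psi\<close> is built from fields preserving \<open>P\<close>.
  Taking the given bivector for \<open>P\<close> kills the mixed term, taking \<open>psi\<close>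
  itself kills the quadratic term.\<close>

lemma schouten_psi:
  assumes P: "bivector A P" "bivector_invariant A G act P" and A: "f \<in> A" "g \<in> A" "h \<in> A"
  shows "schouten P (psi act blk l z) f g h x = 0"
proof -
  have "schouten P (wedge2 (infl (fst t)) (infl (snd t))) f g h x = 0" if "t \<in> pairs" for t
    by (intro schouten_wedge2_invariant P derivation_Inf pairs_mem Inf_bivector A that)
  then show ?thesis
    unfolding psi_eq
    by (subst schouten_lincomb) (auto intro!: P bivector_wedge2 derivation_Inf pairs_mem A)
qed

text \<open>The flow acts by nonzero scalars on block \<open>j\<close>. Conjugation by these fixes
  every block-diagonal matrix, so by equivariance \<Phi> is constant along the flow.\<close>

lemma Inf_moment_map:
  assumes \<Phi>: "equivariant_morphism A G act \<Phi>" and j: "j \<in> indices"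
  shows "infl j (\<lambda>y. F (\<Phi> y)) x = 0"
proof -
  have "\<Phi> (act (block_scalar blk j c) x) = \<Phi> x" if "c \<noteq> 0" for c
  proof -
    have s: "block_scalar blk j c \<in> G" using block_scalar_mem[OF blocks scalars _ that] j by (simp add: indices_def)
    have inv: "invertible (block_scalar blk j c)" using group s by (simp add: matrix_group_def)
    have "\<Phi> x \<in> G" using \<Phi> by (simp add: equivariant_morphism_def)
    then have "block_scalar blk j c ** \<Phi> x = \<Phi> x ** block_scalar blk j c"
      by (intro block_scalar_commute block_diagonal_mem[OF blocks])
    moreover have "\<Phi> (act (block_scalar blk j c) x)
        = block_scalar blk j c ** \<Phi> x ** matrix_inv (block_scalar blk j c)"
      using \<Phi> s by (simp add: equivariant_morphism_def)
    ultimately show ?thesis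
      by (simp add: matrix_mul_assoc[symmetric] matrix_inv_mul(1)[OF inv])
  qed
  then have "infl j (\<lambda>y. F (\<Phi> y)) x = deriv (\<lambda>t. F (\<Phi> x)) 0"
    by (simp add: Inf_field_def inf_act_def mexp_block_id)
  then show ?thesis by simp
qed

lemma hamiltonian_quasi_Poisson_add_psi:
  assumes "hamiltonian_quasi_Poisson A G act d E E' P \<Phi>"
  shows "hamiltonian_quasi_Poisson A G act d E E' (bivector_add P (psi act blk l z)) \<Phi>"
proof -
  have P: "bivector A P" "bivector_invariant A G act P"
    and S: "\<And>f g h x. f \<in> A \<Longrightarrow> g \<in> A \<Longrightarrow> h \<in> A \<Longrightarrow> schouten P P f g h x = phi_M act d E E' f g h x"
    and \<Phi>: "equivariant_morphism A G act \<Phi>"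
    and mom: "\<And>F h x. F \<in> regfun \<Longrightarrow> h \<in> A \<Longrightarrow>
        P (\<lambda>y. F (\<Phi> y)) h x = inf_act act (D_op d E E' F (\<Phi> x)) h x"
    using assms unfolding hamiltonian_quasi_Poisson_def quasi_Poisson_def by blast+
  note psi = bivector_psi[of z] bivector_invariant_psi[of z]
  have "quasi_Poisson A G act d E E' (bivector_add P (psi act blk l z))"
    unfolding quasi_Poisson_def
  proof (intro conjI ballI allI)
    show "bivector A (bivector_add P (psi act blk l z))"
      by (intro bivector_bivector_add P psi)
    show "bivector_invariant A G act (bivector_add P (psi act blk l z))"
      using P(2) psi(2) by (simp add: bivector_invariant_def bivector_add_def)
    show "schouten (bivector_add P (psi act blk l z)) (bivector_add P (psi act blk l z)) f g h x
        = phi_M act d E E' f g h x" if "f \<in> A" "g \<in> A" "h \<in> A" for f g h x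
      using that by (simp add: schouten_bivector_add P psi schouten_psi S)
  qed
  \<comment> \<open>Every term has a factor \<open>infl j\<close> applied to a function of \<Phi>,
    so the moment map condition for \<open>P\<close> carries over unchanged.\<close>
  moreover have "psi act blk l z (\<lambda>y. F (\<Phi> y)) h x = 0" for F h x
    unfolding psi_eq by (simp add: wedge2_def Inf_moment_map[OF \<Phi>] pairs_mem)
  ultimately show ?thesis
    using \<Phi> mom by (simp add: hamiltonian_quasi_Poisson_def bivector_add_def)
qed

end

section \<open>Calculus of Kaehler forms\<close>

text \<open>The three supports may differ because of cancellation; all sums are extended by zeros to
  a common finite set of symbols.\<close>

lemma sum_keys_diff:
  fixes \<phi> :: "'b \<Rightarrow> complex"
  shows "(\<Sum>t\<in>Poly_Mapping.keys (a - b). of_int (Poly_Mapping.lookup (a - b) t) * \<phi> t) =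
    (\<Sum>t\<in>Poly_Mapping.keys a. of_int (Poly_Mapping.lookup a t) * \<phi> t)
    - (\<Sum>t\<in>Poly_Mapping.keys b. of_int (Poly_Mapping.lookup b t) * \<phi> t)"
proof -
  define K where "K = Poly_Mapping.keys a \<union> Poly_Mapping.keys b"
  have *: "(\<Sum>t\<in>Poly_Mapping.keys c. of_int (Poly_Mapping.lookup c t) * \<phi> t) =
      (\<Sum>t\<in>K. of_int (Poly_Mapping.lookup c t) * \<phi> t)" if "Poly_Mapping.keys c \<subseteq> K" for c
    using that by (intro sum.mono_neutral_left) (auto simp: K_def in_keys_iff)
  have K: "Poly_Mapping.keys (a - b) \<subseteq> K" "Poly_Mapping.keys a \<subseteq> K" "Poly_Mapping.keys b \<subseteq> K"
    using keys_diff[of a b] by (auto simp: K_def)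
  show ?thesis
    unfolding *[OF K(1)] *[OF K(2)] *[OF K(3)]
    by (simp add: lookup_minus algebra_simps sum_subtractf)
qed

lemma eval1_diff: "eval1 (\<alpha> - \<beta>) x v = eval1 \<alpha> x v - eval1 \<beta> x v"
  unfolding eval1_def by (rule sum_keys_diff)

lemma eval2_diff: "eval2 (\<alpha> - \<beta>) x v w = eval2 \<alpha> x v w - eval2 \<beta> x v w"
  unfolding eval2_def by (rule sum_keys_diff)

lemma eval1_0 [simp]: "eval1 0 x v = 0"
  by (simp add: eval1_def)

lemma eval2_0 [simp]: "eval2 0 x v w = 0"
  by (simp add: eval2_def)

lemma eval1_add: "eval1 (\<alpha> + \<beta>) x v = eval1 \<alpha> x v + eval1 \<beta> x v"
  using eval1_diff[of \<alpha> "0 - \<beta>"] eval1_diff[of 0 \<beta>] by simp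

lemma eval2_add: "eval2 (\<alpha> + \<beta>) x v w = eval2 \<alpha> x v w + eval2 \<beta> x v w"
  using eval2_diff[of \<alpha> "0 - \<beta>"] eval2_diff[of 0 \<beta>] by simp

lemma eval1_sum: "eval1 (\<Sum>i\<in>I. \<alpha> i) x v = (\<Sum>i\<in>I. eval1 (\<alpha> i) x v)"
  by (induction I rule: infinite_finite_induct) (simp_all add: eval1_add)

lemma eval2_sum: "eval2 (\<Sum>i\<in>I. \<alpha> i) x v w = (\<Sum>i\<in>I. eval2 (\<alpha> i) x v w)"
  by (induction I rule: infinite_finite_induct) (simp_all add: eval2_add)

lemma eval1_of [simp]: "eval1 (frag_of (a, as)) x v = a x * v (as ! 0)"
  by (simp add: eval1_def)

lemma eval2_of [simp]:
  "eval2 (frag_of (a, as)) x v w = a x * (v (as ! 0) * w (as ! 1) - v (as ! 1) * w (as ! 0))"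
  by (simp add: eval2_def)

text \<open>Homomorphisms from a free abelian group are determined by their values on generators.
  Additivity is phrased with differences, which also yields the value 0 at 0.\<close>

lemma frag_ext:
  fixes F F' :: "('b \<Rightarrow>\<^sub>0 int) \<Rightarrow> 'c::ab_group_add"
  assumes "\<And>a b. F (a - b) = F a - F b" "\<And>a b. F' (a - b) = F' a - F' b"
    and "\<And>t. F (frag_of t) = F' (frag_of t)"
  shows "F \<omega> = F' \<omega>"
proof -
  have "Poly_Mapping.keys \<omega> \<subseteq> UNIV" by simp
  then show ?thesis
    by (induction rule: frag_induction)
      (use assms assms(1)[of 0 0] assms(2)[of 0 0] in auto)
qed

lemma eval1_flat: "eval1 (flat \<omega> X) x v = eval2 \<omega> x (\<lambda>f. X f x) v"
  by (rule frag_ext[where \<omega> = \<omega>])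
    (auto simp: flat_def frag_extend_diff eval1_diff eval2_diff algebra_simps)

section \<open>Additivity of the operations on forms and their values on symbols\<close>

lemma form_sum:
  shows form_scale_sum: "form_scale f (\<Sum>i\<in>I. \<alpha> i) = (\<Sum>i\<in>I. form_scale f (\<alpha> i))"
    and form_wedge_sum_left: "form_wedge (\<Sum>i\<in>I. \<alpha> i) \<beta> = (\<Sum>i\<in>I. form_wedge (\<alpha> i) \<beta>)"
    and form_pullback_sum: "form_pullback \<Phi> (\<Sum>i\<in>I. \<gamma> i) = (\<Sum>i\<in>I. form_pullback \<Phi> (\<gamma> i))"
    and ext_d_sum: "ext_d (\<Sum>i\<in>I. \<alpha> i) = (\<Sum>i\<in>I. ext_d (\<alpha> i))"
    and flat_sum: "flat (\<Sum>i\<in>I. \<alpha> i) X = (\<Sum>i\<in>I. flat (\<alpha> i) X)"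
  unfolding form_scale_def form_wedge_def form_pullback_def ext_d_def flat_def
  by (induction I rule: infinite_finite_induct; simp add: frag_extend_add)+

lemma form_wedge_sum_right: "form_wedge \<alpha> (\<Sum>i\<in>I. \<beta> i) = (\<Sum>i\<in>I. form_wedge \<alpha> (\<beta> i))"
proof (rule frag_ext[where \<omega> = \<alpha>])
  show "form_wedge (frag_of t) (\<Sum>i\<in>I. \<beta> i) = (\<Sum>i\<in>I. form_wedge (frag_of t) (\<beta> i))" for t
    unfolding form_wedge_def
    by (induction I rule: infinite_finite_induct) (simp_all add: frag_extend_add case_prod_beta)
qed (simp_all add: form_wedge_def frag_extend_diff sum_subtractf)

lemma form_of [simp]:
  shows "form_scale f (frag_of (a, as)) = frag_of (\<lambda>x. f x * a x, as)"
    and "form_wedge (frag_of (a, as)) (frag_of (b, bs)) = frag_of (\<lambda>x. a x * b x, as @ bs)"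
    and "ext_d (frag_of (a, as)) = frag_of (\<lambda>_. 1, a # as)"
    and "flat (frag_of (a, as)) X =
      frag_of (\<lambda>x. a x * X (as ! 0) x, [as ! 1]) - frag_of (\<lambda>x. a x * X (as ! 1) x, [as ! 0])"
  by (simp_all add: form_scale_def form_wedge_def ext_d_def flat_def)

lemma form_pullback_of [simp]:
  "form_pullback \<Phi> (frag_of (a, as)) = frag_of (\<lambda>x. a (\<Phi> x), map (\<lambda>f x. f (\<Phi> x)) as)"
  by (simp add: form_pullback_def comp_def)

lemma form_add:
  shows "form_pullback \<Phi> (\<gamma> + \<delta>) = form_pullback \<Phi> \<gamma> + form_pullback \<Phi> \<delta>"
    and "ext_d (\<alpha> + \<beta>) = ext_d \<alpha> + ext_d \<beta>"
    and "flat (\<alpha> + \<beta>) X = flat \<alpha> X + flat \<beta> X"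
  by (simp_all add: form_pullback_def ext_d_def flat_def frag_extend_add)

text \<open>One operation that covers scaling by functions and wedge products with exact forms on either
  side.\<close>

definition form_ins ::
  "('m \<Rightarrow> complex) \<Rightarrow> ('m \<Rightarrow> complex) list \<Rightarrow> ('m \<Rightarrow> complex) list \<Rightarrow> 'm form \<Rightarrow> 'm form" where
  "form_ins b us vs = frag_extend (\<lambda>(a, as). frag_of (\<lambda>x. b x * a x, us @ as @ vs))"

lemma form_scale_eq_ins: "form_scale f = form_ins f [] []"
  by (simp add: form_ins_def form_scale_def)

lemma form_ins_of [simp]: "form_ins b us vs (frag_of (a, as)) = frag_of (\<lambda>x. b x * a x, us @ as @ vs)"
  by (simp add: form_ins_def)

lemma form_ins_diff: "form_ins b us vs (\<alpha> - \<beta>) = form_ins b us vs \<alpha> - form_ins b us vs \<beta>"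
  by (simp add: form_ins_def frag_extend_diff)

lemma form_ins_minus: "form_ins b us vs (- \<beta>) = - form_ins b us vs \<beta>"
  by (simp add: form_ins_def frag_extend_minus)

lemma form_ins_0 [simp]: "form_ins b us vs 0 = 0"
  by (simp add: form_ins_def)

lemma form_ins_add: "form_ins b us vs (\<alpha> + \<beta>) = form_ins b us vs \<alpha> + form_ins b us vs \<beta>"
  by (simp add: form_ins_def frag_extend_add)

lemma form_ins_sum: "form_ins b us vs (\<Sum>i\<in>I. \<alpha> i) = (\<Sum>i\<in>I. form_ins b us vs (\<alpha> i))"
  by (induction I rule: infinite_finite_induct) (simp_all add: form_ins_add)

lemma form_wedge_of_right: "form_wedge \<omega> (frag_of (b, bs)) = form_ins b [] bs \<omega>"
  by (rule frag_ext[where \<omega> = \<omega>])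
    (auto simp: form_wedge_def form_ins_def frag_extend_diff mult.commute)

lemma form_wedge_of_left: "form_wedge (frag_of (b, bs)) \<omega> = form_ins b bs [] \<omega>"
  by (rule frag_ext[where \<omega> = \<omega>])
    (auto simp: form_wedge_def form_ins_def frag_extend_diff)

section \<open>Congruence of forms modulo null forms, and membership in \<open>kform\<close>\<close>

lemma null_form_uminus: "\<omega> \<in> null_form A k \<Longrightarrow> - \<omega> \<in> null_form A k"
  using null_form.diff[OF null_form.zero] by force

lemma null_form_add: "\<omega> \<in> null_form A k \<Longrightarrow> \<omega>' \<in> null_form A k \<Longrightarrow> \<omega> + \<omega>' \<in> null_form A k"
  using null_form.diff[OF _ null_form_uminus] by force

lemma null_form_sum: "(\<And>i. i \<in> I \<Longrightarrow> \<omega> i \<in> null_form A k) \<Longrightarrow> (\<Sum>i\<in>I. \<omega> i) \<in> null_form A k"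
  by (induction I rule: infinite_finite_induct) (auto intro: null_form.zero null_form_add)

lemma form_eq_0: "form_eq A k \<omega> 0 \<longleftrightarrow> \<omega> \<in> null_form A k"
  by (simp add: form_eq_def)

lemma form_eq_refl [simp]: "form_eq A k \<omega> \<omega>"
  by (simp add: form_eq_def null_form.zero)

lemma form_eq_sym: "form_eq A k \<omega> \<omega>' \<Longrightarrow> form_eq A k \<omega>' \<omega>"
  using null_form_uminus[of "\<omega> - \<omega>'"] by (simp add: form_eq_def)

lemma form_eq_trans [trans]: "form_eq A k \<alpha> \<beta> \<Longrightarrow> form_eq A k \<beta> \<gamma> \<Longrightarrow> form_eq A k \<alpha> \<gamma>"
  using null_form_add[of "\<alpha> - \<beta>" A k "\<beta> - \<gamma>"] by (simp add: form_eq_def)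

lemma form_eq_add: "form_eq A k \<alpha> \<alpha>' \<Longrightarrow> form_eq A k \<beta> \<beta>' \<Longrightarrow> form_eq A k (\<alpha> + \<beta>) (\<alpha>' + \<beta>')"
  using null_form_add[of "\<alpha> - \<alpha>'" A k "\<beta> - \<beta>'"] by (simp add: form_eq_def algebra_simps)

lemma form_eq_minus: "form_eq A k \<alpha> \<alpha>' \<Longrightarrow> form_eq A k (- \<alpha>) (- \<alpha>')"
  using null_form_uminus[of "\<alpha> - \<alpha>'" A k] by (simp add: form_eq_def)

lemma form_eq_sum: "(\<And>i. i \<in> I \<Longrightarrow> form_eq A k (\<alpha> i) (\<beta> i)) \<Longrightarrow> form_eq A k (\<Sum>i\<in>I. \<alpha> i) (\<Sum>i\<in>I. \<beta> i)"
  by (induction I rule: infinite_finite_induct) (auto intro: form_eq_add)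

lemma kform_of: "frag_of (a, as) \<in> kform A k \<longleftrightarrow> a \<in> A \<and> set as \<subseteq> A \<and> length as = k"
  by (simp add: kform_def)

lemma kform_add: "\<alpha> \<in> kform A k \<Longrightarrow> \<beta> \<in> kform A k \<Longrightarrow> \<alpha> + \<beta> \<in> kform A k"
  using Poly_Mapping.keys_add[of \<alpha> \<beta>] by (fastforce simp: kform_def)

lemma kform_0: "0 \<in> kform A k"
  by (simp add: kform_def)

lemma kform_sum: "(\<And>i. i \<in> I \<Longrightarrow> \<alpha> i \<in> kform A k) \<Longrightarrow> (\<Sum>i\<in>I. \<alpha> i) \<in> kform A k"
  by (induction I rule: infinite_finite_induct) (auto intro: kform_add kform_0)

context function_algebra
begin

text \<open>Each generating relation goes to a relation of the same kind: \<open>b\<close> is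
  absorbed in the coefficient and the inserted lists in the outer lists of differentials.\<close>

lemma null_form_ins:
  assumes "\<omega> \<in> null_form A k" and b: "b \<in> A" and us: "set us \<subseteq> A" "set vs \<subseteq> A"
    and n: "n = length us + k + length vs"
  shows "form_ins b us vs \<omega> \<in> null_form A n"
  using assms(1)
proof induction
  case zero
  then show ?case by (simp add: null_form.zero)
next
  case (diff \<omega> \<omega>')
  then show ?case by (simp add: form_ins_diff null_form.diff)
next
  case (coeff_add a c as)
  then show ?case
    using null_form.coeff_add[of "\<lambda>x. b x * a x" A "\<lambda>x. b x * c x" "us @ as @ vs" n] b us n
    by (simp add: form_ins_diff mult_mem distrib_left)
next
  case (d_const a us' vs' c)
  then show ?case
    using null_form.d_const[of "\<lambda>x. b x * a x" A "us @ us'" "vs' @ vs" n c] b us n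
    by (simp add: mult_mem)
next
  case (d_add a f g us' vs')
  then show ?case
    using null_form.d_add[of "\<lambda>x. b x * a x" A f g "us @ us'" "vs' @ vs" n] b us n
    by (simp add: form_ins_diff mult_mem)
next
  case (d_mult a f g us' vs')
  then show ?case
    using null_form.d_mult[of "\<lambda>x. b x * a x" A f g "us @ us'" "vs' @ vs" n] b us n
    by (simp add: form_ins_diff mult_mem mult.assoc)
next
  case (alt a f us' vs' ws)
  then show ?case
    using null_form.alt[of "\<lambda>x. b x * a x" A f "us @ us'" vs' "ws @ vs" n] b us n
    by (simp add: mult_mem)
qed

lemma form_eq_ins:
  assumes "form_eq A k \<alpha> \<beta>" "b \<in> A" "set us \<subseteq> A" "set vs \<subseteq> A" "n = length us + k + length vs"
  shows "form_eq A n (form_ins b us vs \<alpha>) (form_ins b us vs \<beta>)"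
  using null_form_ins[OF assms(1)[unfolded form_eq_def] assms(2-)] by (simp add: form_eq_def form_ins_diff)

text \<open>Evaluation at a point derivation descends to Kaehler 1-forms. The relation
  \<open>alt\<close> cannot occur in degree 1, where there is no room for a repeated
  differential.\<close>

lemma eval1_null_form:
  assumes "\<omega> \<in> null_form A (Suc 0)" and v: "point_derivation A x v"
  shows "eval1 \<omega> x v = 0"
  using assms(1)
proof induction
  case (d_mult a f g us vs)
  then show ?case by (auto simp: eval1_diff eval1_add pd_mult[OF v] algebra_simps)
qed (auto simp: eval1_diff eval1_add pd_const[OF v] pd_add[OF v] algebra_simps)

lemma form_eq_coeff_add:
  "\<lbrakk>a \<in> A; b \<in> A; set as \<subseteq> A; length as = k\<rbrakk> \<Longrightarrow>
    form_eq A k (frag_of (\<lambda>x. a x + b x, as)) (frag_of (a, as) + frag_of (b, as))"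
  using null_form.coeff_add[of a A b as k] by (simp add: form_eq_def algebra_simps)

text \<open>The relation \<open>coeff_add\<close> with both coefficients 0 leaves exactly minus this
  symbol.\<close>

lemma form_eq_coeff_0:
  assumes "set as \<subseteq> A" "length as = k"
  shows "form_eq A k (frag_of (\<lambda>_. 0, as)) 0"
  using null_form_uminus[OF null_form.coeff_add[of "\<lambda>_. 0" A "\<lambda>_. 0" as k]] assms
  by (simp add: form_eq_def const_mem)

lemma form_eq_coeff_sum:
  assumes "finite I" "\<And>i. i \<in> I \<Longrightarrow> F i \<in> A" "set as \<subseteq> A" "length as = k"
  shows "form_eq A k (frag_of (\<lambda>x. \<Sum>i\<in>I. F i x, as)) (\<Sum>i\<in>I. frag_of (F i, as))"
  using assms(1,2)
proof (induction I)
  case (insert i I)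
  have "form_eq A k (frag_of (\<lambda>x. F i x + (\<Sum>i\<in>I. F i x), as))
      (frag_of (F i, as) + frag_of (\<lambda>x. \<Sum>i\<in>I. F i x, as))"
    using insert assms by (intro form_eq_coeff_add sum_mem) auto
  also have "form_eq A k \<dots> (frag_of (F i, as) + (\<Sum>i\<in>I. frag_of (F i, as)))"
    using insert by (intro form_eq_add) auto
  finally show ?case using insert by simp
qed (use assms form_eq_coeff_0 in simp)

lemma form_eq_d_sum:
  assumes "finite I" "\<And>i. i \<in> I \<Longrightarrow> F i \<in> A" "a \<in> A" "set us \<subseteq> A" "set vs \<subseteq> A" "length us + 1 + length vs = k"
  shows "form_eq A k (frag_of (a, us @ [\<lambda>x. \<Sum>i\<in>I. F i x] @ vs)) (\<Sum>i\<in>I. frag_of (a, us @ [F i] @ vs))"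
  using assms(1,2)
proof (induction I)
  case empty
  then show ?case
    using null_form.d_const[of a A us vs k 0] assms by (simp add: form_eq_0)
next
  case (insert i I)
  have "form_eq A k (frag_of (a, us @ [\<lambda>x. F i x + (\<Sum>i\<in>I. F i x)] @ vs))
      (frag_of (a, us @ [F i] @ vs) + frag_of (a, us @ [\<lambda>x. \<Sum>i\<in>I. F i x] @ vs))"
    using null_form.d_add[of a A "F i" "\<lambda>x. \<Sum>i\<in>I. F i x" us vs k] insert assms
    by (simp add: form_eq_def sum_mem algebra_simps)
  also have "form_eq A k \<dots> (frag_of (a, us @ [F i] @ vs) + (\<Sum>i\<in>I. frag_of (a, us @ [F i] @ vs)))"
    using insert by (intro form_eq_add) auto
  finally show ?case using insert by simp
qed

lemma form_eq_d_mult: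
  assumes "a \<in> A" "f \<in> A" "g \<in> A" "set us \<subseteq> A" "set vs \<subseteq> A" "length us + 1 + length vs = k"
  shows "form_eq A k (frag_of (a, us @ [\<lambda>x. f x * g x] @ vs))
    (frag_of (\<lambda>x. a x * f x, us @ [g] @ vs) + frag_of (\<lambda>x. a x * g x, us @ [f] @ vs))"
  using null_form.d_mult[OF assms] by (simp add: form_eq_def algebra_simps)

text \<open>Leibniz rule with the differential of the constant dropped. Complex scalars live in the
  coefficient functions, since the free group has integer coefficients.\<close>

lemma form_eq_d_cmult:
  assumes "a \<in> A" "f \<in> A" "set us \<subseteq> A" "set vs \<subseteq> A" "length us + 1 + length vs = k"
  shows "form_eq A k (frag_of (a, us @ [\<lambda>x. c * f x] @ vs)) (frag_of (\<lambda>x. a x * c, us @ [f] @ vs))"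
proof -
  have "form_eq A k (frag_of (\<lambda>x. a x * f x, us @ [\<lambda>_. c] @ vs)) 0"
    using null_form.d_const[of "\<lambda>x. a x * f x" A us vs k c] assms by (simp add: form_eq_0 mult_mem)
  from form_eq_trans[OF form_eq_d_mult[OF assms(1) const_mem assms(2-)] form_eq_add[OF form_eq_refl this]]
  show ?thesis by simp
qed

text \<open>Polarisation: expand the vanishing form with both differentials equal to that of
  \<open>f + g\<close>, and remove the two diagonal terms by \<open>alt\<close>.\<close>

lemma form_eq_swap:
  assumes "a \<in> A" "f \<in> A" "g \<in> A"
  shows "form_eq A 2 (frag_of (a, [f, g])) (- frag_of (a, [g, f]))"
proof -
  have fg: "(\<lambda>x. f x + g x) \<in> A" using assms by (intro add_mem)
  have alt: "frag_of (a, [h, h]) \<in> null_form A 2" if "h \<in> A" for h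
    using null_form.alt[of a A h "[]" "[]" "[]" 2] that assms by simp
  note 1 = null_form.d_add[of a A f g "[]" "[\<lambda>x. f x + g x]" 2]
    null_form.d_add[of a A f g "[f]" "[]" 2] null_form.d_add[of a A f g "[g]" "[]" 2]
  define F where "F p q = frag_of (a, [p, q])" for p q :: "'m \<Rightarrow> complex"
  have d: "F (\<lambda>x. f x + g x) (\<lambda>x. f x + g x) - F f (\<lambda>x. f x + g x) - F g (\<lambda>x. f x + g x) \<in> null_form A 2"
    "F f (\<lambda>x. f x + g x) - F f f - F f g \<in> null_form A 2"
    "F g (\<lambda>x. f x + g x) - F g f - F g g \<in> null_form A 2"
    using 1 assms fg by (simp_all add: F_def)
  have "F (\<lambda>x. f x + g x) (\<lambda>x. f x + g x) \<in> null_form A 2" "F f f \<in> null_form A 2" "F g g \<in> null_form A 2"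
    using alt assms fg by (simp_all add: F_def)
  note null_form.diff[OF null_form.diff[OF null_form.diff[OF null_form.diff[OF null_form.diff[OF
    this(1) d(1)] d(2)] d(3)] this(2)] this(3)]
  then show ?thesis by (simp add: form_eq_def F_def)
qed

end

section \<open>The form \<open>tr(N dM)\<close>\<close>

text \<open>Summing over index pairs keeps a wedge of two such forms a double sum of
  symbols.\<close>

definition trace_form :: "('m \<Rightarrow> 'n::finite cmat) \<Rightarrow> ('m \<Rightarrow> 'n cmat) \<Rightarrow> 'm form" where
  "trace_form N M = (\<Sum>t\<in>UNIV. frag_of (\<lambda>x. N x $ snd t $ fst t, [\<lambda>x. M x $ fst t $ snd t]))"

lemma sum_UNIV_prod: "(\<Sum>t\<in>UNIV. F (fst t) (snd t)) = (\<Sum>p\<in>UNIV. \<Sum>q\<in>UNIV. F p q)"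
  by (simp add: sum.cartesian_product case_prod_beta)

lemma eval1_trace_form:
  "eval1 (trace_form N M) x v = (\<Sum>t\<in>UNIV. N x $ snd t $ fst t * v (\<lambda>x. M x $ fst t $ snd t))"
  by (simp add: trace_form_def eval1_sum)

lemma form_wedge_trace_form:
  fixes N M N' M' :: "'m \<Rightarrow> 'n::finite cmat"
  shows "form_wedge (trace_form N M) (trace_form N' M') = (\<Sum>t\<in>UNIV. \<Sum>s\<in>UNIV.
     frag_of (\<lambda>x. N x $ snd t $ fst t * N' x $ snd s $ fst s,
       [\<lambda>x. M x $ fst t $ snd t, \<lambda>x. M' x $ fst s $ snd s]))"
  unfolding trace_form_def by (simp only: form_wedge_sum_left) (simp add: form_wedge_sum_right)

lemma eval2_trace_form_wedge:
  fixes N M N' M' :: "'m \<Rightarrow> 'n::finite cmat"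
  shows "eval2 (form_scale (\<lambda>_. c) (form_wedge (trace_form N M) (trace_form N' M'))) x v w =
    c * (eval1 (trace_form N M) x v * eval1 (trace_form N' M') x w
      - eval1 (trace_form N M) x w * eval1 (trace_form N' M') x v)"
proof -
  have "eval1 (trace_form N M) x v * eval1 (trace_form N' M') x w = (\<Sum>t\<in>UNIV. \<Sum>s\<in>UNIV.
      (N x $ snd t $ fst t * v (\<lambda>x. M x $ fst t $ snd t)) * (N' x $ snd s $ fst s * w (\<lambda>x. M' x $ fst s $ snd s)))"
    for v w unfolding eval1_trace_form sum_product ..
  then show ?thesis
    by (simp add: form_wedge_trace_form form_sum eval2_sum sum_subtractf[symmetric] sum_distrib_left)
      (simp add: algebra_simps)
qed

context function_algebra
begin

lemma kform_trace_form_wedge: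
  fixes N M N' M' :: "'m \<Rightarrow> 'n::finite cmat"
  assumes "\<And>p q. (\<lambda>x. N x $ p $ q) \<in> A" "\<And>p q. (\<lambda>x. M x $ p $ q) \<in> A"
    and "\<And>p q. (\<lambda>x. N' x $ p $ q) \<in> A" "\<And>p q. (\<lambda>x. M' x $ p $ q) \<in> A"
  shows "form_scale (\<lambda>_. c) (form_wedge (trace_form N M) (trace_form N' M')) \<in> kform A 2"
  unfolding form_wedge_trace_form form_sum form_of
  by (intro kform_sum) (simp add: kform_of assms closed_intros)

text \<open>Cyclicity of the trace; \<open>h\<close> and \<open>k\<close> are constant, so they pass
  through the differential.\<close>

lemma trace_form_conj:
  assumes N: "\<And>p q. (\<lambda>x. N x $ p $ q) \<in> A" and M: "\<And>p q. (\<lambda>x. M x $ p $ q) \<in> A"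
    and hk: "h ** k = mat 1" "k ** h = mat 1"
  shows "form_eq A 1 (trace_form (\<lambda>x. h ** N x ** k) (\<lambda>x. h ** M x ** k)) (trace_form N M)"
proof -
  define n' where "n' = (\<lambda>u x. (h ** N x ** k) $ snd u $ fst u)"
  define m where "m = (\<lambda>t x. M x $ fst t $ snd t)"
  \<comment> \<open>The matrix of the linear map sending \<open>X\<close> to
    \<open>h ** X ** k\<close>, in terms of entries.\<close>
  define c where "c u t = h $ fst u $ fst t * k $ snd t $ snd u" for u t
  have m: "m t \<in> A" for t by (simp add: m_def M)
  have n': "n' u \<in> A" for u
  proof -
    have "n' u = (\<lambda>x. \<Sum>q\<in>UNIV. (\<Sum>p\<in>UNIV. h $ snd u $ p * N x $ p $ q) * k $ q $ fst u)"
      by (simp add: n'_def matrix_matrix_mult_def)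
    then show ?thesis by (auto intro!: closed_intros N)
  qed
  have e: "(h ** M x ** k) $ fst u $ snd u = (\<Sum>t\<in>UNIV. c u t * m t x)" for u x
  proof -
    have "(h ** M x ** k) $ fst u $ snd u =
        (\<Sum>q\<in>UNIV. \<Sum>p\<in>UNIV. h $ fst u $ p * k $ q $ snd u * M x $ p $ q)"
      by (simp add: matrix_matrix_mult_def sum_distrib_right sum_distrib_left mult_ac)
    also have "\<dots> = (\<Sum>p\<in>UNIV. \<Sum>q\<in>UNIV. h $ fst u $ p * k $ q $ snd u * M x $ p $ q)"
      by (rule sum.swap)
    finally show ?thesis
      by (simp add: c_def m_def sum_UNIV_prod[of "\<lambda>p q. h $ fst u $ p * k $ q $ snd u * M x $ p $ q"])
  qed
  \<comment> \<open>Moving \<open>c\<close> to the coefficients applies the transposed map, which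
    multiplies by \<open>k\<close> on the left and \<open>h\<close> on the right and so undoes the
    conjugation of \<open>N\<close>.\<close>
  have coeff: "(\<Sum>u\<in>UNIV. n' u x * c u t) = N x $ snd t $ fst t" for t x
  proof -
    have "(\<Sum>u\<in>UNIV. n' u x * c u t) =
        (\<Sum>p\<in>UNIV. \<Sum>q\<in>UNIV. k $ snd t $ q * (h ** N x ** k) $ q $ p * h $ p $ fst t)"
      by (simp add: c_def n'_def mult_ac
          sum_UNIV_prod[of "\<lambda>p q. h $ p $ fst t * (k $ snd t $ q * (h ** N x ** k) $ q $ p)"])
    also have "\<dots> = (k ** (h ** N x ** k) ** h) $ snd t $ fst t"
      by (simp add: matrix_matrix_mult_def[of _ h] matrix_matrix_mult_def[of k] sum_distrib_right)
    also have "k ** (h ** N x ** k) ** h = (k ** h) ** N x ** (k ** h)"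
      by (simp add: matrix_mul_assoc)
    finally show ?thesis using hk by simp
  qed
  have "form_eq A 1 (trace_form (\<lambda>x. h ** N x ** k) (\<lambda>x. h ** M x ** k))
      (\<Sum>u\<in>UNIV. \<Sum>t\<in>UNIV. frag_of (\<lambda>x. n' u x * c u t, [m t]))"
    unfolding trace_form_def
  proof (intro form_eq_sum)
    fix u
    have "form_eq A 1 (frag_of (n' u, [] @ [\<lambda>x. \<Sum>t\<in>UNIV. c u t * m t x] @ []))
        (\<Sum>t\<in>UNIV. frag_of (n' u, [] @ [\<lambda>x. c u t * m t x] @ []))"
      by (intro form_eq_d_sum) (auto intro!: closed_intros m n')
    also have "form_eq A 1 \<dots> (\<Sum>t\<in>UNIV. frag_of (\<lambda>x. n' u x * c u t, [] @ [m t] @ []))"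
      by (intro form_eq_sum form_eq_d_cmult) (auto intro!: m n')
    finally show "form_eq A 1 (frag_of (\<lambda>x. (h ** N x ** k) $ snd u $ fst u, [\<lambda>x. (h ** M x ** k) $ fst u $ snd u]))
        (\<Sum>t\<in>UNIV. frag_of (\<lambda>x. n' u x * c u t, [m t]))"
      by (simp add: e n'_def)
  qed
  also have "(\<Sum>u\<in>UNIV. \<Sum>t\<in>UNIV. frag_of (\<lambda>x. n' u x * c u t, [m t])) =
      (\<Sum>t\<in>UNIV. \<Sum>u\<in>UNIV. frag_of (\<lambda>x. n' u x * c u t, [m t]))"
    by (rule sum.swap)
  also have "form_eq A 1 \<dots> (\<Sum>t\<in>UNIV. frag_of (\<lambda>x. \<Sum>u\<in>UNIV. n' u x * c u t, [m t]))"
    by (intro form_eq_sum form_eq_sym[OF form_eq_coeff_sum]) (auto intro!: closed_intros m n')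
  also have "\<dots> = trace_form N M"
    by (simp add: trace_form_def coeff m_def)
  finally show ?thesis .
qed

text \<open>The factors are replaced one at a time; wedging with a single symbol is an instance of
  \<open>form_ins\<close>, which respects congruence.\<close>

lemma form_eq_wedge_trace_form:
  fixes N M N' M' N1 M1 N1' M1' :: "'m \<Rightarrow> 'n::finite cmat"
  assumes "form_eq A 1 (trace_form N1 M1) (trace_form N M)"
    and "form_eq A 1 (trace_form N1' M1') (trace_form N' M')"
    and A: "\<And>p q. (\<lambda>x. N x $ p $ q) \<in> A" "\<And>p q. (\<lambda>x. M x $ p $ q) \<in> A"
      "\<And>p q. (\<lambda>x. N1' x $ p $ q) \<in> A" "\<And>p q. (\<lambda>x. M1' x $ p $ q) \<in> A"
  shows "form_eq A 2 (form_scale (\<lambda>_. c) (form_wedge (trace_form N1 M1) (trace_form N1' M1')))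
    (form_scale (\<lambda>_. c) (form_wedge (trace_form N M) (trace_form N' M')))"
proof -
  have "form_eq A 2 (form_wedge (trace_form N1 M1) (trace_form N1' M1'))
      (form_wedge (trace_form N M) (trace_form N1' M1'))"
    unfolding trace_form_def[of N1' M1'] form_wedge_sum_right form_wedge_of_right
    by (intro form_eq_sum form_eq_ins[OF assms(1)]) (auto simp: A)
  also have "form_eq A 2 (form_wedge (trace_form N M) (trace_form N1' M1'))
      (form_wedge (trace_form N M) (trace_form N' M'))"
    unfolding trace_form_def[of N M] form_wedge_sum_left form_wedge_of_left
    by (intro form_eq_sum form_eq_ins[OF assms(2)]) (auto simp: A)
  finally have "form_eq A 2 (form_ins (\<lambda>_. c) [] [] (form_wedge (trace_form N1 M1) (trace_form N1' M1')))
    (form_ins (\<lambda>_. c) [] [] (form_wedge (trace_form N M) (trace_form N' M')))"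
    by (rule form_eq_ins) (auto simp: const_mem)
  then show ?thesis by (simp add: form_scale_eq_ins)
qed

text \<open>Contracting \<tau> \<and> \<tau>' with \<open>X\<close> gives \<tau>(X) \<tau>' -
  \<tau>'(X) \<tau>, and both scalar factors vanish by assumption.\<close>

lemma flat_trace_form_wedge:
  fixes N M N' M' :: "'m \<Rightarrow> 'n::finite cmat"
  assumes N: "\<And>p q. (\<lambda>x. N x $ p $ q) \<in> A" and M: "\<And>p q. (\<lambda>x. M x $ p $ q) \<in> A"
    and N': "\<And>p q. (\<lambda>x. N' x $ p $ q) \<in> A" and M': "\<And>p q. (\<lambda>x. M' x $ p $ q) \<in> A"
    and X: "\<And>f. f \<in> A \<Longrightarrow> X f \<in> A"
    and 0: "\<And>x. (\<Sum>t\<in>UNIV. N x $ snd t $ fst t * X (\<lambda>x. M x $ fst t $ snd t) x) = 0"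
      "\<And>x. (\<Sum>t\<in>UNIV. N' x $ snd t $ fst t * X (\<lambda>x. M' x $ fst t $ snd t) x) = 0"
  shows "flat (form_scale (\<lambda>_. c) (form_wedge (trace_form N M) (trace_form N' M'))) X \<in> null_form A 1"
proof -
  define n where "n t x = N x $ snd t $ fst t" for t x
  define m where "m t x = M x $ fst t $ snd t" for t x
  define n' where "n' t x = N' x $ snd t $ fst t" for t x
  define m' where "m' t x = M' x $ fst t $ snd t" for t x
  note [simp] = n_def[symmetric] m_def[symmetric] n'_def[symmetric] m'_def[symmetric]
  have A: "n t \<in> A" "m t \<in> A" "n' t \<in> A" "m' t \<in> A" for t
    unfolding n_def m_def n'_def m'_def by (rule N M N' M')+
  have z: "(\<Sum>t\<in>UNIV. n t x * X (m t) x) = 0" "(\<Sum>t\<in>UNIV. n' t x * X (m' t) x) = 0" for x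
    using 0[of x] unfolding n_def m_def n'_def m'_def by simp_all
  have "flat (form_scale (\<lambda>_. c) (form_wedge (trace_form N M) (trace_form N' M'))) X =
      (\<Sum>t\<in>UNIV. \<Sum>s\<in>UNIV. frag_of (\<lambda>x. c * (n t x * n' s x) * X (m t) x, [m' s])
        - frag_of (\<lambda>x. c * (n t x * n' s x) * X (m' s) x, [m t]))"
    unfolding form_wedge_trace_form form_sum form_of n_def m_def n'_def m'_def by simp
  also have "\<dots> = (\<Sum>s\<in>UNIV. \<Sum>t\<in>UNIV. frag_of (\<lambda>x. c * (n t x * n' s x) * X (m t) x, [m' s]))
        - (\<Sum>t\<in>UNIV. \<Sum>s\<in>UNIV. frag_of (\<lambda>x. c * (n t x * n' s x) * X (m' s) x, [m t]))"
    by (subst (2) sum.swap) (simp add: sum_subtractf)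
  also have "\<dots> \<in> null_form A 1"
  proof (rule null_form.diff; rule null_form_sum)
    fix s
    have "form_eq A 1 (frag_of (\<lambda>x. \<Sum>t\<in>UNIV. c * (n t x * n' s x) * X (m t) x, [m' s]))
        (\<Sum>t\<in>UNIV. frag_of (\<lambda>x. c * (n t x * n' s x) * X (m t) x, [m' s]))"
      by (intro form_eq_coeff_sum) (auto intro!: closed_intros A X)
    moreover have "(\<Sum>t\<in>UNIV. c * (n t x * n' s x) * X (m t) x) = 0" for x
    proof -
      have "(\<Sum>t\<in>UNIV. c * (n t x * n' s x) * X (m t) x) = c * n' s x * (\<Sum>t\<in>UNIV. n t x * X (m t) x)"
        unfolding sum_distrib_left by (intro sum.cong) (auto simp: mult_ac)
      then show ?thesis by (simp add: z)
    qed
    ultimately show "(\<Sum>t\<in>UNIV. frag_of (\<lambda>x. c * (n t x * n' s x) * X (m t) x, [m' s])) \<in> null_form A 1"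
      using form_eq_trans[OF form_eq_sym form_eq_coeff_0[of "[m' s]" 1]] A by (simp add: form_eq_0)
  next
    fix t
    have "form_eq A 1 (frag_of (\<lambda>x. \<Sum>s\<in>UNIV. c * (n t x * n' s x) * X (m' s) x, [m t]))
        (\<Sum>s\<in>UNIV. frag_of (\<lambda>x. c * (n t x * n' s x) * X (m' s) x, [m t]))"
      by (intro form_eq_coeff_sum) (auto intro!: closed_intros A X)
    moreover have "(\<Sum>s\<in>UNIV. c * (n t x * n' s x) * X (m' s) x) = 0" for x
    proof -
      have "(\<Sum>s\<in>UNIV. c * (n t x * n' s x) * X (m' s) x) = c * n t x * (\<Sum>s\<in>UNIV. n' s x * X (m' s) x)"
        unfolding sum_distrib_left by (intro sum.cong) (auto simp: mult_ac)
      then show ?thesis by (simp add: z)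
    qed
    ultimately show "(\<Sum>s\<in>UNIV. frag_of (\<lambda>x. c * (n t x * n' s x) * X (m' s) x, [m t])) \<in> null_form A 1"
      using form_eq_trans[OF form_eq_sym form_eq_coeff_0[of "[m t]" 1]] A by (simp add: form_eq_0)
  qed
  finally show ?thesis .
qed

text \<open>The Maurer--Cartan equation together with \<open>tr(\<theta> \<and> \<theta>) = 0\<close> shows that \<open>tr(M\<^sup>-\<^sup>1dM)\<close> is closed:
  modulo null forms, \<open>dN \<and> dM\<close> contributes \<open>-N dM N \<and> dM\<close>, whose trace changes sign under the
  exchange of the two factors \<open>N dM\<close>.  In the absence of division by two in the free abelian group,
  the coefficient is halved instead.\<close>

lemma trace_form_closed:
  fixes N M :: "'m \<Rightarrow> 'n::finite cmat"
  assumes N: "\<And>p q. (\<lambda>x. N x $ p $ q) \<in> A" and M: "\<And>p q. (\<lambda>x. M x $ p $ q) \<in> A"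
    and inv: "\<And>x. N x ** M x = mat 1" "\<And>x. M x ** N x = mat 1"
  shows "(\<Sum>t\<in>UNIV. frag_of (\<lambda>_. 1, [\<lambda>x. N x $ snd t $ fst t, \<lambda>x. M x $ fst t $ snd t])) \<in> null_form A 2"
proof -
  define n where "n p q x = N x $ p $ q" for p q x
  define m where "m p q x = M x $ p $ q" for p q x
  have A [simp, intro]: "n p q \<in> A" "m p q \<in> A" for p q
    unfolding n_def m_def by (rule N M)+
  have nm: "(\<Sum>s\<in>UNIV. n p s x * m s r x) = mat 1 $ p $ r" for p r x
    using inv(1)[of x] by (simp add: n_def m_def matrix_matrix_mult_def vec_eq_iff)
  have mn: "(\<Sum>r\<in>UNIV. m s r x * n r q x) = mat 1 $ s $ q" for s q x
    using inv(2)[of x] by (simp add: n_def m_def matrix_matrix_mult_def vec_eq_iff)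
  \<comment> \<open>The differential of the constant matrix \<open>N M = 1\<close>, entry by
    entry.\<close>
  have d_one: "form_eq A 1 ((\<Sum>s\<in>UNIV. frag_of (m s r, [n p s])) + (\<Sum>s\<in>UNIV. frag_of (n p s, [m s r]))) 0" for p r
  proof -
    have "form_eq A 1 (frag_of (\<lambda>_. 1, [] @ [\<lambda>x. \<Sum>s\<in>UNIV. n p s x * m s r x] @ []))
        (\<Sum>s\<in>UNIV. frag_of (\<lambda>_. 1, [] @ [\<lambda>x. n p s x * m s r x] @ []))"
      by (intro form_eq_d_sum) (auto intro!: closed_intros)
    also have "form_eq A 1 \<dots> (\<Sum>s\<in>UNIV. frag_of (\<lambda>x. 1 * n p s x, [] @ [m s r] @ []) + frag_of (\<lambda>x. 1 * m s r x, [] @ [n p s] @ []))"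
      by (intro form_eq_sum form_eq_d_mult) (auto intro!: closed_intros)
    finally have "form_eq A 1 (frag_of (\<lambda>_. 1, [\<lambda>_. mat 1 $ p $ r]))
        ((\<Sum>s\<in>UNIV. frag_of (m s r, [n p s])) + (\<Sum>s\<in>UNIV. frag_of (n p s, [m s r])))"
      by (simp add: nm sum.distrib add.commute)
    moreover have "form_eq A 1 (frag_of (\<lambda>_. 1, [\<lambda>_. mat 1 $ p $ r])) 0"
      using null_form.d_const[of "\<lambda>_. 1" A "[]" "[]" 1] by (simp add: form_eq_0 const_mem)
    ultimately show ?thesis using form_eq_sym form_eq_trans by blast
  qed
  \<comment> \<open>Multiplying the relation \<open>d_one\<close> by \<open>N\<close> on the right
    gives \<open>dN = - N dM N\<close>.\<close>
  have dn: "form_eq A 1 (frag_of (\<lambda>_. 1, [n p q]))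
      (- (\<Sum>v\<in>UNIV. frag_of (\<lambda>x. n (snd v) q x * n p (fst v) x, [m (fst v) (snd v)])))" for p q
  proof -
    define S where "S = (\<Sum>v\<in>UNIV. frag_of (\<lambda>x. n (snd v) q x * n p (fst v) x, [m (fst v) (snd v)]))"
    have S: "S = (\<Sum>r\<in>UNIV. \<Sum>s\<in>UNIV. frag_of (\<lambda>x. n r q x * n p s x, [m s r]))"
      unfolding S_def sum_UNIV_prod[of "\<lambda>s r. frag_of (\<lambda>x. n r q x * n p s x, [m s r])"] by (rule sum.swap)
    have "form_eq A 1 (\<Sum>r\<in>UNIV. form_ins (n r q) [] [] ((\<Sum>s\<in>UNIV. frag_of (m s r, [n p s])) + (\<Sum>s\<in>UNIV. frag_of (n p s, [m s r]))))
        (\<Sum>r\<in>UNIV. form_ins (n r q) [] [] 0)"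
      by (intro form_eq_sum form_eq_ins[OF d_one]) auto
    then have 1: "form_eq A 1 ((\<Sum>s\<in>UNIV. \<Sum>r\<in>UNIV. frag_of (\<lambda>x. m s r x * n r q x, [n p s])) + S) 0"
      unfolding S by (subst sum.swap) (simp add: form_ins_add form_ins_sum sum.distrib mult.commute)
    have "form_eq A 1 (\<Sum>s\<in>UNIV. \<Sum>r\<in>UNIV. frag_of (\<lambda>x. m s r x * n r q x, [n p s]))
        (\<Sum>s\<in>UNIV. frag_of (\<lambda>x. \<Sum>r\<in>UNIV. m s r x * n r q x, [n p s]))"
      by (intro form_eq_sum form_eq_sym[OF form_eq_coeff_sum]) (auto intro!: closed_intros)
    also have "form_eq A 1 \<dots> (\<Sum>s\<in>UNIV. if s = q then frag_of (\<lambda>_. 1, [n p q]) else 0)"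
      by (intro form_eq_sum) (auto simp: mn mat_def intro!: form_eq_coeff_0)
    also have "\<dots> = frag_of (\<lambda>_. 1, [n p q])" by simp
    finally have "form_eq A 1 (frag_of (\<lambda>_. 1, [n p q]) + S) 0"
      using form_eq_trans[OF form_eq_add[OF form_eq_sym form_eq_refl] 1] by blast
    then show ?thesis by (simp add: form_eq_def S_def)
  qed
  \<comment> \<open>Summands of \<open>c\<close> times the trace of \<open>N dM\<close> wedged with
    itself. Exchanging \<open>u\<close> and \<open>v\<close> keeps the coefficient and swaps the two
    differentials.\<close>
  define T where "T c u v = frag_of (\<lambda>x. c * (n (snd v) (fst u) x * n (snd u) (fst v) x),
      [m (fst v) (snd v), m (fst u) (snd u)])" for c u v
  have "form_eq A 2 (frag_of (\<lambda>_. 1, [n (snd u) (fst u), m (fst u) (snd u)])) (- (\<Sum>v\<in>UNIV. T 1 u v))" for u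
    using form_eq_ins[OF dn[of "snd u" "fst u"], of "\<lambda>_. 1" "[]" "[m (fst u) (snd u)]" 2]
    by (simp add: form_ins_minus form_ins_sum T_def const_mem)
  then have "form_eq A 2 (\<Sum>u\<in>UNIV. frag_of (\<lambda>_. 1, [n (snd u) (fst u), m (fst u) (snd u)]))
      (\<Sum>u\<in>UNIV. - (\<Sum>v\<in>UNIV. T 1 u v))"
    by (rule form_eq_sum)
  also have "\<dots> = - (\<Sum>u\<in>UNIV. \<Sum>v\<in>UNIV. T 1 u v)"
    by (simp add: sum_negf)
  also have "form_eq A 2 \<dots> (- (\<Sum>u\<in>UNIV. \<Sum>v\<in>UNIV. T (1/2) u v + T (1/2) u v))"
  proof (intro form_eq_minus form_eq_sum)
    fix u v
    have "form_eq A 2 (frag_of (\<lambda>x. 1/2 * (n (snd v) (fst u) x * n (snd u) (fst v) x) + 1/2 * (n (snd v) (fst u) x * n (snd u) (fst v) x),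
        [m (fst v) (snd v), m (fst u) (snd u)])) (T (1/2) u v + T (1/2) u v)"
      unfolding T_def by (intro form_eq_coeff_add mult_mem const_mem A) auto
    moreover have "T 1 u v = frag_of (\<lambda>x. 1/2 * (n (snd v) (fst u) x * n (snd u) (fst v) x) + 1/2 * (n (snd v) (fst u) x * n (snd u) (fst v) x),
        [m (fst v) (snd v), m (fst u) (snd u)])"
      unfolding T_def by (rule arg_cong[where f = frag_of]) (simp add: fun_eq_iff mult.commute)
    ultimately show "form_eq A 2 (T 1 u v) (T (1/2) u v + T (1/2) u v)"
      by simp
  qed
  \<comment> \<open>The half sum is congruent to its own negative, so the sum of the two halves is
    null.\<close>
  also have "form_eq A 2 \<dots> 0"
  proof -
    have "form_eq A 2 (\<Sum>u\<in>UNIV. \<Sum>v\<in>UNIV. T (1/2) u v) (\<Sum>u\<in>UNIV. \<Sum>v\<in>UNIV. - T (1/2) v u)"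
    proof (intro form_eq_sum)
      fix u v
      have "form_eq A 2 (T (1/2) u v) (- frag_of (\<lambda>x. 1/2 * (n (snd v) (fst u) x * n (snd u) (fst v) x),
          [m (fst u) (snd u), m (fst v) (snd v)]))"
        unfolding T_def by (intro form_eq_swap mult_mem const_mem A)
      then show "form_eq A 2 (T (1/2) u v) (- T (1/2) v u)"
        by (simp add: T_def mult.commute)
    qed
    also have "(\<Sum>u\<in>UNIV. \<Sum>v\<in>UNIV. - T (1/2) v u) = - (\<Sum>u\<in>UNIV. \<Sum>v\<in>UNIV. T (1/2) u v)"
      by (subst sum.swap) (simp add: sum_negf)
    finally show ?thesis
      using null_form_uminus[of "(\<Sum>u\<in>UNIV. \<Sum>v\<in>UNIV. T (1/2) u v) + (\<Sum>u\<in>UNIV. \<Sum>v\<in>UNIV. T (1/2) u v)"]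
      by (simp add: form_eq_def sum.distrib)
  qed
  finally show ?thesis by (simp add: form_eq_0 n_def[abs_def] m_def[abs_def])
qed

text \<open>Leibniz rule for \<tau> \<and> \<tau>', both factors being closed by
  \<open>trace_form_closed\<close>.\<close>

lemma ext_d_trace_form_wedge:
  fixes N M N' M' :: "'m \<Rightarrow> 'n::finite cmat"
  assumes N: "\<And>p q. (\<lambda>x. N x $ p $ q) \<in> A" and M: "\<And>p q. (\<lambda>x. M x $ p $ q) \<in> A"
    and N': "\<And>p q. (\<lambda>x. N' x $ p $ q) \<in> A" and M': "\<And>p q. (\<lambda>x. M' x $ p $ q) \<in> A"
    and inv: "\<And>x. N x ** M x = mat 1" "\<And>x. M x ** N x = mat 1"
      "\<And>x. N' x ** M' x = mat 1" "\<And>x. M' x ** N' x = mat 1"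
  shows "ext_d (form_scale (\<lambda>_. c) (form_wedge (trace_form N M) (trace_form N' M'))) \<in> null_form A 3"
proof -
  define n where "n t x = N x $ snd t $ fst t" for t x
  define m where "m t x = M x $ fst t $ snd t" for t x
  define n' where "n' t x = N' x $ snd t $ fst t" for t x
  define m' where "m' t x = M' x $ fst t $ snd t" for t x
  have A [simp, intro]: "n t \<in> A" "m t \<in> A" "n' t \<in> A" "m' t \<in> A" for t
    unfolding n_def m_def n'_def m'_def by (rule N M N' M')+
  have cl: "form_eq A 2 (\<Sum>t\<in>UNIV. frag_of (\<lambda>_. 1, [n t, m t])) 0"
    "form_eq A 2 (\<Sum>t\<in>UNIV. frag_of (\<lambda>_. 1, [n' t, m' t])) 0"
    unfolding form_eq_0 n_def[abs_def] m_def[abs_def] n'_def[abs_def] m'_def[abs_def]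
    using assms by (intro trace_form_closed; blast)+
  have "ext_d (form_scale (\<lambda>_. c) (form_wedge (trace_form N M) (trace_form N' M'))) =
      (\<Sum>t\<in>UNIV. \<Sum>s\<in>UNIV. frag_of (\<lambda>_. 1, [] @ [\<lambda>x. c * (n t x * n' s x)] @ [m t, m' s]))"
    unfolding form_wedge_trace_form form_sum form_of n_def m_def n'_def m'_def by simp
  also have "form_eq A 3 \<dots> (\<Sum>t\<in>UNIV. \<Sum>s\<in>UNIV. frag_of (\<lambda>x. 1 * c, [] @ [\<lambda>x. n t x * n' s x] @ [m t, m' s]))"
    by (intro form_eq_sum form_eq_d_cmult) (auto intro!: closed_intros)
  also have "form_eq A 3 \<dots> (\<Sum>t\<in>UNIV. \<Sum>s\<in>UNIV. frag_of (\<lambda>x. (1 * c) * n t x, [] @ [n' s] @ [m t, m' s])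
      + frag_of (\<lambda>x. (1 * c) * n' s x, [] @ [n t] @ [m t, m' s]))"
    by (intro form_eq_sum form_eq_d_mult) (auto intro!: closed_intros)
  also have "\<dots> = (\<Sum>t\<in>UNIV. \<Sum>s\<in>UNIV. frag_of (\<lambda>x. c * n t x, [n' s, m t, m' s]))
      + (\<Sum>s\<in>UNIV. \<Sum>t\<in>UNIV. frag_of (\<lambda>x. c * n' s x, [n t, m t, m' s]))"
    by (subst (2) sum.swap) (simp add: sum.distrib)
  \<comment> \<open>Moving the differential of \<open>n' s\<close> past that of \<open>m t\<close>
    makes it adjacent to that of \<open>m' s\<close>, so that the sum over \<open>s\<close> is the
    differential of \<tau>'. The sign is the one in the graded Leibniz rule.\<close>
  also have "form_eq A 3 \<dots> ((\<Sum>t\<in>UNIV. \<Sum>s\<in>UNIV. - frag_of (\<lambda>x. c * n t x, [m t, n' s, m' s]))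
      + (\<Sum>s\<in>UNIV. \<Sum>t\<in>UNIV. frag_of (\<lambda>x. c * n' s x, [n t, m t, m' s])))"
  proof (intro form_eq_add form_eq_sum form_eq_refl)
    fix t s
    have "form_eq A 2 (frag_of (\<lambda>x. c * n t x, [n' s, m t])) (- frag_of (\<lambda>x. c * n t x, [m t, n' s]))"
      by (intro form_eq_swap) (auto intro!: closed_intros)
    from form_eq_ins[OF this, of "\<lambda>_. 1" "[]" "[m' s]" 3]
    show "form_eq A 3 (frag_of (\<lambda>x. c * n t x, [n' s, m t, m' s])) (- frag_of (\<lambda>x. c * n t x, [m t, n' s, m' s]))"
      by (simp add: form_ins_minus const_mem)
  qed
  also have "\<dots> = (\<Sum>t\<in>UNIV. - form_ins (\<lambda>x. c * n t x) [m t] [] (\<Sum>s\<in>UNIV. frag_of (\<lambda>_. 1, [n' s, m' s])))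
      + (\<Sum>s\<in>UNIV. form_ins (\<lambda>x. c * n' s x) [] [m' s] (\<Sum>t\<in>UNIV. frag_of (\<lambda>_. 1, [n t, m t])))"
    by (simp add: form_ins_sum sum_negf)
  also have "form_eq A 3 \<dots> ((\<Sum>t\<in>UNIV. - form_ins (\<lambda>x. c * n t x) [m t] [] 0)
      + (\<Sum>s\<in>UNIV. form_ins (\<lambda>x. c * n' s x) [] [m' s] 0))"
    by (intro form_eq_add form_eq_sum form_eq_minus form_eq_ins[OF cl(1)] form_eq_ins[OF cl(2)]) (auto intro!: closed_intros)
  finally show ?thesis by (simp add: form_eq_0)
qed

end

section \<open>The forms \<open>tr(\<Phi>\<^sub>j\<^sup>-\<^sup>1 d\<Phi>\<^sub>j)\<close> of a moment map\<close>

lemma form_pullback_trace_form_wedge: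
  fixes N M N' M' :: "'m \<Rightarrow> 'n::finite cmat"
  shows "form_pullback \<Psi> (form_scale (\<lambda>_. c) (form_wedge (trace_form N M) (trace_form N' M'))) =
    form_scale (\<lambda>_. c) (form_wedge (trace_form (\<lambda>x. N (\<Psi> x)) (\<lambda>x. M (\<Psi> x)))
      (trace_form (\<lambda>x. N' (\<Psi> x)) (\<lambda>x. M' (\<Psi> x))))"
  by (simp add: form_wedge_trace_form form_sum)

lemma DERIV_trace_mexp:
  "((\<lambda>t. trace (X ** mexp (cscale t \<xi>))) has_field_derivative trace (X ** \<xi>)) (at 0)"
  unfolding trace_def matrix_matrix_mult_def
  by (auto intro!: derivative_eq_intros DERIV_mexp sum.cong)

lemma eval1_form_scale: "eval1 (form_scale f \<omega>) x v = f x * eval1 \<omega> x v"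
  by (rule frag_ext[where \<omega> = \<omega>])
    (auto simp: form_scale_def frag_extend_diff eval1_diff algebra_simps)

lemma form_pullback_scale:
  "form_pullback \<Phi> (form_scale f \<omega>) = form_scale (\<lambda>x. f (\<Phi> x)) (form_pullback \<Phi> \<omega>)"
  by (rule frag_ext[where \<omega> = \<omega>])
    (auto simp: form_scale_def form_pullback_def frag_extend_diff comp_def)

lemma eval2_skew: "eval2 \<omega> x v w = - eval2 \<omega> x w v"
  unfolding eval2_def sum_negf[symmetric] by (intro sum.cong) (auto simp: algebra_simps)

text \<open>A form in \<open>kform A 2\<close> involves only differentials of elements of
  \<open>A\<close>, so vectors normalised differently outside \<open>A\<close> may be
  exchanged.\<close>

lemma eval2_cong:
  assumes "\<omega> \<in> kform A 2" "\<And>f. f \<in> A \<Longrightarrow> v f = v' f" "\<And>f. f \<in> A \<Longrightarrow> w f = w' f"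
  shows "eval2 \<omega> x v w = eval2 \<omega> x v' w'"
  unfolding eval2_def
proof (rule sum.cong[OF refl])
  fix t assume "t \<in> Poly_Mapping.keys \<omega>"
  then obtain a as where t: "t = (a, as)" "set as \<subseteq> A" "length as = 2"
    using assms(1) unfolding kform_def by (cases t) auto
  then have "as ! 0 \<in> A" "as ! 1 \<in> A"
    by (auto intro!: subsetD[OF t(2)] nth_mem)
  with t(1) show "of_int (poly_mapping.lookup \<omega> t) * (case t of (a, as) \<Rightarrow> a x * (v (as ! 0) * w (as ! 1) - v (as ! 1) * w (as ! 0))) =
      of_int (poly_mapping.lookup \<omega> t) * (case t of (a, as) \<Rightarrow> a x * (v' (as ! 0) * w' (as ! 1) - v' (as ! 1) * w' (as ! 0)))"
    using assms(2,3) by simp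
qed

lemma zero_tangent: "(\<lambda>_. 0) \<in> tangent A x"
  by (simp add: tangent_def)

lemma tangent_add:
  "w \<in> tangent A x \<Longrightarrow> w' \<in> tangent A x \<Longrightarrow> (\<lambda>f. w f + w' f) \<in> tangent A x"
  unfolding tangent_def by (simp add: algebra_simps)

lemma tangent_scale: "w \<in> tangent A x \<Longrightarrow> (\<lambda>f. c * w f) \<in> tangent A x"
  unfolding tangent_def by (simp add: algebra_simps)

lemma flat_at_cotangent: "flat_at A \<omega> x v \<in> cotangent A x"
proof -
  have "eval2 \<omega> x v (\<lambda>f. w f + w' f) = eval2 \<omega> x v w + eval2 \<omega> x v w'" for w w'
    unfolding eval2_def sum.distrib[symmetric] by (intro sum.cong) (auto simp: algebra_simps)
  moreover have "eval2 \<omega> x v (\<lambda>f. c * w f) = c * eval2 \<omega> x v w" for w c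
    unfolding eval2_def sum_distrib_left by (intro sum.cong) (auto simp: algebra_simps)
  ultimately show ?thesis
    unfolding cotangent_def flat_at_def by (simp add: tangent_add tangent_scale)
qed

lemma cotangent_lincomb:
  assumes \<alpha>: "\<alpha> \<in> cotangent A x" and w: "\<And>t. t \<in> T \<Longrightarrow> w t \<in> tangent A x"
  shows "(\<lambda>f. \<Sum>t\<in>T. c t * w t f) \<in> tangent A x \<and>
    \<alpha> (\<lambda>f. \<Sum>t\<in>T. c t * w t f) = (\<Sum>t\<in>T. c t * \<alpha> (w t))"
proof -
  have add: "\<alpha> (\<lambda>f. v f + w f) = \<alpha> v + \<alpha> w" if "v \<in> tangent A x" "w \<in> tangent A x" for v w
    using \<alpha> that unfolding cotangent_def by blast
  have scale: "\<alpha> (\<lambda>f. c * v f) = c * \<alpha> v" if "v \<in> tangent A x" for v c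
    using \<alpha> that unfolding cotangent_def by blast
  have 0: "\<alpha> (\<lambda>_. 0) = 0"
    using scale[OF zero_tangent[of A x], of 0] by simp
  show ?thesis
    using w
    by (induction T rule: infinite_finite_induct)
      (simp_all add: zero_tangent tangent_add tangent_scale add scale 0)
qed

section \<open>Standing data and the diagonal blocks of the moment map\<close>

locale central_hamiltonian = central_G_set A G act blk l Gs
  for A :: "('m \<Rightarrow> complex) set" and G :: "('n::finite cmat) set" and act
    and blk :: "'n \<Rightarrow> nat" and l Gs +
  fixes d :: nat and E E' :: "nat \<Rightarrow> 'n cmat"
    and P :: "('m \<Rightarrow> complex) \<Rightarrow> ('m \<Rightarrow> complex) \<Rightarrow> 'm \<Rightarrow> complex"
    and \<Phi> :: "'m \<Rightarrow> 'n cmat" and z :: "nat \<Rightarrow> nat \<Rightarrow> complex"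
  assumes dual: "dual_bases (lie_alg G) d E E'"
    and hamiltonian: "hamiltonian_quasi_Poisson A G act d E E' P \<Phi>"
begin

lemma bivector: "bivector A P"
  and equivariant: "equivariant_morphism A G act \<Phi>"
  and moment: "F \<in> regfun \<Longrightarrow> h \<in> A \<Longrightarrow> P (\<lambda>y. F (\<Phi> y)) h x = inf_act act (D_op d E E' F (\<Phi> x)) h x"
  using hamiltonian unfolding hamiltonian_quasi_Poisson_def quasi_Poisson_def by blast+

lemma \<Phi>_mem: "\<Phi> x \<in> G" and comp_\<Phi>: "F \<in> regfun \<Longrightarrow> (\<lambda>x. F (\<Phi> x)) \<in> A"
  and \<Phi>_act: "g \<in> G \<Longrightarrow> \<Phi> (act g x) = g ** \<Phi> x ** matrix_inv g"
  using equivariant by (auto simp: equivariant_morphism_def)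

lemma invertible_mem: "g \<in> G \<Longrightarrow> invertible g"
  and inv_mem: "g \<in> G \<Longrightarrow> matrix_inv g \<in> G"
  using group by (auto simp: matrix_group_def)

lemma \<Phi>_entry: "(\<lambda>x. \<Phi> x $ p $ q) \<in> A"
  by (rule comp_\<Phi>[OF regfun_entry])

lemma \<Phi>_inv_entry: "(\<lambda>x. matrix_inv (\<Phi> x) $ p $ q) \<in> A"
proof -
  obtain F where "F \<in> regfun" "\<And>g :: 'n cmat. invertible g \<Longrightarrow> F g = matrix_inv g $ p $ q"
    using regfun_matrix_inv_entry by blast
  then show ?thesis
    using comp_\<Phi>[of F] invertible_mem[OF \<Phi>_mem] by simp
qed

definition M :: "nat \<Rightarrow> 'm \<Rightarrow> 'n cmat" where
  "M j x = block_part blk j (\<Phi> x)"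

text \<open>Taken from the inverse of \<Phi> rather than of \<open>M j\<close>, so that its entries
  are regular for the same reason as those of the inverse of \<Phi>; \<open>matrix_inv_M\<close>
  identifies the two.\<close>

definition N :: "nat \<Rightarrow> 'm \<Rightarrow> 'n cmat" where
  "N j x = block_part blk j (matrix_inv (\<Phi> x))"

lemma block_diagonal_G: "g \<in> G \<Longrightarrow> block_diagonal blk g"
  by (rule block_diagonal_mem[OF blocks])

lemma block_part_inv:
  assumes "g \<in> G"
  shows "block_part blk j g ** block_part blk j (matrix_inv g) = mat 1"
    and "block_part blk j (matrix_inv g) ** block_part blk j g = mat 1"
  using assms matrix_inv_mul[OF invertible_mem[OF assms]]
  by (simp_all add: block_part_mult[symmetric] block_diagonal_G inv_mem block_part_mat_1)

lemma MN: "M j x ** N j x = mat 1" and NM: "N j x ** M j x = mat 1"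
  unfolding M_def N_def by (rule block_part_inv[OF \<Phi>_mem])+

lemma matrix_inv_M: "matrix_inv (M j x) = N j x"
  by (rule matrix_inv_eqI[OF MN NM])

lemma M_entry: "(\<lambda>x. M j x $ p $ q) \<in> A" and N_entry: "(\<lambda>x. N j x $ p $ q) \<in> A"
  using \<Phi>_entry[of p q] \<Phi>_inv_entry[of p q]
  by (cases "blk p = j \<and> blk q = j"; auto simp: M_def N_def block_part_def const_mem)+

lemma tr_block_eq: "tr_block blk j \<Phi> = trace_form (N j) (M j)"
proof -
  have "tr_block blk j \<Phi> = (\<Sum>p\<in>UNIV. \<Sum>r\<in>UNIV. frag_of (\<lambda>x. N j x $ p $ r, [\<lambda>x. M j x $ r $ p]))"
    by (simp add: tr_block_def thetaL_def form_sum M_def[symmetric] matrix_inv_M)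
  also have "\<dots> = (\<Sum>r\<in>UNIV. \<Sum>p\<in>UNIV. frag_of (\<lambda>x. N j x $ p $ r, [\<lambda>x. M j x $ r $ p]))"
    by (rule sum.swap)
  finally show ?thesis
    by (simp add: trace_form_def sum_UNIV_prod[of "\<lambda>r p. frag_of (\<lambda>x. N j x $ p $ r, [\<lambda>x. M j x $ r $ p])"])
qed

lemma varpi_eq: "varpi blk l z \<Phi> = (\<Sum>t\<in>pairs. form_scale (\<lambda>_. z (fst t) (snd t))
    (form_wedge (trace_form (N (fst t)) (M (fst t))) (trace_form (N (snd t)) (M (snd t)))))"
  unfolding varpi_def tr_block_eq sum_pairs ..

lemma kform_varpi: "varpi blk l z \<Phi> \<in> kform A 2"
  unfolding varpi_eq by (intro kform_sum kform_trace_form_wedge N_entry M_entry)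

lemma ext_d_varpi: "ext_d (varpi blk l z \<Phi>) \<in> null_form A 3"
  unfolding varpi_eq ext_d_sum
  by (intro null_form_sum ext_d_trace_form_wedge N_entry M_entry MN NM)

text \<open>By equivariance, acting by \<open>g\<close> conjugates \<open>M j\<close> and
  \<open>N j\<close> by block \<open>j\<close> of \<open>g\<close>, and \<open>trace_form\<close> is
  unchanged under conjugation by constant matrices.\<close>

lemma varpi_invariant:
  assumes g: "g \<in> G"
  shows "form_eq A 2 (form_pullback (act g) (varpi blk l z \<Phi>)) (varpi blk l z \<Phi>)"
proof -
  define h where "h j = block_part blk j g" for j
  define k where "k j = block_part blk j (matrix_inv g)" for j
  have hk: "h j ** k j = mat 1" "k j ** h j = mat 1" for j
    unfolding h_def k_def by (rule block_part_inv[OF g])+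
  have "block_diagonal blk (a ** b)" if "block_diagonal blk a" "block_diagonal blk b" for a b
    unfolding block_diagonal_def
  proof (intro allI impI)
    fix p q assume pq: "blk p \<noteq> blk q"
    have "a $ p $ r * b $ r $ q = 0" for r
      using that pq by (cases "blk p = blk r") (auto simp: block_diagonal_def)
    then show "(a ** b) $ p $ q = 0"
      unfolding matrix_matrix_mult_def vec_lambda_beta by (intro sum.neutral ballI)
  qed
  note bd = this block_diagonal_G[OF g] block_diagonal_G[OF inv_mem[OF g]] block_diagonal_G[OF \<Phi>_mem]
  have M: "M j (act g x) = h j ** M j x ** k j" for j x
    by (simp add: M_def h_def k_def \<Phi>_act[OF g] block_part_mult bd)
  have N: "N j (act g x) = h j ** N j x ** k j" for j x
  proof -
    have "M j (act g x) ** (h j ** N j x ** k j) = h j ** (M j x ** (k j ** h j) ** N j x) ** k j"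
      "(h j ** N j x ** k j) ** M j (act g x) = h j ** (N j x ** (k j ** h j) ** M j x) ** k j"
      by (simp_all add: M matrix_mul_assoc)
    then have "matrix_inv (M j (act g x)) = h j ** N j x ** k j"
      by (intro matrix_inv_eqI) (simp_all add: hk MN NM)
    then show ?thesis by (simp add: matrix_inv_M)
  qed
  have "form_eq A 1 (trace_form (\<lambda>x. N j (act g x)) (\<lambda>x. M j (act g x))) (trace_form (N j) (M j))" for j
    unfolding M N by (rule trace_form_conj[OF N_entry M_entry hk])
  then show ?thesis
    unfolding varpi_eq form_pullback_sum form_pullback_trace_form_wedge
    by (intro form_eq_sum form_eq_wedge_trace_form N_entry M_entry)
      (auto intro: comp_act_mem[OF N_entry g] comp_act_mem[OF M_entry g])
qed

text \<open>Infinitesimal form of \<open>M(g x) h = h M(x)\<close>, where \<open>h\<close> is block \<open>j\<close> of \<open>g\<close>: the derivative of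
  \<open>M\<close> along \<open>\<xi>\<close> is a commutator with \<open>M\<close>.\<close>

lemma trace_inf_act:
  assumes \<xi>: "\<xi> \<in> lie_alg G"
  shows "(\<Sum>t\<in>UNIV. N j x $ snd t $ fst t * inf_act act \<xi> (\<lambda>x. M j x $ fst t $ snd t) x) = 0"
proof -
  define g where "g t = mexp (cscale (- t) \<xi>)" for t
  define h where "h t = block_part blk j (g t)" for t
  define D :: "'n cmat" where "D = (\<chi> p q. inf_act act \<xi> (\<lambda>x. M j x $ p $ q) x)"
  \<comment> \<open>The derivative of \<open>h\<close> at 0: the sign comes from the flow of
    \<open>- t\<close>, and the entries outside block \<open>j\<close> vanish because
    \<open>h\<close> is constant there.\<close>
  define H :: "'n cmat" where "H = (\<chi> p q. if blk p = j \<and> blk q = j then - \<xi> $ p $ q else 0)"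
  have g: "g t \<in> G" for t unfolding g_def by (rule mexp_mem[OF \<xi>])
  have g0: "g 0 = mat 1" by (simp add: g_def)
  have h0: "h 0 = mat 1" by (simp add: h_def g0 block_part_mat_1)
  have dM: "((\<lambda>t. M j (act (g t) x) $ p $ q) has_field_derivative D $ p $ q) (at 0)" for p q
    unfolding g_def D_def using DERIV_inf_act[OF M_entry[of j p q] \<xi>, where x = x] by simp
  have dh: "((\<lambda>t. h t $ p $ q) has_field_derivative H $ p $ q) (at 0)" for p q
    using DERIV_mexp_minus[of \<xi> p q] by (auto simp: h_def H_def block_part_def g_def)
  have "M j (act (g t) x) ** h t = h t ** M j x" for t
  proof -
    have "M j (act (g t) x) ** h t = block_part blk j (\<Phi> (act (g t) x) ** g t)"
      by (simp add: M_def h_def block_part_mult block_diagonal_G \<Phi>_mem g)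
    also have "\<Phi> (act (g t) x) ** g t = g t ** \<Phi> x"
      using matrix_inv_mul(2)[OF invertible_mem[OF g]] by (simp add: \<Phi>_act[OF g] matrix_mul_assoc[symmetric])
    finally show ?thesis
      by (simp add: M_def h_def block_part_mult block_diagonal_G \<Phi>_mem g)
  qed
  then have eq: "(\<Sum>r\<in>UNIV. M j (act (g t) x) $ p $ r * h t $ r $ q) = (\<Sum>r\<in>UNIV. h t $ p $ r * M j x $ r $ q)" for t p q
    by (simp add: matrix_matrix_mult_def vec_eq_iff)
  have "D ** h 0 + M j x ** H = H ** M j x"
    unfolding vec_eq_iff
  proof (intro allI)
    fix p q
    have 1: "((\<lambda>t. \<Sum>r\<in>UNIV. M j (act (g t) x) $ p $ r * h t $ r $ q) has_field_derivative
        (D ** h 0 + M j x ** H) $ p $ q) (at 0)"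
      by (auto intro!: derivative_eq_intros dM dh sum.cong
          simp: matrix_matrix_mult_def sum.distrib[symmetric] g0 act_1 algebra_simps)
    have 2: "((\<lambda>t. \<Sum>r\<in>UNIV. h t $ p $ r * M j x $ r $ q) has_field_derivative (H ** M j x) $ p $ q) (at 0)"
      by (auto intro!: derivative_eq_intros dh simp: matrix_matrix_mult_def)
    show "(D ** h 0 + M j x ** H) $ p $ q = (H ** M j x) $ p $ q"
      using 1 2 unfolding eq by (rule DERIV_unique)
  qed
  \<comment> \<open>The product rule at time 0 has shown \<open>D\<close> to be the commutator of
    \<open>H\<close> and \<open>M\<close>; hence the trace of \<open>N D\<close> is tr(H) -
    tr(H).\<close>
  then have "D = H ** M j x - M j x ** H" by (simp add: h0 algebra_simps)
  then have "N j x ** D = N j x ** (H ** M j x) - N j x ** (M j x ** H)"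
    by (simp add: vec_eq_iff matrix_matrix_mult_def right_diff_distrib sum_subtractf)
  also have "N j x ** (M j x ** H) = H" by (simp add: matrix_mul_assoc NM)
  finally have "trace (N j x ** D) = trace (N j x ** (H ** M j x)) - trace H"
    by (simp add: trace_sub)
  also have "trace (N j x ** (H ** M j x)) = trace ((H ** M j x) ** N j x)" by (rule trace_mul_sym)
  also have "(H ** M j x) ** N j x = H ** (M j x ** N j x)" by (simp add: matrix_mul_assoc)
  finally have "trace (N j x ** D) = 0" by (simp add: MN)
  moreover have "trace (N j x ** D) = (\<Sum>q\<in>UNIV. \<Sum>p\<in>UNIV. N j x $ q $ p * D $ p $ q)"
    by (simp add: trace_def matrix_matrix_mult_def)
  moreover have "\<dots> = (\<Sum>p\<in>UNIV. \<Sum>q\<in>UNIV. N j x $ q $ p * D $ p $ q)" by (rule sum.swap)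
  ultimately show ?thesis
    by (simp add: D_def sum_UNIV_prod[of "\<lambda>p q. N j x $ q $ p * inf_act act \<xi> (\<lambda>x. M j x $ p $ q) x"])
qed

lemma flat_varpi:
  assumes "\<xi> \<in> lie_alg G"
  shows "flat (varpi blk l z \<Phi>) (inf_act act \<xi>) \<in> null_form A 1"
  unfolding varpi_eq flat_sum
  by (intro null_form_sum flat_trace_form_wedge N_entry M_entry inf_act_mem trace_inf_act assms)

section \<open>The forms \<tau>_j as functions of tangent vectors\<close>

definition tau :: "nat \<Rightarrow> 'm \<Rightarrow> (('m \<Rightarrow> complex) \<Rightarrow> complex) \<Rightarrow> complex" where
  "tau j x v = eval1 (tr_block blk j \<Phi>) x v"

lemma eval2_varpi:
  "eval2 (varpi blk l z \<Phi>) x v w = (\<Sum>t\<in>pairs. z (fst t) (snd t) *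
    (tau (fst t) x v * tau (snd t) x w - tau (fst t) x w * tau (snd t) x v))"
  by (simp add: varpi_eq eval2_sum eval2_trace_form_wedge tau_def tr_block_eq)

lemma inv_\<Phi>_off_block: "blk p \<noteq> blk q \<Longrightarrow> matrix_inv (\<Phi> x) $ p $ q = 0"
  using block_diagonal_G[OF inv_mem[OF \<Phi>_mem]] by (simp add: block_diagonal_def)

text \<open>The padded block may be replaced by \<Phi> itself: the inverse of \<Phi> vanishes across
  blocks, and \<open>v\<close> kills the constant padding entries. The inner sums are diagonal
  entries of theta^L.\<close>

lemma tau_eq:
  assumes v: "point_derivation A x v"
  shows "tau j x v = (\<Sum>p\<in>UNIV. \<Sum>r\<in>UNIV.
    if blk p = j then matrix_inv (\<Phi> x) $ p $ r * v (\<lambda>y. \<Phi> y $ r $ p) else 0)"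
proof -
  have "tau j x v = (\<Sum>r\<in>UNIV. \<Sum>p\<in>UNIV. N j x $ p $ r * v (\<lambda>y. M j y $ r $ p))"
    by (simp add: tau_def tr_block_eq eval1_trace_form
        sum_UNIV_prod[of "\<lambda>r p. N j x $ p $ r * v (\<lambda>y. M j y $ r $ p)"])
  also have "\<dots> = (\<Sum>p\<in>UNIV. \<Sum>r\<in>UNIV. N j x $ p $ r * v (\<lambda>y. M j y $ r $ p))"
    by (rule sum.swap)
  also have "\<dots> = (\<Sum>p\<in>UNIV. \<Sum>r\<in>UNIV.
      if blk p = j then matrix_inv (\<Phi> x) $ p $ r * v (\<lambda>y. \<Phi> y $ r $ p) else 0)"
  proof (intro sum.cong refl)
    fix p r
    show "N j x $ p $ r * v (\<lambda>y. M j y $ r $ p) =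
        (if blk p = j then matrix_inv (\<Phi> x) $ p $ r * v (\<lambda>y. \<Phi> y $ r $ p) else 0)"
      using inv_\<Phi>_off_block[of p r x]
      by (auto simp: N_def M_def block_part_def pd_const[OF v])
  qed
  finally show ?thesis .
qed

text \<open>The companion formula with diagonal entries of theta^R. Exchanging the indices moves the
  block condition from one index to the other, which is harmless where the inverse is
  nonzero.\<close>

lemma tau_eq':
  assumes v: "point_derivation A x v"
  shows "tau j x v = (\<Sum>p\<in>UNIV. \<Sum>r\<in>UNIV.
    if blk p = j then matrix_inv (\<Phi> x) $ r $ p * v (\<lambda>y. \<Phi> y $ p $ r) else 0)"
proof -
  have "tau j x v = (\<Sum>p\<in>UNIV. \<Sum>r\<in>UNIV.
      if blk r = j then matrix_inv (\<Phi> x) $ p $ r * v (\<lambda>y. \<Phi> y $ r $ p) else 0)"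
    unfolding tau_eq[OF v] by (intro sum.cong refl) (metis inv_\<Phi>_off_block mult_zero_left)
  then show ?thesis by (subst (asm) sum.swap)
qed

lemma tau_linear:
  "tau j x (\<lambda>f. v f + w f) = tau j x v + tau j x w"
  "tau j x (\<lambda>f. c * v f) = c * tau j x v"
  by (simp_all add: tau_def tr_block_eq eval1_trace_form sum.distrib sum_distrib_left algebra_simps)

lemma tau_cong: "(\<And>f. f \<in> A \<Longrightarrow> v f = w f) \<Longrightarrow> tau j x v = tau j x w"
  by (simp add: tau_def tr_block_eq eval1_trace_form M_entry)

lemma tau_infl:
  assumes "i \<in> indices"
  shows "tau j x (\<lambda>f. infl i f x) = 0"
  unfolding tau_def tr_block_eq eval1_trace_form Inf_field_def
  by (rule trace_inf_act[OF block_id_mem[OF assms]])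

text \<open>Serves the injectivity condition: the pullback of theta^L determines every
  \<tau>_j.\<close>

lemma tau_thetaL:
  assumes "point_derivation A x v"
  shows "tau j x v = (\<Sum>p\<in>UNIV. if blk p = j then thetaL_at \<Phi> x v $ p $ p else 0)"
  unfolding tau_eq[OF assms]
  by (intro sum.cong refl) (simp add: thetaL_at_def thetaL_def form_sum eval1_sum)

text \<open>At a given point \<open>x\<close>, \<open>tr(\<Phi>\<^sub>j\<^sup>-\<^sup>1 d\<Phi>\<^sub>j)\<close> is the differential of the regular function
  \<open>g \<mapsto> tr(1\<^sub>j \<Phi>(x)\<^sup>-\<^sup>1 g)\<close>, whose image under \<open>D\<close> at \<open>\<Phi>(x)\<close> is \<open>1\<^sub>j\<close>.\<close>

lemma tau_moment:
  assumes j: "j \<in> indices" and h: "h \<in> A"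
  shows "tau j x (\<lambda>f. P f h x) = infl j h x"
proof -
  define C where "C = block_id blk j ** matrix_inv (\<Phi> x)"
  define F :: "'n cmat \<Rightarrow> complex" where "F g = trace (C ** g)" for g
  have F: "F = (\<lambda>g. \<Sum>p\<in>UNIV. \<Sum>r\<in>UNIV. C $ p $ r * g $ r $ p)"
    by (rule ext) (simp add: F_def trace_def matrix_matrix_mult_def)
  have reg: "F \<in> regfun"
    unfolding F regfun_def
    by (intro gen_alg_sum gen_alg_cmult) (rule regfun_entry[unfolded regfun_def])
  have pd: "point_derivation A x (\<lambda>f. P f h x)"
    by (rule point_derivation_bivector'[OF bivector h])
  have "tau j x (\<lambda>f. P f h x) = (\<Sum>p\<in>UNIV. \<Sum>r\<in>UNIV. C $ p $ r * P (\<lambda>y. \<Phi> y $ r $ p) h x)"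
    unfolding tau_eq[OF pd] C_def block_id_mult by (intro sum.cong) auto
  also have "\<dots> = P (\<lambda>y. F (\<Phi> y)) h x"
  proof -
    have "P (\<lambda>y. \<Sum>p\<in>UNIV. \<Sum>r\<in>UNIV. C $ p $ r * \<Phi> y $ r $ p) h x =
        (\<Sum>p\<in>UNIV. P (\<lambda>y. \<Sum>r\<in>UNIV. C $ p $ r * \<Phi> y $ r $ p) h x)"
      by (rule pd_sum[OF pd]) (intro closed_intros \<Phi>_entry)
    also have "\<dots> = (\<Sum>p\<in>UNIV. \<Sum>r\<in>UNIV. C $ p $ r * P (\<lambda>y. \<Phi> y $ r $ p) h x)"
      by (intro sum.cong refl pd_lincomb[OF pd] \<Phi>_entry)
    finally show ?thesis by (simp add: F)
  qed
  also have "\<dots> = inf_act act (D_op d E E' F (\<Phi> x)) h x"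
    by (rule moment[OF reg h])
  also have "D_op d E E' F (\<Phi> x) = block_id blk j"
  proof -
    have inv: "matrix_inv (\<Phi> x) ** \<Phi> x = mat 1" "\<Phi> x ** matrix_inv (\<Phi> x) = mat 1"
      by (rule matrix_inv_mul[OF invertible_mem[OF \<Phi>_mem]])+
    \<comment> \<open>Both products equal 1_j, as 1_j commutes with the block-diagonal matrix
      \<Phi>(x). Left and right derivatives of \<open>F\<close> therefore agree, and the factor 1/2
      in \<open>D_op\<close> averages two equal terms.\<close>
    have C1: "C ** \<Phi> x = block_id blk j"
      using inv by (simp add: C_def matrix_mul_assoc[symmetric])
    have C2: "\<Phi> x ** C = block_id blk j"
      unfolding C_def matrix_mul_assoc block_id_commute[OF block_diagonal_G[OF \<Phi>_mem], symmetric]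
      using inv by (simp add: matrix_mul_assoc[symmetric])
    have L: "left_der \<xi> F (\<Phi> x) = trace (block_id blk j ** \<xi>)" for \<xi>
      unfolding left_der_def F_def matrix_mul_assoc C1 by (rule DERIV_imp_deriv[OF DERIV_trace_mexp])
    have R: "right_der \<xi> F (\<Phi> x) = trace (block_id blk j ** \<xi>)" for \<xi>
    proof -
      have "F (g ** \<Phi> x) = trace (block_id blk j ** g)" for g
        unfolding F_def matrix_mul_assoc
        by (subst trace_mul_sym) (simp add: matrix_mul_assoc C2)
      then show ?thesis
        unfolding right_der_def by (simp add: DERIV_imp_deriv[OF DERIV_trace_mexp])
    qed
    obtain c where c: "block_id blk j = (\<Sum>a<d. cscale (c a) (E' a))"
      using dual block_id_mem[OF j] unfolding dual_bases_def complex_basis_def by blast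
    \<comment> \<open>Pairing with \<open>E a\<close> extracts the coefficient of
      \<open>E' a\<close>; the same pairing is the coefficient in \<open>D_op\<close>.\<close>
    have "c a = trace (block_id blk j ** E a)" if a: "a < d" for a
    proof -
      have "trace (block_id blk j ** E a) = trace (E a ** block_id blk j)"
        by (rule trace_mul_sym)
      also have "\<dots> = (\<Sum>b<d. c b * tr_form (E a) (E' b))"
        unfolding c tr_form_def trace_def matrix_matrix_mult_def
        by (simp add: sum_component sum_distrib_left mult_ac)
          (simp only: sum.swap[of _ "{..<d}"])
      also have "\<dots> = (\<Sum>b<d. if b = a then c a else 0)"
        using dual a by (intro sum.cong) (auto simp: dual_bases_def)
      finally show ?thesis using a by simp
    qed
    then show ?thesis
      unfolding D_op_def L R by (subst c) (auto intro!: sum.cong simp: field_simps)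
  qed
  finally show ?thesis by (simp add: Inf_field_def)
qed

section \<open>The perturbed bivector as a map on covectors\<close>

definition flow :: "nat \<Rightarrow> 'm \<Rightarrow> ('m \<Rightarrow> complex) \<Rightarrow> complex" where
  "flow j x = inf_act_at A act (block_id blk j) x"

lemma flow_eq: "f \<in> A \<Longrightarrow> flow j x f = infl j f x"
  by (simp add: flow_def inf_act_at_def Inf_field_def)

lemma flow_tangent:
  assumes "j \<in> indices"
  shows "flow j x \<in> tangent A x"
  using tangentI[OF point_derivation_derivation[OF derivation_Inf[OF assms]], of x]
  unfolding flow_def inf_act_at_def Inf_field_def .

lemma tau_flow: "i \<in> indices \<Longrightarrow> tau j x (flow i x) = 0"
  using tau_cong[of "flow i x" "\<lambda>f. infl i f x"] by (simp add: flow_eq tau_infl)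

text \<open>The tangent vector on which \<open>sharp_at\<close> evaluates a covector to obtain the
  \<open>h\<close>-component of its image; up to sign the Hamiltonian vector of
  \<open>h\<close>.\<close>

definition slot :: "('m \<Rightarrow> complex) \<Rightarrow> 'm \<Rightarrow> ('m \<Rightarrow> complex) \<Rightarrow> complex" where
  "slot h x = (\<lambda>f. if f \<in> A then P f h x else 0)"

lemma slot_tangent: "h \<in> A \<Longrightarrow> slot h x \<in> tangent A x"
  unfolding slot_def by (intro tangentI point_derivation_bivector'[OF bivector])

lemma tau_slot:
  assumes "j \<in> indices" "h \<in> A"
  shows "tau j x (slot h x) = infl j h x"
  using tau_cong[of "slot h x" "\<lambda>f. P f h x"] tau_moment[OF assms] by (simp add: slot_def)

text \<open>For fixed \<open>h\<close>, the vector paired with \<alpha> is \<open>slot h x\<close>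
  plus a combination of the vectors \<open>flow j x\<close>, so only the values of \<alpha> on these
  enter the correction.\<close>

lemma sharp_add_psi:
  assumes \<alpha>: "\<alpha> \<in> cotangent A x" and h: "h \<in> A"
  shows "sharp_at A (bivector_add P (psi act blk l z)) x \<alpha> h = \<alpha> (slot h x) +
    (\<Sum>t\<in>pairs. z (fst t) (snd t) * (\<alpha> (flow (fst t) x) * infl (snd t) h x - \<alpha> (flow (snd t) x) * infl (fst t) h x))"
proof -
  define c where "c t = z (fst t) (snd t) * infl (snd t) h x" for t
  define c' where "c' t = - z (fst t) (snd t) * infl (fst t) h x" for t
  define v where "v = (\<lambda>f. \<Sum>t\<in>pairs. c t * flow (fst t) x f)"
  define v' where "v' = (\<lambda>f. \<Sum>t\<in>pairs. c' t * flow (snd t) x f)"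
  have v: "v \<in> tangent A x" "\<alpha> v = (\<Sum>t\<in>pairs. c t * \<alpha> (flow (fst t) x))"
    unfolding v_def
    using cotangent_lincomb[OF \<alpha>, of pairs "\<lambda>t. flow (fst t) x" c] flow_tangent pairs_mem by blast+
  have v': "v' \<in> tangent A x" "\<alpha> v' = (\<Sum>t\<in>pairs. c' t * \<alpha> (flow (snd t) x))"
    unfolding v'_def
    using cotangent_lincomb[OF \<alpha>, of pairs "\<lambda>t. flow (snd t) x" c'] flow_tangent pairs_mem by blast+
  have add: "\<alpha> (\<lambda>f. v f + w f) = \<alpha> v + \<alpha> w" if "v \<in> tangent A x" "w \<in> tangent A x" for v w
    using \<alpha> that unfolding cotangent_def by blast
  have "(\<lambda>f. if f \<in> A then bivector_add P (psi act blk l z) f h x else 0) = (\<lambda>f. slot h x f + (v f + v' f))"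
  proof
    fix f
    show "(if f \<in> A then bivector_add P (psi act blk l z) f h x else 0) = slot h x f + (v f + v' f)"
    proof (cases "f \<in> A")
      case True
      then show ?thesis
        by (simp add: bivector_add_def psi_eq slot_def v_def v'_def c_def c'_def flow_eq wedge2_def
            sum.distrib[symmetric] algebra_simps)
    next
      case False
      then have "flow j x f = 0" for j by (simp add: flow_def inf_act_at_def)
      with False show ?thesis by (simp add: slot_def v_def v'_def)
    qed
  qed
  then have "sharp_at A (bivector_add P (psi act blk l z)) x \<alpha> h = \<alpha> (slot h x) + (\<alpha> v + \<alpha> v')"
    using h by (simp add: sharp_at_def add slot_tangent v v' tangent_add)
  then show ?thesis
    unfolding v v' by (simp add: c_def c'_def sum.distrib[symmetric] algebra_simps)
qed

lemma sharp_at_slot: "h \<in> A \<Longrightarrow> sharp_at A P x \<alpha> h = \<alpha> (slot h x)"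
  by (simp add: sharp_at_def slot_def)

text \<open>Since \<open>P\<^sup>\<sharp>\<close> maps \<open>tr(\<Phi>\<^sub>j\<^sup>-\<^sup>1 d\<Phi>\<^sub>j)\<close> to \<open>Inf\<^bsup>(j)\<^esup>\<close>, the contribution of \<open>\<psi>\<close> can be absorbed into the covector.\<close>

lemma nondegenerate_add_psi:
  assumes "nondegenerate A G act P"
  shows "nondegenerate A G act (bivector_add P (psi act blk l z))"
  unfolding nondegenerate_def
proof (intro allI subsetI)
  fix x u assume "u \<in> tangent A x"
  then obtain \<alpha> \<xi> where \<alpha>: "\<alpha> \<in> cotangent A x" and \<xi>: "\<xi> \<in> lie_alg G"
    and u: "u = (\<lambda>f. sharp_at A P x \<alpha> f + inf_act_at A act \<xi> x f)"
    using assms unfolding nondegenerate_def by fastforce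
  \<comment> \<open>The correction is a combination of the \<tau>_j, which vanish on all
    \<open>flow i x\<close>. So \<beta> and \<alpha> agree on the flows, \<psi> contributes the same
    for both, and the image of the correction under \<open>P\<close> cancels that
    contribution.\<close>
  define \<beta> where "\<beta> v = (if v \<in> tangent A x then \<alpha> v - (\<Sum>t\<in>pairs. z (fst t) (snd t) *
      (\<alpha> (flow (fst t) x) * tau (snd t) x v - \<alpha> (flow (snd t) x) * tau (fst t) x v)) else 0)" for v
  have lin: "\<alpha> (\<lambda>f. v f + w f) = \<alpha> v + \<alpha> w" "\<alpha> (\<lambda>f. c * v f) = c * \<alpha> v"
    if "v \<in> tangent A x" "w \<in> tangent A x" for v w c
    using \<alpha> that unfolding cotangent_def by blast+
  have \<beta>: "\<beta> \<in> cotangent A x"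
    unfolding cotangent_def \<beta>_def
    by (auto simp: tangent_add tangent_scale lin tau_linear sum_subtractf[symmetric]
        sum.distrib[symmetric] sum_distrib_left algebra_simps)
  have "\<beta> (flow i x) = \<alpha> (flow i x)" if "i \<in> indices" for i
    using that by (simp add: \<beta>_def flow_tangent tau_flow)
  moreover have "\<beta> (slot h x) = \<alpha> (slot h x) - (\<Sum>t\<in>pairs. z (fst t) (snd t) *
      (\<alpha> (flow (fst t) x) * infl (snd t) h x - \<alpha> (flow (snd t) x) * infl (fst t) h x))" if "h \<in> A" for h
    using that by (simp add: \<beta>_def slot_tangent tau_slot pairs_mem)
  ultimately have "sharp_at A (bivector_add P (psi act blk l z)) x \<beta> h = sharp_at A P x \<alpha> h" for h
    by (cases "h \<in> A") (simp_all add: sharp_add_psi[OF \<beta>] sharp_at_slot pairs_mem, simp_all add: sharp_at_def)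
  then show "u \<in> (\<lambda>(\<alpha>, \<xi>) f. sharp_at A (bivector_add P (psi act blk l z)) x \<alpha> f + inf_act_at A act \<xi> x f)
      ` (cotangent A x \<times> lie_alg G)"
    using \<beta> \<xi> u by (intro image_eqI[of _ _ "(\<beta>, \<xi>)"]) auto
qed

section \<open>The perturbed 2-form and its correspondence with the perturbed bivector\<close>

lemma quasi_Hamiltonian_add_varpi:
  assumes "quasi_Hamiltonian A G act \<omega> \<Phi>"
  shows "quasi_Hamiltonian A G act (\<omega> + varpi blk l z \<Phi>) \<Phi>"
proof -
  have \<omega>: "\<omega> \<in> kform A 2" "\<And>g. g \<in> G \<Longrightarrow> form_eq A 2 (form_pullback (act g) \<omega>) \<omega>"
    "form_eq A 3 (ext_d \<omega>) (form_pullback \<Phi> eta)"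
    "\<And>\<xi>. \<xi> \<in> lie_alg G \<Longrightarrow> form_eq A 1 (flat \<omega> (inf_act act \<xi>))
        (form_scale (\<lambda>_. 1/2) (form_pullback \<Phi> (tr_pair \<xi> (\<lambda>p q. thetaL p q + thetaR p q))))"
    "\<And>x. inj_on (\<lambda>v. (flat_at A \<omega> x v, thetaL_at \<Phi> x v)) (tangent A x)"
    using assms unfolding quasi_Hamiltonian_def by blast+
  have drop: "form_eq A k (\<alpha> + \<beta>) \<gamma>" if "form_eq A k \<alpha> \<gamma>" "\<beta> \<in> null_form A k" for k \<alpha> \<beta> and \<gamma> :: "'m form"
    using form_eq_add[OF that(1), of \<beta> 0] that(2) by (simp add: form_eq_0)
  have inj: "inj_on (\<lambda>v. (flat_at A (\<omega> + varpi blk l z \<Phi>) x v, thetaL_at \<Phi> x v)) (tangent A x)" for x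
  proof (rule inj_onI)
    fix v w assume vw: "v \<in> tangent A x" "w \<in> tangent A x"
      and "(flat_at A (\<omega> + varpi blk l z \<Phi>) x v, thetaL_at \<Phi> x v) =
        (flat_at A (\<omega> + varpi blk l z \<Phi>) x w, thetaL_at \<Phi> x w)"
    then have eq: "flat_at A (\<omega> + varpi blk l z \<Phi>) x v = flat_at A (\<omega> + varpi blk l z \<Phi>) x w"
      "thetaL_at \<Phi> x v = thetaL_at \<Phi> x w" by simp_all
    have pd: "point_derivation A x v" "point_derivation A x w"
      using vw by (simp_all add: tangent_iff)
    \<comment> \<open>Equal second components give equal \<tau>_j, so \<open>varpi\<close>
      contributes the same amount for \<open>v\<close> and \<open>w\<close> and can be
      cancelled.\<close>
    have tau: "tau j x v = tau j x w" for j
      unfolding tau_thetaL[OF pd(1)] tau_thetaL[OF pd(2)] eq(2) ..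
    have "flat_at A \<omega> x v = flat_at A \<omega> x w"
    proof
      fix u
      show "flat_at A \<omega> x v u = flat_at A \<omega> x w u"
        using fun_cong[OF eq(1), of u] by (auto simp: flat_at_def eval2_add eval2_varpi tau)
    qed
    with eq(2) \<omega>(5) vw show "v = w" by (auto dest: inj_onD)
  qed
  show ?thesis
    unfolding quasi_Hamiltonian_def
    by (intro conjI ballI allI)
      (simp_all add: kform_add \<omega>(1) kform_varpi equivariant inj form_add form_eq_add \<omega>(2) varpi_invariant
        drop[OF \<omega>(3) ext_d_varpi] drop[OF \<omega>(4) flat_varpi] del: One_nat_def)
qed

lemma corresponding_add:
  assumes qH: "quasi_Hamiltonian A G act \<omega> \<Phi>" and cor: "corresponding A act d E E' P \<omega> \<Phi>"
  shows "corresponding A act d E E' (bivector_add P (psi act blk l z)) (\<omega> + varpi blk l z \<Phi>) \<Phi>"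
proof -
  have \<omega>: "\<omega> \<in> kform A 2"
    "\<And>\<xi>. \<xi> \<in> lie_alg G \<Longrightarrow> form_eq A 1 (flat \<omega> (inf_act act \<xi>))
        (form_scale (\<lambda>_. 1/2) (form_pullback \<Phi> (tr_pair \<xi> (\<lambda>p q. thetaL p q + thetaR p q))))"
    using qH unfolding quasi_Hamiltonian_def by blast+
  \<comment> \<open>The moment map condition of \<omega> at 1_i: theta^L and theta^R both pair with
    1_i to \<tau>_i, so half their sum is \<tau>_i. The sign comes from placing the flow in the
    second argument.\<close>
  have \<omega>_flow: "eval2 \<omega> x v (flow i x) = - tau i x v" if v: "v \<in> tangent A x" and i: "i \<in> indices" for x v i
  proof -
    have pd: "point_derivation A x v" using v by (simp add: tangent_iff)
    have "eval2 \<omega> x (flow i x) v = eval2 \<omega> x (\<lambda>f. infl i f x) v"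
      by (rule eval2_cong[OF \<omega>(1)]) (simp_all add: flow_eq)
    also have "\<dots> = eval1 (flat \<omega> (infl i)) x v"
      by (simp add: eval1_flat)
    also have "\<dots> = eval1 (form_scale (\<lambda>_. 1/2) (form_pullback \<Phi> (tr_pair (block_id blk i) (\<lambda>p q. thetaL p q + thetaR p q)))) x v"
      using eval1_null_form[OF \<omega>(2)[OF block_id_mem[OF i], unfolded form_eq_def One_nat_def] pd]
      by (simp add: eval1_diff Inf_field_def)
    also have "\<dots> = (\<Sum>p\<in>UNIV. \<Sum>q\<in>UNIV. 1/2 * (block_id blk i $ p $ q *
        ((\<Sum>r\<in>UNIV. matrix_inv (\<Phi> x) $ q $ r * v (\<lambda>y. \<Phi> y $ r $ p))
         + (\<Sum>r\<in>UNIV. matrix_inv (\<Phi> x) $ r $ p * v (\<lambda>y. \<Phi> y $ q $ r)))))"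
    proof -
      have L: "eval1 (form_pullback \<Phi> (thetaL q p)) x v =
          (\<Sum>r\<in>UNIV. matrix_inv (\<Phi> x) $ q $ r * v (\<lambda>y. \<Phi> y $ r $ p))" for p q
        by (simp add: thetaL_def form_sum eval1_sum)
      have R: "eval1 (form_pullback \<Phi> (thetaR q p)) x v =
          (\<Sum>r\<in>UNIV. matrix_inv (\<Phi> x) $ r $ p * v (\<lambda>y. \<Phi> y $ q $ r))" for p q
        by (simp add: thetaR_def form_sum eval1_sum)
      show ?thesis
        by (simp add: tr_pair_def form_sum form_add eval1_sum eval1_form_scale form_pullback_scale eval1_add L R)
    qed
    also have "\<dots> = (\<Sum>p\<in>UNIV. \<Sum>q\<in>UNIV. if q = p then (if blk p = i then 1/2 *
        ((\<Sum>r\<in>UNIV. matrix_inv (\<Phi> x) $ p $ r * v (\<lambda>y. \<Phi> y $ r $ p))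
         + (\<Sum>r\<in>UNIV. matrix_inv (\<Phi> x) $ r $ p * v (\<lambda>y. \<Phi> y $ p $ r))) else 0) else 0)"
      by (intro sum.cong refl) (auto simp: block_id_def)
    also have "\<dots> = 1/2 * (tau i x v + tau i x v)"
    proof -
      have "tau i x v + tau i x v = (\<Sum>p\<in>UNIV. if blk p = i then
        ((\<Sum>r\<in>UNIV. matrix_inv (\<Phi> x) $ p $ r * v (\<lambda>y. \<Phi> y $ r $ p))
         + (\<Sum>r\<in>UNIV. matrix_inv (\<Phi> x) $ r $ p * v (\<lambda>y. \<Phi> y $ p $ r))) else 0)"
        by (subst tau_eq[OF pd], subst tau_eq'[OF pd])
          (simp add: sum.distrib[symmetric], intro sum.cong refl, simp add: sum.distrib)
      then show ?thesis
        by (simp add: sum_divide_distrib, intro sum.cong refl, simp)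
    qed
    finally show ?thesis
      using eval2_skew[of \<omega> x v "flow i x"] by simp
  qed
  show ?thesis
    unfolding corresponding_def
  proof (intro allI ballI)
    fix x v assume v: "v \<in> tangent A x"
    define \<beta> where "\<beta> = flat_at A (\<omega> + varpi blk l z \<Phi>) x v"
    have \<beta>: "\<beta> \<in> cotangent A x" unfolding \<beta>_def by (rule flat_at_cotangent)
    \<comment> \<open>Only \<omega> contributes: each term of \<open>varpi\<close> evaluated here
      contains some \<tau>_j on a flow vector, which is 0.\<close>
    have "\<beta> (flow i x) = - tau i x v" if "i \<in> indices" for i
      using that v by (simp add: \<beta>_def flat_at_def flow_tangent eval2_add \<omega>_flow eval2_varpi tau_flow)
    moreover have "\<beta> (slot h x) = flat_at A \<omega> x v (slot h x) + (\<Sum>t\<in>pairs. z (fst t) (snd t) *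
        (tau (fst t) x v * infl (snd t) h x - infl (fst t) h x * tau (snd t) x v))" if "h \<in> A" for h
      using that by (simp add: \<beta>_def flat_at_def slot_tangent eval2_add eval2_varpi tau_slot pairs_mem)
    \<comment> \<open>The \<psi>-terms, formed with the values - \<tau>_i on the flows, are opposite
      to the \<open>varpi\<close>-terms in the value on \<open>slot h x\<close>. The right-hand side
      of the correspondence does not involve \<open>z\<close>, so it is inherited from
      \<open>P\<close> and \<omega>.\<close>
    ultimately have "sharp_at A (bivector_add P (psi act blk l z)) x \<beta> h = sharp_at A P x (flat_at A \<omega> x v) h" for h
      by (cases "h \<in> A")
        (simp_all add: sharp_add_psi[OF \<beta>] sharp_at_slot pairs_mem sum.distrib[symmetric] algebra_simps,
          simp_all add: sharp_at_def)
    then have "sharp_at A (bivector_add P (psi act blk l z)) x \<beta> = sharp_at A P x (flat_at A \<omega> x v)" by blast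
    with cor v show "sharp_at A (bivector_add P (psi act blk l z)) x (flat_at A (\<omega> + varpi blk l z \<Phi>) x v) =
        (\<lambda>f. v f - 1/4 * (\<Sum>a<d.
           eval1 (form_pullback \<Phi> (tr_pair (E' a) (\<lambda>p q. thetaL p q - thetaR p q))) x v *
           inf_act_at A act (E a) x f))"
      unfolding corresponding_def \<beta>_def by simp
  qed
qed

end

theorem proposition3p6:
  fixes A :: "('m \<Rightarrow> complex) set"
    and G :: "(complex^'n^'n) set"
    and act :: "complex^'n^'n \<Rightarrow> 'm \<Rightarrow> 'm"
    and d :: nat and E E' :: "nat \<Rightarrow> complex^'n^'n"
    and P :: "('m \<Rightarrow> complex) \<Rightarrow> ('m \<Rightarrow> complex) \<Rightarrow> 'm \<Rightarrow> complex"
    and \<Phi> :: "'m \<Rightarrow> complex^'n^'n"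
    and l :: nat and blk :: "'n::finite \<Rightarrow> nat" and Gs :: "nat \<Rightarrow> (complex^'n^'n) set"
    and z :: "nat \<Rightarrow> nat \<Rightarrow> complex"
  assumes "reductive_group G"
    and "tr_form_nondegenerate (lie_alg G)"
    and "dual_bases (lie_alg G) d E E'"
    and "affine_variety A"
    and "algebraic_action A G act"
    and "block_decomposition blk l Gs G"
    and "central_scalars blk l Gs"
    and "hamiltonian_quasi_Poisson A G act d E E' P \<Phi>"
  shows "hamiltonian_quasi_Poisson A G act d E E' (bivector_add P (psi act blk l z)) \<Phi> \<and>
    (\<forall>\<omega>. nondegenerate A G act P \<and> quasi_Hamiltonian A G act \<omega> \<Phi> \<and>
          corresponding A act d E E' P \<omega> \<Phi> \<longrightarrow>
       nondegenerate A G act (bivector_add P (psi act blk l z)) \<and>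
       quasi_Hamiltonian A G act (\<omega> + varpi blk l z \<Phi>) \<Phi> \<and>
       corresponding A act d E E' (bivector_add P (psi act blk l z)) (\<omega> + varpi blk l z \<Phi>) \<Phi>)"
proof -
  interpret central_hamiltonian A G act blk l Gs d E E' P \<Phi> z
    by unfold_locales (use assms in \<open>auto simp: affine_variety_def reductive_group_def\<close>)
  show ?thesis
    using hamiltonian_quasi_Poisson_add_psi[OF assms(8)] nondegenerate_add_psi
      quasi_Hamiltonian_add_varpi corresponding_add by blast
qed

end
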